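(* Let $L_W>0$, $U(x)=\frac{x^4}{4}-\frac{x^2}{2}$ and $W(x)=L_W\frac{x^2}{2}$ on $\mathbb{R}$, let $\sigma_c>0$ be the critical parameter of the nonlinear limit (defined in the context), and let $\sigma_0\in(0,\sigma_c)$. There exists $c_0>0$ such that for all $(\delta,p)$, with $\delta>0$ and $p\ge 2$ an integer, satisfying $\frac{\delta}{p-1}\le c_0$, denoting $$\sigma_c^{eff}=\sigma_c\left(1-\frac{\delta L_W}{2(p-1)}\right),$$ the following phase transition holds for the effective dynamics with parameters $\delta,p$ (defined in the context): - For all $\sigma\ge\sigma_c^{eff}$, there exists a unique stationary distribution $\mu^{\delta,p}_{\sigma,0}$ for the effective dynamics with diffusion coefficient $\sigma$. Furthermore, $\mu^{\delta,p}_{\sigma,0}$ is symmetric. - For all $\sigma\in[\sigma_0,\sigma_c^{eff})$, there exist exactly three stationary distributions for the effective dynamics with diffusion coefficient $\sigma$. One is symmetric, also denoted $\mu^{\delta,p}_{\sigma,0}$, and the other two, denoted $\mu^{\delta,p}_{\sigma,+}$ and $\mu^{\delta,p}_{\sigma,-}$, satisfy $\pm\int x\,d\mu^{\delta,p}_{\sigma,\pm}(x)>0$.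
   Context: Nonlinear limit (NL) and $\sigma_c$. For $\sigma>0$, (NL) is the one-dimensional McKean-Vlasov SDE $$d\bar X_t=-U'(\bar X_t)dt-W'\ast\bar\rho_t(\bar X_t)dt+\sqrt{2\sigma}\,dB_t,\qquad \bar\rho_t=\mathrm{Law}(\bar X_t),$$ with $B$ a standard Brownian motion. Its stationary distributions are the probability measures $\mu$ on $\mathbb{R}$ solving $$\mu(dx)=\frac{\exp\left(-\frac1\sigma\left(U(x)+W\ast\mu(x)\right)\right)}{\int_{\mathbb R}\exp\left(-\frac1\sigma\left(U(y)+W\ast\mu(y)\right)\right)dy}\,dx .$$ It is known (Tugaut) that there is a unique $\sigma_c>0$ (depending on $L_W$) such that: for $\sigma\ge\sigma_c$, (NL) has a unique stationary distribution, and it is symmetric; for $0<\sigma<\sigma_c$, (NL) has exactly three stationary distributions, one symmetric and two others with respectively positive and negative mean. This defines $\sigma_c$. Effective dynamics. For $\sigma>0$, $\delta>0$ and an integer $p\ge2$, the effective dynamics is the nonlinear SDE $$dX_t=-U'(X_t)dt-W'\ast\rho_t(X_t)dt+\left(2\sigma+\frac{\delta}{p-1}\Sigma(X_t,\rho_t)\right)^{1/2}dB_t,\qquad \rho_t=\mathrm{Law}(X_t),$$ where $\Sigma(x,\rho)=(W')^2\ast\rho(x)-(W'\ast\rho(x))^2$; for $W(x)=L_W\frac{x^2}{2}$, $\Sigma(x,\rho)=L_W^2\,\mathrm{Var}(\rho)$. Write $\kappa_1(\mu)=\int x\,\mu(dx)$ and $\kappa_2(\mu)=\int (x-\kappa_1(\mu))^2\mu(dx)$.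 The stationary distributions of the effective dynamics (with parameters $\sigma,\delta,p$) are the probability measures $\mu$ on $\mathbb{R}$ solving $$\mu(dx)=\frac{\exp\left(-\frac{2}{2\sigma+\frac{\delta L_W^2}{p-1}\kappa_2(\mu)}\left(U(x)+\frac{L_W}{2}|x-\kappa_1(\mu)|^2\right)\right)}{\int_{\mathbb R}\exp\left(-\frac{2}{2\sigma+\frac{\delta L_W^2}{p-1}\kappa_2(\mu)}\left(U(y)+\frac{L_W}{2}|y-\kappa_1(\mu)|^2\right)\right)dy}\,dx .$$ A measure on $\mathbb{R}$ is symmetric if it is invariant under $x\mapsto -x$. *)

theory Defs
  imports "HOL-Probability.Probability"
begin

definition double_well :: "real \<Rightarrow> real" where
  "double_well x = x ^ 4 / 4 - x ^ 2 / 2"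

definition quad_interaction :: "real \<Rightarrow> real \<Rightarrow> real" where
  "quad_interaction L x = L * x ^ 2 / 2"

definition conv_measure :: "(real \<Rightarrow> real) \<Rightarrow> real measure \<Rightarrow> real \<Rightarrow> real" where
  "conv_measure W \<mu> x = (LINT y|\<mu>. W (x - y))"

definition mean :: "real measure \<Rightarrow> real" where
  "mean \<mu> = (LINT x|\<mu>. x)"

definition second_cumulant :: "real measure \<Rightarrow> real" where
  "second_cumulant \<mu> = (LINT x|\<mu>. (x - mean \<mu>) ^ 2)"

definition borel_prob :: "real measure \<Rightarrow> bool" where
  "borel_prob \<mu> \<longleftrightarrow> prob_space \<mu> \<and> sets \<mu> = sets borel"

definition symmetric_measure :: "real measure \<Rightarrow> bool" where
  "symmetric_measure \<mu> \<longleftrightarrow> distr \<mu> borel uminus = \<mu>"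

definition gibbs :: "real \<Rightarrow> (real \<Rightarrow> real) \<Rightarrow> real measure" where
  "gibbs \<beta> V = density lborel
     (\<lambda>x. ennreal (exp (- \<beta> * V x) / (LINT y|lborel. exp (- \<beta> * V y))))"

text \<open>Stationary distributions of the McKean-Vlasov equation with drift
  \<open>- U' - W' * \<rho>\<close> and constant diffusion coefficient \<open>\<sigma>\<close>, given by the
  self-consistency equation for their density. The integrability condition says that
  \<open>W * \<mu>\<close> is finite; it is needed because the Bochner integral of a non-integrable
  function is \<open>0\<close> by convention.\<close>

definition nl_stationary ::
  "(real \<Rightarrow> real) \<Rightarrow> (real \<Rightarrow> real) \<Rightarrow> real \<Rightarrow> real measure \<Rightarrow> bool" where
  "nl_stationary U W \<sigma> \<mu> \<longleftrightarrow>
     borel_prob \<mu> \<and> (\<forall>x. integrable \<mu> (\<lambda>y. W (x - y))) \<and>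
     \<mu> = gibbs (1 / \<sigma>) (\<lambda>x. U x + conv_measure W \<mu> x)"

text \<open>Stationary distributions of the effective dynamics for \<open>W x = L * x ^ 2 / 2\<close>,
  where the squared diffusion coefficient is
  \<open>2 * \<sigma> + \<delta> / (p - 1) * L ^ 2 * Var \<rho>\<close>. Finiteness of the second moment makes
  the mean and the variance meaningful.\<close>

definition eff_stationary ::
  "(real \<Rightarrow> real) \<Rightarrow> real \<Rightarrow> real \<Rightarrow> nat \<Rightarrow> real \<Rightarrow> real measure \<Rightarrow> bool" where
  "eff_stationary U L \<delta> p \<sigma> \<mu> \<longleftrightarrow>
     borel_prob \<mu> \<and> integrable \<mu> (\<lambda>x. x ^ 2) \<and>
     \<mu> = gibbs (2 / (2 * \<sigma> + \<delta> * L ^ 2 / (real p - 1) * second_cumulant \<mu>))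
            (\<lambda>x. U x + L / 2 * \<bar>x - mean \<mu>\<bar> ^ 2)"

definition one_symmetric :: "real measure set \<Rightarrow> bool" where
  "one_symmetric S \<longleftrightarrow> (\<exists>\<mu>\<^sub>0. S = {\<mu>\<^sub>0} \<and> symmetric_measure \<mu>\<^sub>0)"

definition three_phases :: "real measure set \<Rightarrow> bool" where
  "three_phases S \<longleftrightarrow> (\<exists>\<mu>\<^sub>0 \<mu>\<^sub>p \<mu>\<^sub>m.
     S = {\<mu>\<^sub>0, \<mu>\<^sub>p, \<mu>\<^sub>m} \<and> distinct [\<mu>\<^sub>0, \<mu>\<^sub>p, \<mu>\<^sub>m] \<and>
     symmetric_measure \<mu>\<^sub>0 \<and> mean \<mu>\<^sub>p > 0 \<and> mean \<mu>\<^sub>m < 0)"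

text \<open>At most one \<open>\<sigma>\<^sub>c\<close> can satisfy this, since the two regimes exclude each
  other; its existence for every \<open>L > 0\<close> is a theorem of Tugaut.\<close>

definition critical_parameter :: "real \<Rightarrow> real \<Rightarrow> bool" where
  "critical_parameter L \<sigma>\<^sub>c \<longleftrightarrow> \<sigma>\<^sub>c > 0 \<and>
     (\<forall>\<sigma>\<ge>\<sigma>\<^sub>c. one_symmetric {\<mu>. nl_stationary double_well (quad_interaction L) \<sigma> \<mu>}) \<and>
     (\<forall>\<sigma>. 0 < \<sigma> \<and> \<sigma> < \<sigma>\<^sub>c \<longrightarrow>
        three_phases {\<mu>. nl_stationary double_well (quad_interaction L) \<sigma> \<mu>})"

end

theory Submission
  imports Defs
begin

text \<open>
  Write \<open>L\<close> for \<open>L\<^sub>W\<close>. Completing the square shows that every stationary distribution, of either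
  dynamics, is a tilted measure with density proportional to
  \<open>exp (h * x - (x ^ 4 / 4 + (L - 1) * x\<^sup>2 / 2) / s)\<close>, where \<open>h = L * m / s\<close>, \<open>m\<close> is the mean and
  \<open>s\<close> is a temperature. The requirement that its mean be \<open>s * h / L\<close> is the same in both cases. For
  the nonlinear limit the temperature is \<open>\<sigma>\<close>; for the effective dynamics it solves
  \<open>s = \<sigma> + \<epsilon> * V\<close>, where \<open>V\<close> is the variance of the measure and
  \<open>\<epsilon> = \<delta> * L\<^sup>2 / (2 * (p - 1))\<close>. The effective stationary distributions for \<open>\<sigma>\<close> are
  therefore the nonlinear-limit states at those temperatures \<open>s\<close> for which \<open>s - \<epsilon> * V\<close> takes the
  value \<open>\<sigma>\<close>, and it remains to see that \<open>s - \<epsilon> * V\<close> increases strictly along each branch of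
  states when \<open>\<epsilon>\<close> is small.

  On the symmetric branch this follows because \<open>V / s\<close> does not increase with the temperature
  (\<open>variance_over_temperature_mono\<close>), which bounds the growth of \<open>V\<close> on all of
  \<open>[\<sigma>\<^sub>0, \<infinity>)\<close>.

  The branch with \<open>h > 0\<close> lives on \<open>s < \<sigma>\<^sub>c\<close>. There \<open>h\<close> behaves like a square root at
  \<open>\<sigma>\<^sub>c\<close>, so it is \<open>h\<^sup>2\<close> that has to be controlled. Integration by parts turns the equation for
  \<open>h \<noteq> 0\<close> into the statement that the ratio of the third to the first moment is \<open>1\<close>
  (\<open>self_consistent_iff_cubic_ratio\<close>). This ratio extends to \<open>h = 0\<close>, is Lipschitz in \<open>1 / s\<close>, and
  increases with \<open>h \<ge> 0\<close> at least as fast as a positive multiple of \<open>h\<^sup>2\<close>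
  (\<open>cubic_ratio_strict_mono_quantitative\<close>); the latter replaces the GHS inequality and comes down to
  a total positivity property of \<open>sinh z / z\<close> (\<open>sinhc_total_positivity\<close>). Hence \<open>h\<^sup>2\<close>, and with
  it \<open>V\<close>, is a Lipschitz function of \<open>s\<close> up to and including \<open>\<sigma>\<^sub>c\<close>
  (\<open>branch_variance_lipschitz\<close>).

  Both branches meet at \<open>s = \<sigma>\<^sub>c\<close>. By compactness the ratio is \<open>1\<close> at \<open>h = 0\<close> there
  (\<open>critical_cubic_ratio\<close>), which says \<open>V = \<sigma>\<^sub>c / L\<close>; so \<open>s - \<epsilon> * V\<close> equals
  \<open>\<sigma>\<^sub>c * (1 - \<epsilon> / L)\<close> at the junction, and this is the effective critical parameter.
\<close>

section \<open>Hyperbolic inequalities\<close>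

definition sinhc :: "real \<Rightarrow> real" where
  "sinhc z = (if z = 0 then 1 else sinh z / z)"

lemma sinhc_minus [simp]: "sinhc (- z) = sinhc z"
  by (simp add: sinhc_def)

lemma sinhc_0 [simp]: "sinhc 0 = 1"
  by (simp add: sinhc_def)

lemma mult_sinhc: "z * sinhc z = sinh z"
  by (simp add: sinhc_def)

lemma sinhc_abs [simp]: "sinhc \<bar>z\<bar> = sinhc z"
  by (simp add: abs_if)

lemma isCont_sinhc: "isCont sinhc z"
proof (cases "z = 0")
  case False
  have "isCont (\<lambda>z. sinh z / z) z"
    using False by (intro continuous_intros) auto
  moreover have "\<forall>\<^sub>F x in nhds z. sinh x / x = sinhc x"
    using t1_space_nhds[OF False] by eventually_elim (simp add: sinhc_def)
  ultimately show ?thesis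
    using isCont_cong[of "\<lambda>z. sinh z / z" sinhc z] by simp
next
  case True
  have "((\<lambda>h. (sinh (0 + h) - sinh 0) / h) \<longlongrightarrow> cosh 0) (at (0::real))"
    using has_field_derivative_sinh[OF DERIV_ident, of "0::real" UNIV] unfolding DERIV_def by simp
  then have "((\<lambda>h. sinh h / h) \<longlongrightarrow> 1) (at (0::real))" by simp
  then have "(sinhc \<longlongrightarrow> 1) (at (0::real))"
    by (rule Lim_transform_eventually) (simp add: eventually_at_filter sinhc_def)
  then show ?thesis
    using True by (simp add: isCont_def)
qed

lemma continuous_on_sinhc [continuous_intros]:
  "continuous_on A f \<Longrightarrow> continuous_on A (\<lambda>x. sinhc (f x))"
proof -
  assume "continuous_on A f"
  moreover have "continuous_on UNIV sinhc"
    by (simp add: continuous_at_imp_continuous_on isCont_sinhc)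
  ultimately show ?thesis
    by (auto intro: continuous_on_compose2)
qed

lemma sinhc_measurable [measurable]: "sinhc \<in> borel_measurable borel"
  by (intro borel_measurable_continuous_onI continuous_on_sinhc continuous_on_id)

lemma cosh_le_exp_abs: "cosh (z::real) \<le> exp \<bar>z\<bar>"
proof -
  have "exp z \<le> exp \<bar>z\<bar>" "exp (- z) \<le> exp \<bar>z\<bar>" by simp_all
  then show ?thesis unfolding cosh_field_def by argo
qed

text \<open>Every coefficient of the power series of the right-hand side is nonnegative, so the sum is at
  least its cubic term.\<close>

lemma sinh_mono_quadratic_remainder:
  assumes "0 \<le> v" "v \<le> (u::real)"
  shows "u * v * (u\<^sup>2 - v\<^sup>2) / 6 \<le> v * sinh u - u * sinh v"
proof -
  define f where "f n = v * (if even n then 0 else u ^ n /\<^sub>R fact n)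
    - u * (if even n then 0 else v ^ n /\<^sub>R fact n)" for n
  have f: "f sums (v * sinh u - u * sinh v)"
    unfolding f_def by (intro sums_diff sums_mult sinh_converges)
  have nn: "0 \<le> f n" for n
  proof (cases "even n")
    case False
    then obtain k where n: "n = Suc k" by (cases n) auto
    have "v ^ k \<le> u ^ k" using assms by (intro power_mono)
    then have "(u * v) * v ^ k \<le> (u * v) * u ^ k" using assms by (intro mult_left_mono) auto
    then have "u * v ^ n \<le> v * u ^ n" unfolding n by (simp add: mult_ac)
    then show ?thesis using False
      by (simp add: f_def field_simps)
  qed (simp add: f_def)
  \<comment> \<open>Up to degree 3 only the cubic terms survive: the linear ones cancel.\<close>
  have "sum f {..3} \<le> suminf f"
    using f nn by (intro sum_le_suminf) (auto simp: sums_iff)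
  moreover have "sum f {..3} = u * v * (u\<^sup>2 - v\<^sup>2) / 6"
    proof -
    have "{..3::nat} = {0, 1, 2, 3}" by auto
    then show ?thesis
      by (simp add: f_def fact_numeral) (simp add: power2_eq_square power3_eq_cube field_simps)
  qed
  ultimately show ?thesis using f by (simp add: sums_iff)
qed

text \<open>The series of \<open>sinhc z - z\<^sup>2 / 6\<close> in \<open>z\<^sup>2\<close> has nonnegative coefficients, so the function grows
  on \<open>z \<ge> 0\<close>. The endpoint \<open>v = 0\<close>, where dividing by \<open>v\<close> is not possible, is a limit.\<close>

lemma sinhc_diff_ge:
  assumes "0 \<le> v" "v \<le> u"
  shows "(u\<^sup>2 - v\<^sup>2) / 6 \<le> sinhc u - sinhc v"
proof -
  have pos: "(u\<^sup>2 - v\<^sup>2) / 6 \<le> sinhc u - sinhc v" if "0 < v" "v \<le> u" for v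
  proof -
    have "(u * v) * ((u\<^sup>2 - v\<^sup>2) / 6) \<le> (u * v) * (sinhc u - sinhc v)"
      using sinh_mono_quadratic_remainder[of v u] that
      by (simp add: sinhc_def right_diff_distrib)
    moreover have "0 < u * v" using that by simp
    ultimately show ?thesis by (rule mult_left_le_imp_le)
  qed
  show ?thesis
  proof (cases "v = 0")
    case True
    show ?thesis
    proof (cases "u = 0")
      case False
      then have u: "0 < u" using assms True by simp
      have "((\<lambda>v. sinhc u - sinhc v - (u\<^sup>2 - v\<^sup>2) / 6) \<longlongrightarrow> sinhc u - sinhc 0 - (u\<^sup>2 - 0\<^sup>2) / 6) (at_right 0)"
        using isCont_sinhc[of 0] unfolding isCont_def
        by (intro tendsto_intros) (auto intro: tendsto_mono[OF at_le])
      moreover have "\<forall>\<^sub>F v in at_right 0. 0 \<le> sinhc u - sinhc v - (u\<^sup>2 - v\<^sup>2) / 6"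
        using eventually_at_right_less[of 0] eventually_at_right_real[OF u]
        by eventually_elim (use pos in \<open>force simp: algebra_simps\<close>)
      ultimately have "0 \<le> sinhc u - sinhc 0 - (u\<^sup>2 - 0\<^sup>2) / 6"
        by (intro tendsto_lowerbound) auto
      then show ?thesis using True by simp
    qed (use True in simp)
  qed (use assms pos in auto)
qed

lemma sinhc_ge_1: "1 \<le> sinhc z"
proof -
  have "z\<^sup>2 / 6 \<le> sinhc z - 1" using sinhc_diff_ge[of 0 "\<bar>z\<bar>"] by simp
  moreover have "0 \<le> z\<^sup>2 / 6" by simp
  ultimately show ?thesis by linarith
qed

lemma sinhc_le_cosh: "sinhc z \<le> cosh z"
proof -
  have "sinhc z \<le> cosh z" if "z > 0" for z
  proof -
    have "(sinh has_real_derivative cosh x) (at x)" for x :: real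
      by (auto intro!: derivative_eq_intros)
    then have "\<exists>\<xi>>0. \<xi> < z \<and> sinh z - sinh 0 = (z - 0) * cosh \<xi>"
      using MVT2[of 0 z sinh cosh] that by blast
    then obtain \<xi> where "\<xi> > 0" "\<xi> < z" "sinh z = z * cosh \<xi>" by auto
    then show ?thesis
      using that by (simp add: sinhc_def cosh_real_nonneg_le_iff)
  qed
  from this[of "\<bar>z\<bar>"] show ?thesis
    by (cases "z = 0") auto
qed

lemma sinhc_le_exp_abs: "sinhc z \<le> exp \<bar>z\<bar>"
  using sinhc_le_cosh cosh_le_exp_abs order_trans by blast

text \<open>Convexity of \<open>t \<mapsto> t ^ k\<close> on \<open>t \<ge> 0\<close>, in the form of increments over intervals of equal length.\<close>

lemma power_second_difference:
  fixes A B C D :: real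
  assumes "A - B = C - D" "D \<le> B" "0 \<le> D" "B \<le> A"
  shows "C ^ k - D ^ k \<le> A ^ k - B ^ k"
proof -
  have "(C - D) * (\<Sum>i<k. D ^ (k - Suc i) * C ^ i) \<le> (A - B) * (\<Sum>i<k. B ^ (k - Suc i) * A ^ i)"
    using assms by (intro mult_mono sum_mono power_mono sum_nonneg mult_nonneg_nonneg) auto
  then show ?thesis
    by (simp add: power_diff_sumr2 mult_ac)
qed

text \<open>As a function of \<open>z\<^sup>2\<close>, \<open>cosh z\<close> is a power series with nonnegative coefficients. All its terms
  are convex, and the quartic one alone contributes the lower bound.\<close>

lemma cosh_second_difference:
  fixes P Q p q :: real
  assumes "P\<^sup>2 - Q\<^sup>2 = p\<^sup>2 - q\<^sup>2" "q\<^sup>2 \<le> Q\<^sup>2" "Q\<^sup>2 \<le> P\<^sup>2"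
  shows "(P\<^sup>2 - Q\<^sup>2) * (Q\<^sup>2 - q\<^sup>2) / 12 \<le> cosh P - cosh Q - (cosh p - cosh q)"
proof -
  define c :: "real \<Rightarrow> nat \<Rightarrow> real" where "c z n = (if even n then z ^ n /\<^sub>R fact n else 0)" for z n
  define f where "f n = c P n - c Q n - (c p n - c q n)" for n
  have f: "f sums (cosh P - cosh Q - (cosh p - cosh q))"
    unfolding f_def c_def by (intro sums_diff cosh_converges)
  have nn: "0 \<le> f n" for n
  proof (cases "even n")
    case True
    then obtain k where n: "n = 2 * k" by blast
    have "p ^ n - q ^ n \<le> P ^ n - Q ^ n"
      using power_second_difference[of "P\<^sup>2" "Q\<^sup>2" "p\<^sup>2" "q\<^sup>2" k] assms
      by (simp add: n power_mult)
    moreover have "f n = ((P ^ n - Q ^ n) - (p ^ n - q ^ n)) / fact n"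
      using True by (simp add: f_def c_def divide_simps)
    ultimately show ?thesis by simp
  qed (simp add: f_def c_def)
  \<comment> \<open>The quadratic terms cancel because the two differences of squares are equal.\<close>
  have "sum f {..4} \<le> suminf f"
    using f nn by (intro sum_le_suminf) (auto simp: sums_iff)
  moreover have "sum f {..4} = (P\<^sup>2 - Q\<^sup>2) * (Q\<^sup>2 - q\<^sup>2) / 12"
  proof -
    define d where "d = P\<^sup>2 - Q\<^sup>2"
    have e: "P\<^sup>2 = Q\<^sup>2 + d" "p\<^sup>2 = q\<^sup>2 + d" using assms by (auto simp: d_def)
    have pw: "z ^ 4 = (z\<^sup>2)\<^sup>2" for z :: real by simp
    have f3: "fact 4 = (24::real)" by (simp add: eval_nat_numeral)
    have "{..4::nat} = {0, 1, 2, 3, 4}" by auto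
    then have "sum f {..4} = (P\<^sup>2 - Q\<^sup>2 - (p\<^sup>2 - q\<^sup>2)) / 2 + (P ^ 4 - Q ^ 4 - (p ^ 4 - q ^ 4)) / 24"
      by (simp add: f_def c_def f3 fact_numeral) (simp add: field_simps)
    also have "\<dots> = d * (Q\<^sup>2 - q\<^sup>2) / 12"
      unfolding pw e by (simp add: power2_eq_square field_simps)
    finally show ?thesis by (simp add: d_def)
  qed
  ultimately show ?thesis using f by (simp add: sums_iff)
qed

text \<open>The products of \<open>sinh\<close> are differences of \<open>cosh\<close> at \<open>h * x \<plusminus> k * y\<close> and \<open>k * x \<plusminus> h * y\<close>. The
  squares of these arguments differ by the same amount \<open>(h\<^sup>2 - k\<^sup>2) * (x\<^sup>2 - y\<^sup>2)\<close> for both signs,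
  so the second-difference bound for \<open>cosh\<close> applies.\<close>

lemma sinhc_total_positivity_aux:
  assumes "0 \<le> k" "k \<le> h" "0 \<le> y" "y \<le> x"
  shows "(h\<^sup>2 - k\<^sup>2) * (x\<^sup>2 - y\<^sup>2) / 6
    \<le> sinhc (h * x) * sinhc (k * y) - sinhc (k * x) * sinhc (h * y)"
proof (cases "k = 0 \<or> y = 0")
  case True
  then show ?thesis
  proof
    assume "k = 0"
    then show ?thesis
      using sinhc_diff_ge[of "h * y" "h * x"] assms
      by (simp add: mult_left_mono power_mult_distrib algebra_simps)
  next
    assume "y = 0"
    then show ?thesis
      using sinhc_diff_ge[of "k * x" "h * x"] assms
      by (simp add: mult_right_mono power_mult_distrib algebra_simps)
  qed
next
  case False
  then have pos: "0 < k" "0 < h" "0 < y" "0 < x" using assms by auto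
  have sq: "k\<^sup>2 \<le> h\<^sup>2" "y\<^sup>2 \<le> x\<^sup>2" using assms by (auto intro: power_mono)
  have 1: "(h * x + k * y)\<^sup>2 - (k * x + h * y)\<^sup>2 = (h\<^sup>2 - k\<^sup>2) * (x\<^sup>2 - y\<^sup>2)"
    by (simp add: power2_eq_square algebra_simps)
  have 2: "(h * x - k * y)\<^sup>2 - (k * x - h * y)\<^sup>2 = (h\<^sup>2 - k\<^sup>2) * (x\<^sup>2 - y\<^sup>2)"
    by (simp add: power2_eq_square algebra_simps)
  have 3: "(k * x + h * y)\<^sup>2 - (k * x - h * y)\<^sup>2 = 4 * (h * k * x * y)"
    by (simp add: power2_eq_square algebra_simps)
  have nn: "0 \<le> (h\<^sup>2 - k\<^sup>2) * (x\<^sup>2 - y\<^sup>2)" "0 \<le> h * k * x * y"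
    using sq pos by simp_all
  have "(h\<^sup>2 - k\<^sup>2) * (x\<^sup>2 - y\<^sup>2) * (4 * (h * k * x * y)) / 12
      \<le> cosh (h * x + k * y) - cosh (k * x + h * y) - (cosh (h * x - k * y) - cosh (k * x - h * y))"
    using cosh_second_difference[of "h * x + k * y" "k * x + h * y" "h * x - k * y" "k * x - h * y"]
      1 2 3 nn by auto
  also have "\<dots> = 2 * (sinh (h * x) * sinh (k * y) - sinh (k * x) * sinh (h * y))"
    by (simp add: cosh_add cosh_diff)
  also have "\<dots> = (h * k * x * y) * (2 * (sinhc (h * x) * sinhc (k * y) - sinhc (k * x) * sinhc (h * y)))"
    by (simp add: mult_sinhc[symmetric] algebra_simps)
  also have "(h\<^sup>2 - k\<^sup>2) * (x\<^sup>2 - y\<^sup>2) * (4 * (h * k * x * y)) / 12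
      = (h * k * x * y) * ((h\<^sup>2 - k\<^sup>2) * (x\<^sup>2 - y\<^sup>2) / 3)"
    by simp
  finally have "(h * k * x * y) * ((h\<^sup>2 - k\<^sup>2) * (x\<^sup>2 - y\<^sup>2) / 3)
      \<le> (h * k * x * y) * (2 * (sinhc (h * x) * sinhc (k * y) - sinhc (k * x) * sinhc (h * y)))" .
  moreover have "0 < h * k * x * y" using pos by simp
  ultimately have "(h\<^sup>2 - k\<^sup>2) * (x\<^sup>2 - y\<^sup>2) / 3
      \<le> 2 * (sinhc (h * x) * sinhc (k * y) - sinhc (k * x) * sinhc (h * y))"
    by (rule mult_left_le_imp_le)
  then show ?thesis by simp
qed

text \<open>Multiplying by \<open>x\<^sup>2 - y\<^sup>2\<close> makes the inequality symmetric in \<open>x\<close> and \<open>y\<close> and even in each, so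
  that it holds on the whole plane and can be integrated against a product weight.\<close>

lemma sinhc_total_positivity:
  assumes "0 \<le> k" "k \<le> h"
  shows "(h\<^sup>2 - k\<^sup>2) * (x\<^sup>2 - y\<^sup>2)\<^sup>2 / 6
    \<le> (x\<^sup>2 - y\<^sup>2) * (sinhc (h * x) * sinhc (k * y) - sinhc (k * x) * sinhc (h * y))"
proof -
  have main: "(h\<^sup>2 - k\<^sup>2) * (x\<^sup>2 - y\<^sup>2)\<^sup>2 / 6
    \<le> (x\<^sup>2 - y\<^sup>2) * (sinhc (h * x) * sinhc (k * y) - sinhc (k * x) * sinhc (h * y))"
    if "0 \<le> y" "y \<le> x" for x y
  proof -
    have "0 \<le> x\<^sup>2 - y\<^sup>2" using that by (simp add: power_mono)
    then have "(x\<^sup>2 - y\<^sup>2) * ((h\<^sup>2 - k\<^sup>2) * (x\<^sup>2 - y\<^sup>2) / 6) \<le>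
      (x\<^sup>2 - y\<^sup>2) * (sinhc (h * x) * sinhc (k * y) - sinhc (k * x) * sinhc (h * y))"
      by (intro mult_left_mono sinhc_total_positivity_aux assms that)
    then show ?thesis by (simp add: power2_eq_square mult_ac)
  qed
  have [simp]: "sinhc (c * \<bar>z\<bar>) = sinhc (c * z)" for c z
    by (cases "0 \<le> z") (simp_all add: abs_if)
  show ?thesis
  proof (cases "\<bar>y\<bar> \<le> \<bar>x\<bar>")
    case True
    then show ?thesis using main[of "\<bar>y\<bar>" "\<bar>x\<bar>"] by simp
  next
    case False
    then have "(h\<^sup>2 - k\<^sup>2) * (y\<^sup>2 - x\<^sup>2)\<^sup>2 / 6
      \<le> (y\<^sup>2 - x\<^sup>2) * (sinhc (h * y) * sinhc (k * x) - sinhc (k * y) * sinhc (h * x))"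
      using main[of "\<bar>x\<bar>" "\<bar>y\<bar>"] by simp
    then show ?thesis by (simp add: power2_commute algebra_simps)
  qed
qed

text \<open>The bound is in terms of \<open>u\<^sup>2 - v\<^sup>2\<close>, not \<open>u - v\<close>: moments must be Lipschitz in the square of the
  tilt, because only the square is a Lipschitz function of the temperature.\<close>

lemma abs_cosh_diff_le:
  assumes "\<bar>u\<bar> \<le> (H::real)" "\<bar>v\<bar> \<le> H"
  shows "\<bar>cosh u - cosh v\<bar> \<le> \<bar>u\<^sup>2 - v\<^sup>2\<bar> * exp H"
proof -
  have sinh_le: "\<bar>sinh z\<bar> \<le> \<bar>z\<bar> * cosh z" for z :: real
    using mult_left_mono[OF sinhc_le_cosh[of z], of "\<bar>z\<bar>"] sinhc_ge_1[of z]
    by (simp add: mult_sinhc[symmetric] abs_mult)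
  have "cosh u - cosh v = 2 * (sinh ((u + v) / 2) * sinh ((u - v) / 2))"
  proof -
    have "cosh u = cosh ((u + v) / 2 + (u - v) / 2)" "cosh v = cosh ((u + v) / 2 - (u - v) / 2)"
      by (simp_all add: field_simps)
    then show ?thesis unfolding cosh_add cosh_diff by simp
  qed
  then have "\<bar>cosh u - cosh v\<bar> = 2 * (\<bar>sinh ((u + v) / 2)\<bar> * \<bar>sinh ((u - v) / 2)\<bar>)"
    by (simp add: abs_mult)
  also have "\<dots> \<le> 2 * ((\<bar>(u + v) / 2\<bar> * cosh ((u + v) / 2)) * (\<bar>(u - v) / 2\<bar> * cosh ((u - v) / 2)))"
    by (intro mult_left_mono mult_mono sinh_le) auto
  also have "\<dots> = \<bar>u\<^sup>2 - v\<^sup>2\<bar> * (cosh ((u + v) / 2) * cosh ((u - v) / 2)) / 2"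
  proof -
    have "u\<^sup>2 - v\<^sup>2 = (u + v) * (u - v)" by (simp add: power2_eq_square algebra_simps)
    then show ?thesis by (simp add: abs_mult)
  qed
  also have "cosh ((u + v) / 2) * cosh ((u - v) / 2) = (cosh u + cosh v) / 2"
  proof -
    have "cosh u = cosh ((u + v) / 2 + (u - v) / 2)" "cosh v = cosh ((u + v) / 2 - (u - v) / 2)"
      by (simp_all add: field_simps)
    then show ?thesis unfolding cosh_add cosh_diff by simp
  qed
  also have "\<bar>u\<^sup>2 - v\<^sup>2\<bar> * ((cosh u + cosh v) / 2) / 2 \<le> \<bar>u\<^sup>2 - v\<^sup>2\<bar> * exp H"
  proof -
    have "cosh u \<le> exp H" "cosh v \<le> exp H"
      using cosh_le_exp_abs[of u] cosh_le_exp_abs[of v] assms by (auto elim!: order_trans)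
    then have "(cosh u + cosh v) / 2 / 2 \<le> exp H"
      using exp_ge_zero[of H] by argo
    then have "\<bar>u\<^sup>2 - v\<^sup>2\<bar> * ((cosh u + cosh v) / 2 / 2) \<le> \<bar>u\<^sup>2 - v\<^sup>2\<bar> * exp H"
      by (intro mult_left_mono) auto
    then show ?thesis by simp
  qed
  finally show ?thesis .
qed


section \<open>Moments of the tilted weight\<close>

text \<open>The Gibbs density at inverse temperature \<open>b\<close>, without tilt and normalisation. The quadratic
  term combines the well \<open>- x\<^sup>2 / 2\<close> with the interaction \<open>L * x\<^sup>2 / 2\<close>.\<close>

definition weight :: "real \<Rightarrow> real \<Rightarrow> real \<Rightarrow> real" where
  "weight L b x = exp (- b * (x ^ 4 / 4 + (L - 1) * x\<^sup>2 / 2))"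

definition moment :: "real \<Rightarrow> nat \<Rightarrow> real \<Rightarrow> real \<Rightarrow> real" where
  "moment L k b h = (LINT x|lborel. x ^ k * exp (h * x) * weight L b x)"

definition cosh_moment :: "real \<Rightarrow> nat \<Rightarrow> real \<Rightarrow> real \<Rightarrow> real" where
  "cosh_moment L k b h = (LINT x|lborel. x ^ k * cosh (h * x) * weight L b x)"

text \<open>For even \<open>k\<close> this is the tilted moment of order \<open>k - 1\<close> divided by \<open>h\<close>, extended to \<open>h = 0\<close>
  (see \<open>moment_odd\<close>).\<close>

definition sinhc_moment :: "real \<Rightarrow> nat \<Rightarrow> real \<Rightarrow> real \<Rightarrow> real" where
  "sinhc_moment L k b h = (LINT x|lborel. x ^ k * sinhc (h * x) * weight L b x)"

lemma weight_pos [simp]: "0 < weight L b x" "0 \<le> weight L b x"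
  by (simp_all add: weight_def)

lemma weight_minus [simp]: "weight L b (- x) = weight L b x"
  by (simp add: weight_def)

lemma cosh_measurable [measurable]: "(cosh :: real \<Rightarrow> real) \<in> borel_measurable borel"
  by (intro borel_measurable_continuous_onI continuous_intros)

lemma weight_measurable [measurable]: "weight L b \<in> borel_measurable borel"
  unfolding weight_def by measurable

lemma integrable_abs_power_gauss: "integrable lborel (\<lambda>x::real. \<bar>x\<bar> ^ k * exp (- x\<^sup>2 / 2))"
proof -
  have "(\<lambda>x::real. \<bar>x\<bar> ^ k * exp (- x\<^sup>2 / 2))
      = (\<lambda>x. sqrt (2 * pi) * (std_normal_density x * \<bar>x - 0\<bar> ^ k))"
    by (auto simp: normal_density_def)
  then show ?thesis
    by (simp only: integrable_mult_right integrable_normal_moment_abs)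
qed

text \<open>The quartic term, uniformly in \<open>b \<ge> b\<^sub>1\<close>, absorbs the quadratic term, the exponential factor and
  the Gaussian. This one domination supplies all integrability and all uniform constants.\<close>

lemma weight_exp_le_gauss:
  assumes "0 < b\<^sub>1"
  shows "\<exists>K>0. \<forall>b\<in>{b\<^sub>1..b\<^sub>0}. \<forall>x. exp (H * \<bar>x\<bar>) * weight L b x \<le> K * exp (- x\<^sup>2 / 2)"
proof (intro exI[of _ "exp (\<bar>H\<bar> + (b\<^sub>0 * \<bar>L - 1\<bar> + \<bar>H\<bar> + 1)\<^sup>2 / b\<^sub>1)"] conjI ballI allI)
  fix b x assume b: "b \<in> {b\<^sub>1..b\<^sub>0}"
  \<comment> \<open>\<open>q * x\<^sup>2\<close> dominates everything that the quartic term has to absorb.\<close>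
  define q where "q = b\<^sub>0 * \<bar>L - 1\<bar> + \<bar>H\<bar> + 1"
  have q: "0 \<le> q" using assms b unfolding q_def by (intro add_nonneg_nonneg mult_nonneg_nonneg) auto
  have 1: "H * \<bar>x\<bar> \<le> \<bar>H\<bar> + \<bar>H\<bar> * x\<^sup>2"
  proof -
    have "\<bar>x\<bar> \<le> 1 + x\<^sup>2"
    proof (cases "\<bar>x\<bar> \<le> 1")
      case False
      then have "\<bar>x\<bar> * 1 \<le> \<bar>x\<bar> * \<bar>x\<bar>" by (intro mult_left_mono) auto
      then show ?thesis by (simp add: power2_eq_square)
    qed (simp add: add_increasing2)
    then have "\<bar>H\<bar> * \<bar>x\<bar> \<le> \<bar>H\<bar> * (1 + x\<^sup>2)" by (rule mult_left_mono) simp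
    moreover have "H * \<bar>x\<bar> \<le> \<bar>H\<bar> * \<bar>x\<bar>" by (rule mult_right_mono) auto
    ultimately show ?thesis by (simp add: algebra_simps)
  qed
  have 2: "- b * ((L - 1) * x\<^sup>2 / 2) \<le> b\<^sub>0 * \<bar>L - 1\<bar> * x\<^sup>2 / 2"
  proof -
    have "b * (1 - L) \<le> b * \<bar>L - 1\<bar>" using assms b by (intro mult_left_mono) auto
    also have "\<dots> \<le> b\<^sub>0 * \<bar>L - 1\<bar>" using b by (intro mult_right_mono) auto
    finally have "b * (1 - L) * x\<^sup>2 \<le> b\<^sub>0 * \<bar>L - 1\<bar> * x\<^sup>2" by (intro mult_right_mono) auto
    then show ?thesis by (simp add: algebra_simps)
  qed
  have 3: "b\<^sub>1 * x ^ 4 \<le> b * x ^ 4" using b by (intro mult_right_mono) auto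
  have 4: "q * x\<^sup>2 \<le> b\<^sub>1 * x ^ 4 / 4 + q\<^sup>2 / b\<^sub>1"
  proof -
    have "0 \<le> (b\<^sub>1 * x\<^sup>2 / 2 - q)\<^sup>2" by simp
    also have "\<dots> = b\<^sub>1 * (b\<^sub>1 * x ^ 4 / 4 + q\<^sup>2 / b\<^sub>1 - q * x\<^sup>2)"
      using assms by (simp add: field_simps power2_eq_square power4_eq_xxxx)
    finally have "0 \<le> b\<^sub>1 * x ^ 4 / 4 + q\<^sup>2 / b\<^sub>1 - q * x\<^sup>2"
      using assms by (simp add: zero_le_mult_iff)
    then show ?thesis by simp
  qed
  have 5: "b\<^sub>0 * \<bar>L - 1\<bar> * x\<^sup>2 / 2 + \<bar>H\<bar> * x\<^sup>2 + x\<^sup>2 / 2 \<le> q * x\<^sup>2"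
  proof -
    have "0 \<le> b\<^sub>0 * \<bar>L - 1\<bar> * x\<^sup>2" using assms b by (intro mult_nonneg_nonneg) auto
    moreover have "q * x\<^sup>2 = b\<^sub>0 * \<bar>L - 1\<bar> * x\<^sup>2 + \<bar>H\<bar> * x\<^sup>2 + x\<^sup>2"
      by (simp add: q_def algebra_simps)
    ultimately show ?thesis using zero_le_power2[of x] by argo
  qed
  have "H * \<bar>x\<bar> + - b * (x ^ 4 / 4 + (L - 1) * x\<^sup>2 / 2)
      = H * \<bar>x\<bar> + - b * ((L - 1) * x\<^sup>2 / 2) - b * x ^ 4 / 4"
    by (simp add: algebra_simps)
  also have "\<dots> \<le> (\<bar>H\<bar> + q\<^sup>2 / b\<^sub>1) + - x\<^sup>2 / 2"
    using 1 2 3 4 5 by argo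
  finally have "exp (H * \<bar>x\<bar> + - b * (x ^ 4 / 4 + (L - 1) * x\<^sup>2 / 2))
      \<le> exp ((\<bar>H\<bar> + q\<^sup>2 / b\<^sub>1) + - x\<^sup>2 / 2)" by (simp only: exp_le_cancel_iff)
  then show "exp (H * \<bar>x\<bar>) * weight L b x
      \<le> exp (\<bar>H\<bar> + (b\<^sub>0 * \<bar>L - 1\<bar> + \<bar>H\<bar> + 1)\<^sup>2 / b\<^sub>1) * exp (- x\<^sup>2 / 2)"
    unfolding weight_def q_def[symmetric] by (simp only: exp_add)
qed simp

lemma integrable_times_weight:
  assumes "0 < b" and [measurable]: "f \<in> borel_measurable borel"
    and "\<And>x. \<bar>f x\<bar> \<le> \<bar>x\<bar> ^ k * exp (H * \<bar>x\<bar>)"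
  shows "integrable lborel (\<lambda>x. f x * weight L b x)"
proof -
  obtain K where K: "0 < K" "\<And>x. exp (H * \<bar>x\<bar>) * weight L b x \<le> K * exp (- x\<^sup>2 / 2)"
    using weight_exp_le_gauss[OF assms(1), of b H L] by auto
  show ?thesis
  proof (rule Bochner_Integration.integrable_bound)
    show "integrable lborel (\<lambda>x. K * (\<bar>x\<bar> ^ k * exp (- x\<^sup>2 / 2)))"
      by (intro integrable_mult_right integrable_abs_power_gauss)
    have "\<bar>f x * weight L b x\<bar> \<le> K * (\<bar>x\<bar> ^ k * exp (- x\<^sup>2 / 2))" for x
    proof -
      have "\<bar>f x * weight L b x\<bar> \<le> (\<bar>x\<bar> ^ k * exp (H * \<bar>x\<bar>)) * weight L b x"
        by (simp add: abs_mult assms(3) mult_right_mono)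
      also have "\<dots> \<le> \<bar>x\<bar> ^ k * (K * exp (- x\<^sup>2 / 2))"
        using mult_left_mono[OF K(2), of "\<bar>x\<bar> ^ k"] by (simp add: mult_ac)
      finally show ?thesis by (simp add: mult_ac)
    qed
    then show "AE x in lborel. norm (f x * weight L b x) \<le> norm (K * (\<bar>x\<bar> ^ k * exp (- x\<^sup>2 / 2)))"
      using K(1) by (simp add: abs_mult)
  qed measurable
qed

lemma abs_power_times_le:
  fixes x t c :: real
  assumes "\<bar>t\<bar> \<le> c" shows "\<bar>x ^ k * t\<bar> \<le> \<bar>x\<bar> ^ k * c"
  using assms by (simp add: abs_mult power_abs mult_left_mono)

lemma sinhc_abs_le: "\<bar>sinhc (h * x)\<bar> \<le> exp (\<bar>h\<bar> * \<bar>x\<bar>)"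
  using sinhc_le_exp_abs[of "h * x"] sinhc_ge_1[of "h * x"] by (simp add: abs_mult)

lemma cosh_abs_le: "\<bar>cosh (h * x :: real)\<bar> \<le> exp (\<bar>h\<bar> * \<bar>x\<bar>)"
  using cosh_le_exp_abs[of "h * x"] cosh_real_ge_1[of "h * x"] by (simp add: abs_mult)

lemma integrable_moment:
  assumes "0 < b" shows "integrable lborel (\<lambda>x. x ^ k * exp (h * x) * weight L b x)"
  by (rule integrable_times_weight[where k = k and H = "\<bar>h\<bar>"], use assms in simp, measurable)
     (intro abs_power_times_le, simp add: abs_mult[symmetric])

lemma integrable_cosh_moment:
  assumes "0 < b" shows "integrable lborel (\<lambda>x. x ^ k * cosh (h * x) * weight L b x)"
  by (rule integrable_times_weight[where k = k and H = "\<bar>h\<bar>"], use assms in simp, measurable)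
     (intro abs_power_times_le cosh_abs_le)

lemma integrable_sinhc_moment:
  assumes "0 < b" shows "integrable lborel (\<lambda>x. x ^ k * sinhc (h * x) * weight L b x)"
  by (rule integrable_times_weight[where k = k and H = "\<bar>h\<bar>"], use assms in simp, measurable)
     (intro abs_power_times_le sinhc_abs_le)

lemma moment_minus: "moment L k b (- h) = (-1) ^ k * moment L k b h"
proof -
  have "moment L k b (- h) = (LINT x|lborel. (- x) ^ k * exp (h * x) * weight L b x)"
    unfolding moment_def by (subst lborel_integral_real_affine[where c = "-1" and t = 0]) auto
  also have "\<dots> = (LINT x|lborel. (-1) ^ k * (x ^ k * exp (h * x) * weight L b x))"
  proof (intro Bochner_Integration.integral_cong refl)
    show "(- x) ^ k * exp (h * x) * weight L b x = (-1) ^ k * (x ^ k * exp (h * x) * weight L b x)" for x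
      using power_minus[of x k] by (simp only: mult.assoc)
  qed
  finally show ?thesis unfolding moment_def by simp
qed

text \<open>The weight is even, so averaging over \<open>\<plusminus> h\<close> replaces the exponential by \<open>cosh\<close>.\<close>

lemma moment_even:
  assumes "0 < b" "even k" shows "moment L k b h = cosh_moment L k b h"
proof -
  have "2 * moment L k b h = moment L k b h + moment L k b (- h)"
    using assms by (simp add: moment_minus)
  also have "\<dots> = (LINT x|lborel. x ^ k * exp (h * x) * weight L b x + x ^ k * exp (- h * x) * weight L b x)"
    unfolding moment_def using assms
    by (intro Bochner_Integration.integral_add[symmetric] integrable_moment)
  also have "\<dots> = (LINT x|lborel. 2 * (x ^ k * cosh (h * x) * weight L b x))"
    by (intro Bochner_Integration.integral_cong) (auto simp: cosh_field_def algebra_simps)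
  finally show ?thesis unfolding cosh_moment_def by simp
qed

text \<open>The average over \<open>\<plusminus> h\<close> now produces \<open>sinh (h * x) = h * x * sinhc (h * x)\<close>, which splits off
  the factor \<open>h\<close>.\<close>

lemma moment_odd:
  assumes "0 < b" "odd k" shows "moment L k b h = h * sinhc_moment L (Suc k) b h"
proof -
  have "2 * moment L k b h = moment L k b h - moment L k b (- h)"
    using assms by (simp add: moment_minus)
  also have "\<dots> = (LINT x|lborel. x ^ k * exp (h * x) * weight L b x - x ^ k * exp (- h * x) * weight L b x)"
    unfolding moment_def using assms
    by (intro Bochner_Integration.integral_diff[symmetric] integrable_moment)
  also have "\<dots> = (LINT x|lborel. (2 * h) * (x ^ Suc k * sinhc (h * x) * weight L b x))"
  proof (intro Bochner_Integration.integral_cong refl)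
    fix x
    have "x ^ k * exp (h * x) * weight L b x - x ^ k * exp (- h * x) * weight L b x
        = 2 * x ^ k * sinh (h * x) * weight L b x"
      by (simp add: sinh_field_def algebra_simps)
    also have "\<dots> = 2 * x ^ k * (h * x * sinhc (h * x)) * weight L b x"
      by (simp only: mult_sinhc)
    finally show "x ^ k * exp (h * x) * weight L b x - x ^ k * exp (- h * x) * weight L b x
        = (2 * h) * (x ^ Suc k * sinhc (h * x) * weight L b x)" by (simp add: mult_ac)
  qed
  finally show ?thesis unfolding sinhc_moment_def by simp
qed

lemma sinhc_moment_0: "0 < b \<Longrightarrow> even k \<Longrightarrow> sinhc_moment L k b 0 = moment L k b 0"
  by (simp add: moment_def sinhc_moment_def)

lemma integral_pos_lborel:
  fixes f :: "real \<Rightarrow> real"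
  assumes "integrable lborel f" "\<And>x. 0 \<le> f x" "finite {x. f x = 0}"
  shows "0 < (LINT x|lborel. f x)"
proof -
  have "integral\<^sup>L lborel f \<noteq> 0"
  proof
    assume "integral\<^sup>L lborel f = 0"
    then have "AE x in lborel. f x = 0"
      using integral_nonneg_eq_0_iff_AE[OF assms(1)] assms(2) by auto
    moreover have "AE x in lborel. x \<notin> {x. f x = 0}"
      using assms(3) by (intro AE_not_in finite_imp_null_set_lborel)
    ultimately have "AE x in (lborel :: real measure). False" by eventually_elim auto
    then show False by (simp add: AE_iff_null emeasure_lborel_UNIV null_sets_def)
  qed
  moreover have "0 \<le> integral\<^sup>L lborel f" using assms(2) by simp
  ultimately show ?thesis by simp
qed

lemma finite_power_zero: "finite {x::real. x ^ k * c x = 0}" if "\<And>x. c x \<noteq> 0"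
proof (rule finite_subset)
  show "{x::real. x ^ k * c x = 0} \<subseteq> {0}" using that by auto
qed simp

lemma cosh_moment_pos:
  assumes "0 < b" "even k" shows "0 < cosh_moment L k b h"
  unfolding cosh_moment_def
proof (rule integral_pos_lborel)
  have "cosh (h * x) * weight L b x \<noteq> 0" for x
    using cosh_real_pos[of "h * x"] weight_pos(1)[of L b x] by (metis mult_eq_0_iff less_irrefl)
  then show "finite {x. x ^ k * cosh (h * x) * weight L b x = 0}"
    unfolding mult.assoc by (rule finite_power_zero)
  show "0 \<le> x ^ k * cosh (h * x) * weight L b x" for x
    using assms cosh_real_pos[of "h * x"] by (simp add: zero_le_even_power)
qed (rule integrable_cosh_moment[OF assms(1)])

lemma moment_pos:
  assumes "0 < b" "even k" shows "0 < moment L k b h"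
  using moment_even[OF assms] cosh_moment_pos[OF assms] by simp

lemma sinhc_moment_ge:
  assumes "0 < b" "even k" shows "moment L k b 0 \<le> sinhc_moment L k b h"
  unfolding moment_def sinhc_moment_def
proof (rule integral_mono)
  show "x ^ k * exp (0 * x) * weight L b x \<le> x ^ k * sinhc (h * x) * weight L b x" for x
    using assms sinhc_ge_1[of "h * x"] by (intro mult_mono) (auto simp: zero_le_even_power)
qed (use assms in \<open>auto intro: integrable_sinhc_moment integrable_moment[where h = 0, simplified]\<close>)

lemma sinhc_moment_pos:
  assumes "0 < b" "even k" shows "0 < sinhc_moment L k b h"
  using moment_pos[OF assms] sinhc_moment_ge[OF assms] by (rule less_le_trans)

text \<open>A pointwise inequality between symmetrised products is integrated first in \<open>y\<close>, then in \<open>x\<close>; all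
  terms factor, so no product measure is involved. With \<open>c = 0\<close> this is Chebyshev's association
  inequality.\<close>

lemma symmetrized_product_le:
  fixes f\<^sub>1 g\<^sub>1 f\<^sub>2 g\<^sub>2 u v z :: "real \<Rightarrow> real"
  assumes "integrable lborel f\<^sub>1" "integrable lborel g\<^sub>1" "integrable lborel f\<^sub>2" "integrable lborel g\<^sub>2"
    "integrable lborel u" "integrable lborel v" "integrable lborel z"
    and le: "\<And>x y. c * (u x * v y + v x * u y - 2 * z x * z y)
      \<le> f\<^sub>1 x * g\<^sub>1 y + g\<^sub>1 x * f\<^sub>1 y - f\<^sub>2 x * g\<^sub>2 y - g\<^sub>2 x * f\<^sub>2 y"
  shows "c * (integral\<^sup>L lborel u * integral\<^sup>L lborel v - (integral\<^sup>L lborel z)\<^sup>2)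
    \<le> integral\<^sup>L lborel f\<^sub>1 * integral\<^sup>L lborel g\<^sub>1 - integral\<^sup>L lborel f\<^sub>2 * integral\<^sup>L lborel g\<^sub>2"
proof -
  let ?I = "integral\<^sup>L lborel :: (real \<Rightarrow> real) \<Rightarrow> real"
  have inner: "c * (u x * ?I v + v x * ?I u - 2 * z x * ?I z)
      \<le> f\<^sub>1 x * ?I g\<^sub>1 + g\<^sub>1 x * ?I f\<^sub>1 - f\<^sub>2 x * ?I g\<^sub>2 - g\<^sub>2 x * ?I f\<^sub>2" for x
    using integral_mono[of lborel "\<lambda>y. c * (u x * v y + v x * u y - 2 * z x * z y)"
        "\<lambda>y. f\<^sub>1 x * g\<^sub>1 y + g\<^sub>1 x * f\<^sub>1 y - f\<^sub>2 x * g\<^sub>2 y - g\<^sub>2 x * f\<^sub>2 y"] le assms(1-7)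
    by (simp add: Bochner_Integration.integrable_diff Bochner_Integration.integrable_add)
  have "c * (?I u * ?I v + ?I v * ?I u - 2 * ?I z * ?I z)
      \<le> ?I f\<^sub>1 * ?I g\<^sub>1 + ?I g\<^sub>1 * ?I f\<^sub>1 - ?I f\<^sub>2 * ?I g\<^sub>2 - ?I g\<^sub>2 * ?I f\<^sub>2"
    using integral_mono[of lborel "\<lambda>x. c * (u x * ?I v + v x * ?I u - 2 * z x * ?I z)"
        "\<lambda>x. f\<^sub>1 x * ?I g\<^sub>1 + g\<^sub>1 x * ?I f\<^sub>1 - f\<^sub>2 x * ?I g\<^sub>2 - g\<^sub>2 x * ?I f\<^sub>2"] inner assms(1-7)
    by (simp add: Bochner_Integration.integrable_diff Bochner_Integration.integrable_add)
  then show ?thesis by (simp add: power2_eq_square algebra_simps)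
qed


section \<open>Regularity and monotonicity in the parameters\<close>

lemma abs_exp_diff_le: "\<bar>exp u - exp v\<bar> \<le> \<bar>u - v\<bar> * (exp u + exp (v::real))"
proof -
  have le: "exp u - exp v \<le> \<bar>u - v\<bar> * (exp u + exp v)" for u v :: real
  proof -
    have "exp u * (1 + (v - u)) \<le> exp u * exp (v - u)"
      by (intro mult_left_mono exp_ge_add_one_self) auto
    then have "exp u - exp v \<le> (u - v) * exp u"
      by (simp add: exp_diff algebra_simps)
    also have "\<dots> \<le> \<bar>u - v\<bar> * (exp u + exp v)"
      by (intro mult_mono) auto
    finally show ?thesis .
  qed
  show ?thesis
    using le[of u v] le[of v u] by (auto simp: abs_le_iff abs_minus_commute add.commute)
qed

lemma abs_weight_diff_le:
  "\<bar>weight L b x - weight L b' x\<bar>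
    \<le> \<bar>b - b'\<bar> * (x ^ 4 + \<bar>L - 1\<bar> * x\<^sup>2) * (weight L b x + weight L b' x)"
proof -
  let ?V = "x ^ 4 / 4 + (L - 1) * x\<^sup>2 / 2"
  have "\<bar>weight L b x - weight L b' x\<bar> \<le> \<bar>- b * ?V - - b' * ?V\<bar> * (weight L b x + weight L b' x)"
    unfolding weight_def by (rule abs_exp_diff_le)
  also have "- b * ?V - - b' * ?V = (b' - b) * ?V" by (simp only: left_diff_distrib)
  also have "\<bar>(b' - b) * ?V\<bar> = \<bar>b - b'\<bar> * \<bar>?V\<bar>" by (simp add: abs_mult abs_minus_commute)
  also have "\<bar>b - b'\<bar> * \<bar>?V\<bar> * (weight L b x + weight L b' x)
      \<le> \<bar>b - b'\<bar> * (x ^ 4 + \<bar>L - 1\<bar> * x\<^sup>2) * (weight L b x + weight L b' x)"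
  proof (intro mult_right_mono mult_left_mono)
    have "\<bar>?V\<bar> \<le> \<bar>x ^ 4 / 4\<bar> + \<bar>(L - 1) * x\<^sup>2 / 2\<bar>" by (rule abs_triangle_ineq)
    also have "\<bar>x ^ 4 / 4\<bar> = x ^ 4 / 4" by simp
    also have "\<bar>(L - 1) * x\<^sup>2 / 2\<bar> = \<bar>L - 1\<bar> * x\<^sup>2 / 2" by (simp add: abs_mult)
    also have "x ^ 4 / 4 + \<bar>L - 1\<bar> * x\<^sup>2 / 2 \<le> x ^ 4 + \<bar>L - 1\<bar> * x\<^sup>2"
      by (intro add_mono) auto
    finally show "\<bar>?V\<bar> \<le> x ^ 4 + \<bar>L - 1\<bar> * x\<^sup>2" .
  qed (auto intro: add_nonneg_nonneg)
  finally show ?thesis .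
qed

lemma integral_diff_le:
  fixes f g D :: "real \<Rightarrow> real"
  assumes "integrable lborel f" "integrable lborel g" "integrable lborel D"
    and "\<And>x. \<bar>f x - g x\<bar> \<le> D x"
  shows "\<bar>integral\<^sup>L lborel f - integral\<^sup>L lborel g\<bar> \<le> integral\<^sup>L lborel D"
proof -
  have "\<bar>integral\<^sup>L lborel f - integral\<^sup>L lborel g\<bar> = \<bar>LINT x|lborel. f x - g x\<bar>"
    using assms by simp
  also have "\<dots> \<le> (LINT x|lborel. \<bar>f x - g x\<bar>)"
    using integral_norm_bound[of lborel "\<lambda>x. f x - g x"] by simp
  also have "\<dots> \<le> integral\<^sup>L lborel D"
    using assms by (intro integral_mono) auto
  finally show ?thesis .
qed

text \<open>One constant serves every \<open>\<phi>\<close> dominated by \<open>exp (H * \<bar>x\<bar>)\<close>, hence every tilt of size at most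
  \<open>H\<close>, whether it enters through \<^term>\<open>cosh\<close> or through \<^term>\<open>sinhc\<close>.\<close>

lemma weight_integral_lipschitz:
  assumes "0 < b\<^sub>1"
  shows "\<exists>C>0. \<forall>b\<in>{b\<^sub>1..b\<^sub>0}. \<forall>b'\<in>{b\<^sub>1..b\<^sub>0}. \<forall>\<phi>\<in>borel_measurable borel.
    (\<forall>x. \<bar>\<phi> x\<bar> \<le> exp (H * \<bar>x\<bar>)) \<longrightarrow>
    \<bar>(LINT x|lborel. x ^ k * \<phi> x * weight L b x) - (LINT x|lborel. x ^ k * \<phi> x * weight L b' x)\<bar>
      \<le> C * \<bar>b - b'\<bar>"
proof -
  obtain K where K: "0 < K"
    "\<And>b x. b \<in> {b\<^sub>1..b\<^sub>0} \<Longrightarrow> exp (H * \<bar>x\<bar>) * weight L b x \<le> K * exp (- x\<^sup>2 / 2)"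
    using weight_exp_le_gauss[OF assms, of b\<^sub>0 H L] by auto
  define D where "D x = 2 * K * (\<bar>x\<bar> ^ (k + 4) * exp (- x\<^sup>2 / 2) + \<bar>L - 1\<bar> * (\<bar>x\<bar> ^ (k + 2) * exp (- x\<^sup>2 / 2)))"
    for x :: real
  have ring: "p * d * (u + l * v) * (K * t + K * t) = d * (2 * K * (p * u * t + l * (p * v * t)))"
    for p d u l v t :: real by (simp add: algebra_simps)
  have D: "integrable lborel D"
    unfolding D_def by (intro integrable_mult_right Bochner_Integration.integrable_add integrable_abs_power_gauss)
  have D0: "0 \<le> integral\<^sup>L lborel D"
    using K(1) unfolding D_def by (intro Bochner_Integration.integral_nonneg) auto
  show ?thesis
  proof (intro exI[of _ "integral\<^sup>L lborel D + 1"] conjI ballI impI)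
    show "0 < integral\<^sup>L lborel D + 1" using D0 by simp
    fix b b' and \<phi> :: "real \<Rightarrow> real"
    assume b: "b \<in> {b\<^sub>1..b\<^sub>0}" "b' \<in> {b\<^sub>1..b\<^sub>0}"
      and [measurable]: "\<phi> \<in> borel_measurable borel"
      and "\<forall>x. \<bar>\<phi> x\<bar> \<le> exp (H * \<bar>x\<bar>)"
    then have \<phi>: "\<bar>\<phi> x\<bar> \<le> exp (H * \<bar>x\<bar>)" for x by blast
    have int: "integrable lborel (\<lambda>x. x ^ k * \<phi> x * weight L b x)" if "b \<in> {b\<^sub>1..b\<^sub>0}" for b
      using that assms by (intro integrable_times_weight[where k = k and H = H] abs_power_times_le \<phi>) auto
    have "\<bar>x ^ k * \<phi> x * weight L b x - x ^ k * \<phi> x * weight L b' x\<bar> \<le> \<bar>b - b'\<bar> * D x" for x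
    proof -
      have "\<bar>x ^ k * \<phi> x * weight L b x - x ^ k * \<phi> x * weight L b' x\<bar>
          = \<bar>x\<bar> ^ k * \<bar>\<phi> x\<bar> * \<bar>weight L b x - weight L b' x\<bar>"
        by (simp add: right_diff_distrib[symmetric] abs_mult power_abs)
      also have "\<dots> \<le> \<bar>x\<bar> ^ k * exp (H * \<bar>x\<bar>) *
          (\<bar>b - b'\<bar> * (x ^ 4 + \<bar>L - 1\<bar> * x\<^sup>2) * (weight L b x + weight L b' x))"
        by (intro mult_mono abs_weight_diff_le \<phi>) auto
      also have "\<dots> = \<bar>x\<bar> ^ k * \<bar>b - b'\<bar> * (x ^ 4 + \<bar>L - 1\<bar> * x\<^sup>2) *
          (exp (H * \<bar>x\<bar>) * weight L b x + exp (H * \<bar>x\<bar>) * weight L b' x)"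
        by (simp add: algebra_simps)
      also have "\<dots> \<le> \<bar>x\<bar> ^ k * \<bar>b - b'\<bar> * (x ^ 4 + \<bar>L - 1\<bar> * x\<^sup>2) *
          (K * exp (- x\<^sup>2 / 2) + K * exp (- x\<^sup>2 / 2))"
        using b by (intro mult_left_mono add_mono K) auto
      also have "\<dots> = \<bar>b - b'\<bar> * D x"
      proof -
        have "\<bar>x\<bar> ^ (k + 4) = \<bar>x\<bar> ^ k * x ^ 4" "\<bar>x\<bar> ^ (k + 2) = \<bar>x\<bar> ^ k * x\<^sup>2"
          by (simp_all only: power_add power_even_abs_numeral power2_abs even_numeral)
        then show ?thesis unfolding D_def by (simp only: ring)
      qed
      finally show ?thesis .
    qed
    then have "\<bar>(LINT x|lborel. x ^ k * \<phi> x * weight L b x) - (LINT x|lborel. x ^ k * \<phi> x * weight L b' x)\<bar>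
        \<le> (LINT x|lborel. \<bar>b - b'\<bar> * D x)"
      using int b D by (intro integral_diff_le) auto
    also have "\<dots> \<le> (integral\<^sup>L lborel D + 1) * \<bar>b - b'\<bar>" by (simp add: algebra_simps)
    finally show "\<bar>(LINT x|lborel. x ^ k * \<phi> x * weight L b x) - (LINT x|lborel. x ^ k * \<phi> x * weight L b' x)\<bar>
        \<le> (integral\<^sup>L lborel D + 1) * \<bar>b - b'\<bar>" .
  qed
qed

lemma weight_integral_bounded:
  assumes "0 < b\<^sub>1"
  shows "\<exists>C>0. \<forall>b\<in>{b\<^sub>1..b\<^sub>0}. \<forall>\<phi>\<in>borel_measurable borel.
    (\<forall>x. \<bar>\<phi> x\<bar> \<le> exp (H * \<bar>x\<bar>)) \<longrightarrow> (LINT x|lborel. x ^ k * \<phi> x * weight L b x) \<le> C"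
proof -
  obtain K where K: "0 < K"
    "\<And>b x. b \<in> {b\<^sub>1..b\<^sub>0} \<Longrightarrow> exp (H * \<bar>x\<bar>) * weight L b x \<le> K * exp (- x\<^sup>2 / 2)"
    using weight_exp_le_gauss[OF assms, of b\<^sub>0 H L] by auto
  define D where "D x = K * (\<bar>x\<bar> ^ k * exp (- x\<^sup>2 / 2))" for x :: real
  have D: "integrable lborel D"
    unfolding D_def by (intro integrable_mult_right integrable_abs_power_gauss)
  have D0: "0 \<le> integral\<^sup>L lborel D"
    using K(1) unfolding D_def by (intro Bochner_Integration.integral_nonneg) auto
  show ?thesis
  proof (intro exI[of _ "integral\<^sup>L lborel D + 1"] conjI ballI impI)
    show "0 < integral\<^sup>L lborel D + 1" using D0 by simp
    fix b and \<phi> :: "real \<Rightarrow> real"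
    assume b: "b \<in> {b\<^sub>1..b\<^sub>0}" and [measurable]: "\<phi> \<in> borel_measurable borel"
      and "\<forall>x. \<bar>\<phi> x\<bar> \<le> exp (H * \<bar>x\<bar>)"
    then have \<phi>: "\<bar>\<phi> x\<bar> \<le> exp (H * \<bar>x\<bar>)" for x by blast
    have "x ^ k * \<phi> x * weight L b x \<le> D x" for x
    proof -
      have "x ^ k * \<phi> x * weight L b x \<le> (\<bar>x\<bar> ^ k * exp (H * \<bar>x\<bar>)) * weight L b x"
        using abs_power_times_le[OF \<phi>, of x k x] by (intro mult_right_mono) auto
      also have "\<dots> \<le> \<bar>x\<bar> ^ k * (K * exp (- x\<^sup>2 / 2))"
        using mult_left_mono[OF K(2)[OF b], of "\<bar>x\<bar> ^ k"] by (simp add: mult_ac)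
      finally show ?thesis by (simp only: D_def mult_ac)
    qed
    moreover have "integrable lborel (\<lambda>x. x ^ k * \<phi> x * weight L b x)"
      using b assms by (intro integrable_times_weight[where k = k and H = H] abs_power_times_le \<phi>) auto
    ultimately have "(LINT x|lborel. x ^ k * \<phi> x * weight L b x) \<le> integral\<^sup>L lborel D"
      using D by (intro integral_mono)
    then show "(LINT x|lborel. x ^ k * \<phi> x * weight L b x) \<le> integral\<^sup>L lborel D + 1" by simp
  qed
qed

lemma exp_abs_mono_tilt: "\<bar>h\<bar> \<le> H \<Longrightarrow> exp (\<bar>h\<bar> * \<bar>x\<bar>) \<le> exp (H * \<bar>x::real\<bar>)"
  by (simp add: mult_right_mono)

lemma sinhc_moment_lipschitz:
  assumes "0 < b\<^sub>1"
  shows "\<exists>C>0. \<forall>b\<in>{b\<^sub>1..b\<^sub>0}. \<forall>b'\<in>{b\<^sub>1..b\<^sub>0}. \<forall>h. \<bar>h\<bar> \<le> H \<longrightarrow>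
    \<bar>sinhc_moment L k b h - sinhc_moment L k b' h\<bar> \<le> C * \<bar>b - b'\<bar>"
proof -
  have [measurable]: "(\<lambda>x. sinhc (h * x)) \<in> borel_measurable borel" for h by measurable
  have "\<forall>x. \<bar>sinhc (h * x)\<bar> \<le> exp (H * \<bar>x\<bar>)" if "\<bar>h\<bar> \<le> H" for h
    using order_trans[OF sinhc_abs_le exp_abs_mono_tilt[OF that]] by blast
  then show ?thesis
    using weight_integral_lipschitz[OF assms, of b\<^sub>0 H k L] unfolding sinhc_moment_def
    by (elim exE conjE) (intro exI conjI, assumption, force)
qed

lemma sinhc_moment_bounded:
  assumes "0 < b\<^sub>1"
  shows "\<exists>C>0. \<forall>b\<in>{b\<^sub>1..b\<^sub>0}. \<forall>h. \<bar>h\<bar> \<le> H \<longrightarrow> sinhc_moment L k b h \<le> C"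
proof -
  have [measurable]: "(\<lambda>x. sinhc (h * x)) \<in> borel_measurable borel" for h by measurable
  have "\<forall>x. \<bar>sinhc (h * x)\<bar> \<le> exp (H * \<bar>x\<bar>)" if "\<bar>h\<bar> \<le> H" for h
    using order_trans[OF sinhc_abs_le exp_abs_mono_tilt[OF that]] by blast
  then show ?thesis
    using weight_integral_bounded[OF assms, of b\<^sub>0 H k L] unfolding sinhc_moment_def
    by (elim exE conjE) (intro exI conjI, assumption, force)
qed

lemma cosh_moment_bounded:
  assumes "0 < b\<^sub>1"
  shows "\<exists>C>0. \<forall>b\<in>{b\<^sub>1..b\<^sub>0}. \<forall>h. \<bar>h\<bar> \<le> H \<longrightarrow> cosh_moment L k b h \<le> C"
proof -
  have [measurable]: "(\<lambda>x. cosh (h * x :: real)) \<in> borel_measurable borel" for h by measurable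
  have "\<forall>x. \<bar>cosh (h * x)\<bar> \<le> exp (H * \<bar>x\<bar>)" if "\<bar>h\<bar> \<le> H" for h
    using order_trans[OF cosh_abs_le exp_abs_mono_tilt[OF that]] by blast
  then show ?thesis
    using weight_integral_bounded[OF assms, of b\<^sub>0 H k L] unfolding cosh_moment_def
    by (elim exE conjE) (intro exI conjI, assumption, force)
qed

lemma cosh_moment_lipschitz:
  assumes "0 < b\<^sub>1"
  shows "\<exists>C>0. \<forall>b\<in>{b\<^sub>1..b\<^sub>0}. \<forall>b'\<in>{b\<^sub>1..b\<^sub>0}. \<forall>h h'. \<bar>h\<bar> \<le> H \<longrightarrow> \<bar>h'\<bar> \<le> H \<longrightarrow>
    \<bar>cosh_moment L k b h - cosh_moment L k b' h'\<bar> \<le> C * (\<bar>b - b'\<bar> + \<bar>h\<^sup>2 - h'\<^sup>2\<bar>)"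
proof -
  have [measurable]: "(\<lambda>x. cosh (h * x :: real)) \<in> borel_measurable borel" for h by measurable
  have cosh_le: "\<forall>x. \<bar>cosh (h * x)\<bar> \<le> exp (H * \<bar>x\<bar>)" if "\<bar>h\<bar> \<le> H" for h
    using order_trans[OF cosh_abs_le exp_abs_mono_tilt[OF that]] by blast
  obtain C where C: "0 < C" "\<And>b b' h. b \<in> {b\<^sub>1..b\<^sub>0} \<Longrightarrow> b' \<in> {b\<^sub>1..b\<^sub>0} \<Longrightarrow> \<bar>h\<bar> \<le> H \<Longrightarrow>
      \<bar>cosh_moment L k b h - cosh_moment L k b' h\<bar> \<le> C * \<bar>b - b'\<bar>"
    using weight_integral_lipschitz[OF assms, of b\<^sub>0 H k L] cosh_le unfolding cosh_moment_def by force
  obtain K where K: "0 < K"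
    "\<And>b x. b \<in> {b\<^sub>1..b\<^sub>0} \<Longrightarrow> exp (H * \<bar>x\<bar>) * weight L b x \<le> K * exp (- x\<^sup>2 / 2)"
    using weight_exp_le_gauss[OF assms, of b\<^sub>0 H L] by auto
  define D where "D x = K * (\<bar>x\<bar> ^ (k + 2) * exp (- x\<^sup>2 / 2))" for x :: real
  have D: "integrable lborel D"
    unfolding D_def by (intro integrable_mult_right integrable_abs_power_gauss)
  have D0: "0 \<le> integral\<^sup>L lborel D"
    using K(1) unfolding D_def by (intro Bochner_Integration.integral_nonneg) auto
  have tilt: "\<bar>cosh_moment L k b h - cosh_moment L k b h'\<bar> \<le> \<bar>h\<^sup>2 - h'\<^sup>2\<bar> * integral\<^sup>L lborel D"
    if b: "b \<in> {b\<^sub>1..b\<^sub>0}" and h: "\<bar>h\<bar> \<le> H" "\<bar>h'\<bar> \<le> H" for b h h'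
  proof -
    have "\<bar>x ^ k * cosh (h * x) * weight L b x - x ^ k * cosh (h' * x) * weight L b x\<bar>
        \<le> \<bar>h\<^sup>2 - h'\<^sup>2\<bar> * D x" for x
    proof -
      have "\<bar>x ^ k * cosh (h * x) * weight L b x - x ^ k * cosh (h' * x) * weight L b x\<bar>
          = \<bar>x\<bar> ^ k * \<bar>cosh (h * x) - cosh (h' * x)\<bar> * weight L b x"
        by (simp add: left_diff_distrib[symmetric] right_diff_distrib[symmetric] abs_mult power_abs)
      also have "\<dots> \<le> \<bar>x\<bar> ^ k * (\<bar>(h * x)\<^sup>2 - (h' * x)\<^sup>2\<bar> * exp (H * \<bar>x\<bar>)) * weight L b x"
        using h by (intro mult_right_mono mult_left_mono abs_cosh_diff_le)
          (auto simp: abs_mult mult_right_mono)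
      also have "\<bar>(h * x)\<^sup>2 - (h' * x)\<^sup>2\<bar> = \<bar>h\<^sup>2 - h'\<^sup>2\<bar> * \<bar>x\<bar>\<^sup>2"
        by (simp add: power_mult_distrib left_diff_distrib[symmetric] abs_mult)
      also have "\<bar>x\<bar> ^ k * (\<bar>h\<^sup>2 - h'\<^sup>2\<bar> * \<bar>x\<bar>\<^sup>2 * exp (H * \<bar>x\<bar>)) * weight L b x
          = \<bar>h\<^sup>2 - h'\<^sup>2\<bar> * \<bar>x\<bar> ^ (k + 2) * (exp (H * \<bar>x\<bar>) * weight L b x)"
        by (simp only: power_add mult_ac)
      also have "\<dots> \<le> \<bar>h\<^sup>2 - h'\<^sup>2\<bar> * \<bar>x\<bar> ^ (k + 2) * (K * exp (- x\<^sup>2 / 2))"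
        using b by (intro mult_left_mono K) auto
      finally show ?thesis by (simp only: D_def mult_ac)
    qed
    then have "\<bar>cosh_moment L k b h - cosh_moment L k b h'\<bar> \<le> (LINT x|lborel. \<bar>h\<^sup>2 - h'\<^sup>2\<bar> * D x)"
      unfolding cosh_moment_def using assms b D
      by (intro integral_diff_le integrable_cosh_moment) auto
    then show ?thesis by simp
  qed
  show ?thesis
  proof (intro exI[of _ "C + integral\<^sup>L lborel D"] conjI ballI allI impI)
    show "0 < C + integral\<^sup>L lborel D" using C(1) D0 by simp
    fix b b' h h' assume *: "b \<in> {b\<^sub>1..b\<^sub>0}" "b' \<in> {b\<^sub>1..b\<^sub>0}" "\<bar>h\<bar> \<le> H" "\<bar>h'\<bar> \<le> H"
    have "\<bar>cosh_moment L k b h - cosh_moment L k b' h'\<bar>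
        \<le> C * \<bar>b - b'\<bar> + \<bar>h\<^sup>2 - h'\<^sup>2\<bar> * integral\<^sup>L lborel D"
      using C(2)[of b b' h] tilt[of b' h h'] * by linarith
    also have "\<dots> \<le> (C + integral\<^sup>L lborel D) * (\<bar>b - b'\<bar> + \<bar>h\<^sup>2 - h'\<^sup>2\<bar>)"
      using C(1) D0 by (simp add: algebra_simps)
    finally show "\<bar>cosh_moment L k b h - cosh_moment L k b' h'\<bar>
        \<le> (C + integral\<^sup>L lborel D) * (\<bar>b - b'\<bar> + \<bar>h\<^sup>2 - h'\<^sup>2\<bar>)" .
  qed
qed

text \<open>The smallest weight on a range of inverse temperatures is again of the form \<^term>\<open>weight\<close>, with
  interaction strength \<open>1 + \<bar>L - 1\<bar>\<close>; its moments give lower bounds uniform in \<open>b\<close>.\<close>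

lemma weight_ge:
  assumes "0 \<le> b" "b \<le> b\<^sub>0"
  shows "weight (1 + \<bar>L - 1\<bar>) b\<^sub>0 x \<le> weight L b x"
proof -
  have "b * (x ^ 4 / 4 + (L - 1) * x\<^sup>2 / 2) \<le> b * (x ^ 4 / 4 + \<bar>L - 1\<bar> * x\<^sup>2 / 2)"
    using assms by (intro mult_left_mono add_left_mono divide_right_mono mult_right_mono) auto
  also have "\<dots> \<le> b\<^sub>0 * (x ^ 4 / 4 + \<bar>L - 1\<bar> * x\<^sup>2 / 2)"
    using assms by (intro mult_right_mono add_nonneg_nonneg divide_nonneg_nonneg mult_nonneg_nonneg) auto
  finally show ?thesis by (simp add: weight_def)
qed

lemma moment_0_ge:
  assumes "0 < b" "b \<le> b\<^sub>0" "even k"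
  shows "moment (1 + \<bar>L - 1\<bar>) k b\<^sub>0 0 \<le> moment L k b 0"
  unfolding moment_def
  using assms by (intro integral_mono integrable_moment mult_left_mono weight_ge)
    (auto simp: zero_le_even_power)

lemma cosh_moment_ge:
  assumes "0 < b" "even k" shows "moment L k b 0 \<le> cosh_moment L k b h"
  unfolding moment_def cosh_moment_def
proof (rule integral_mono)
  show "x ^ k * exp (0 * x) * weight L b x \<le> x ^ k * cosh (h * x) * weight L b x" for x
    using assms cosh_real_ge_1[of "h * x"] by (intro mult_mono) (auto simp: zero_le_even_power)
qed (use assms in \<open>auto intro: integrable_cosh_moment integrable_moment[where h = 0, simplified]\<close>)

text \<open>Integrate \<open>x\<^sup>2 * (x\<^sup>2 - t)\<^sup>2\<close>, with \<open>t\<close> the value that minimises the integral.\<close>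

lemma moment_cauchy_schwarz_strict:
  assumes "0 < b"
  shows "(moment L 4 b 0)\<^sup>2 < moment L 2 b 0 * moment L 6 b 0"
proof -
  define t where "t = moment L 4 b 0 / moment L 2 b 0"
  have M2: "0 < moment L 2 b 0" using assms by (simp add: moment_pos)
  have int: "integrable lborel (\<lambda>x. x ^ k * weight L b x)" for k
    using integrable_moment[OF assms, of k 0] by simp
  have eq: "x\<^sup>2 * ((x\<^sup>2 - t)\<^sup>2 * weight L b x)
      = x ^ 6 * weight L b x - 2 * t * (x ^ 4 * weight L b x) + t\<^sup>2 * (x\<^sup>2 * weight L b x)" for x
    by (simp add: algebra_simps power2_eq_square eval_nat_numeral)
  have "0 < (LINT x|lborel. x\<^sup>2 * ((x\<^sup>2 - t)\<^sup>2 * weight L b x))"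
  proof (rule integral_pos_lborel)
    show "integrable lborel (\<lambda>x. x\<^sup>2 * ((x\<^sup>2 - t)\<^sup>2 * weight L b x))"
      unfolding eq by (intro Bochner_Integration.integrable_add Bochner_Integration.integrable_diff
          integrable_mult_right int)
    show "0 \<le> x\<^sup>2 * ((x\<^sup>2 - t)\<^sup>2 * weight L b x)" for x by simp
    have "{x. x\<^sup>2 * ((x\<^sup>2 - t)\<^sup>2 * weight L b x) = 0} \<subseteq> {0, sqrt t, - sqrt t}"
    proof
      fix x assume "x \<in> {x. x\<^sup>2 * ((x\<^sup>2 - t)\<^sup>2 * weight L b x) = 0}"
      then have "x = 0 \<or> x\<^sup>2 = t" using weight_pos(1)[of L b x] by auto
      then show "x \<in> {0, sqrt t, - sqrt t}"
        by (auto simp: real_sqrt_abs abs_if)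
    qed
    then show "finite {x. x\<^sup>2 * ((x\<^sup>2 - t)\<^sup>2 * weight L b x) = 0}"
      by (rule finite_subset) simp
  qed
  also have "\<dots> = moment L 6 b 0 - 2 * t * moment L 4 b 0 + t\<^sup>2 * moment L 2 b 0"
    unfolding eq moment_def using int by simp
  also have "\<dots> = moment L 6 b 0 - (moment L 4 b 0)\<^sup>2 / moment L 2 b 0"
    using M2 by (simp add: t_def power2_eq_square field_simps)
  finally show ?thesis using M2 by (simp add: field_simps)
qed

text \<open>Total positivity of \<^term>\<open>sinhc\<close> integrated over two independent copies of the weight. The gain
  \<open>(x\<^sup>2 - y\<^sup>2)\<^sup>2\<close> integrates to a Cauchy-Schwarz defect, which is positive and can be evaluated for
  the smallest weight.\<close>

lemma sinhc_moment_cross_diff_ge: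
  fixes L b b\<^sub>0 h h' :: real
  assumes "0 < b" "b \<le> b\<^sub>0" "0 \<le> h'" "h' \<le> h"
  defines "M \<equiv> \<lambda>k. moment (1 + \<bar>L - 1\<bar>) k b\<^sub>0 0"
  shows "(h\<^sup>2 - h'\<^sup>2) / 6 * (M 2 * M 6 - (M 4)\<^sup>2)
    \<le> sinhc_moment L 4 b h * sinhc_moment L 2 b h' - sinhc_moment L 4 b h' * sinhc_moment L 2 b h"
proof -
  let ?w = "weight (1 + \<bar>L - 1\<bar>) b\<^sub>0" and ?v = "weight L b"
  have b0: "0 < b\<^sub>0" using assms by simp
  have M: "M k = (LINT x|lborel. x ^ k * ?w x)" for k by (simp add: M_def moment_def)
  have int: "integrable lborel (\<lambda>x. x ^ k * ?w x)" for k
    using integrable_moment[OF b0, of k 0] by simp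
  show ?thesis
    unfolding M sinhc_moment_def
  proof (rule symmetrized_product_le)
    fix x y :: real
    let ?s = "\<lambda>h x. sinhc (h * x)"
    have "(h\<^sup>2 - h'\<^sup>2) / 6 * (x\<^sup>2 * ?w x * (y ^ 6 * ?w y) + x ^ 6 * ?w x * (y\<^sup>2 * ?w y)
          - 2 * (x ^ 4 * ?w x) * (y ^ 4 * ?w y))
        = x\<^sup>2 * y\<^sup>2 * ((h\<^sup>2 - h'\<^sup>2) * (x\<^sup>2 - y\<^sup>2)\<^sup>2 / 6) * (?w x * ?w y)"
      by (simp add: power2_eq_square eval_nat_numeral field_simps)
    also have "\<dots> \<le> x\<^sup>2 * y\<^sup>2 * ((x\<^sup>2 - y\<^sup>2) * (?s h x * ?s h' y - ?s h' x * ?s h y)) * (?v x * ?v y)"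
    proof (intro mult_mono mult_left_mono sinhc_total_positivity weight_ge assms)
      have "0 \<le> (h\<^sup>2 - h'\<^sup>2) * (x\<^sup>2 - y\<^sup>2)\<^sup>2 / 6" using assms by (simp add: power_mono)
      also have "\<dots> \<le> (x\<^sup>2 - y\<^sup>2) * (?s h x * ?s h' y - ?s h' x * ?s h y)"
        by (intro sinhc_total_positivity assms)
      finally show "0 \<le> x\<^sup>2 * y\<^sup>2 * ((x\<^sup>2 - y\<^sup>2) * (?s h x * ?s h' y - ?s h' x * ?s h y))" by simp
    qed (use assms in auto)
    also have "\<dots> = x ^ 4 * ?s h x * ?v x * (y\<^sup>2 * ?s h' y * ?v y) + x\<^sup>2 * ?s h' x * ?v x * (y ^ 4 * ?s h y * ?v y)
        - x ^ 4 * ?s h' x * ?v x * (y\<^sup>2 * ?s h y * ?v y) - x\<^sup>2 * ?s h x * ?v x * (y ^ 4 * ?s h' y * ?v y)"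
      by (simp add: power2_eq_square eval_nat_numeral algebra_simps)
    finally show "(h\<^sup>2 - h'\<^sup>2) / 6 * (x\<^sup>2 * ?w x * (y ^ 6 * ?w y) + x ^ 6 * ?w x * (y\<^sup>2 * ?w y)
          - 2 * (x ^ 4 * ?w x) * (y ^ 4 * ?w y))
        \<le> x ^ 4 * ?s h x * ?v x * (y\<^sup>2 * ?s h' y * ?v y) + x\<^sup>2 * ?s h' x * ?v x * (y ^ 4 * ?s h y * ?v y)
        - x ^ 4 * ?s h' x * ?v x * (y\<^sup>2 * ?s h y * ?v y) - x\<^sup>2 * ?s h x * ?v x * (y ^ 4 * ?s h' y * ?v y)" .
  qed (intro int integrable_sinhc_moment assms)+
qed


section \<open>Integration by parts\<close>

lemma integral_derivative_eq_0:
  fixes F f :: "real \<Rightarrow> real"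
  assumes "\<And>x. (F has_real_derivative f x) (at x)" "continuous_on UNIV f" "integrable lborel f"
    and "(F \<longlongrightarrow> 0) at_top" "(F \<longlongrightarrow> 0) at_bot"
  shows "(LINT x|lborel. f x) = 0"
proof -
  have "(LBINT x=-\<infinity>..\<infinity>. f x) = 0 - 0"
  proof (rule interval_integral_FTC_integrable)
    show "(F has_vector_derivative f x) (at x)" for x
      using assms(1) by (simp add: has_real_derivative_iff_has_vector_derivative[symmetric])
    show "isCont f x" for x
      using assms(2) by (simp add: continuous_on_eq_continuous_at)
    show "set_integrable lborel (einterval (-\<infinity>) \<infinity>) f"
      using assms(3) by (simp add: set_integrable_def)
    show "((F \<circ> real_of_ereal) \<longlongrightarrow> 0) (at_right (-\<infinity>))" "((F \<circ> real_of_ereal) \<longlongrightarrow> 0) (at_left \<infinity>)"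
      using assms(4,5) by (simp_all add: ereal_tendsto_simps)
  qed simp
  then show ?thesis
    by (simp add: interval_lebesgue_integral_def set_lebesgue_integral_def)
qed

text \<open>As \<open>\<bar>x\<bar> ^ k \<le> exp (k * \<bar>x\<bar>)\<close>, the Gaussian domination with exponential rate \<open>\<bar>h\<bar> + k + 1\<close> leaves a
  factor \<open>exp (- \<bar>x\<bar>)\<close>. It makes the boundary terms of the integration by parts vanish.\<close>

lemma tilted_weight_decay:
  assumes "0 < b"
  shows "\<exists>K. \<forall>x. \<bar>x ^ k * exp (h * x) * weight L b x\<bar> \<le> K * exp (- \<bar>x\<bar>)"
proof -
  obtain K where K: "0 < K" "\<And>x. exp ((\<bar>h\<bar> + k + 1) * \<bar>x\<bar>) * weight L b x \<le> K * exp (- x\<^sup>2 / 2)"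
    using weight_exp_le_gauss[OF assms, of b "\<bar>h\<bar> + k + 1" L] by auto
  have "\<bar>x ^ k * exp (h * x) * weight L b x\<bar> \<le> K * exp (- \<bar>x\<bar>)" for x
  proof -
    have "\<bar>x\<bar> \<le> exp \<bar>x\<bar>" using exp_ge_add_one_self[of "\<bar>x\<bar>"] by linarith
    then have "\<bar>x\<bar> ^ k \<le> exp (k * \<bar>x\<bar>)"
      using power_mono[of "\<bar>x\<bar>" "exp \<bar>x\<bar>" k] by (simp add: exp_of_nat_mult)
    moreover have "h * x \<le> \<bar>h\<bar> * \<bar>x\<bar>" by (simp add: abs_mult[symmetric])
    ultimately have "\<bar>x\<bar> ^ k * exp (h * x) * weight L b x \<le> exp (k * \<bar>x\<bar>) * exp (\<bar>h\<bar> * \<bar>x\<bar>) * weight L b x"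
      by (intro mult_right_mono mult_mono) auto
    also have "\<dots> = exp (- \<bar>x\<bar>) * (exp ((\<bar>h\<bar> + k + 1) * \<bar>x\<bar>) * weight L b x)"
      by (simp add: exp_add[symmetric] algebra_simps)
    also have "\<dots> \<le> exp (- \<bar>x\<bar>) * (K * exp (- x\<^sup>2 / 2))"
      by (intro mult_left_mono K) auto
    also have "\<dots> \<le> exp (- \<bar>x\<bar>) * (K * 1)"
      using K(1) by (intro mult_left_mono) auto
    finally show ?thesis by (simp add: abs_mult power_abs mult_ac)
  qed
  then show ?thesis by blast
qed

text \<open>The derivative of \<open>x ^ k * exp (h * x) * weight L b x\<close> integrates to \<open>0\<close> over the line. For
  \<open>k = 0\<close> the truncated difference \<open>k - 1\<close> is harmless because of the factor \<open>k\<close>.\<close>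

lemma moment_integration_by_parts:
  assumes b: "0 < b"
  shows "real k * moment L (k - 1) b h + h * moment L k b h
    = b * (moment L (k + 3) b h + (L - 1) * moment L (k + 1) b h)"
proof -
  define F where "F x = x ^ k * exp (h * x) * weight L b x" for x
  define e where "e j x = x ^ j * exp (h * x) * weight L b x" for j x
  define f where "f x = real k * e (k - 1) x + h * e k x - b * (e (k + 3) x + (L - 1) * e (k + 1) x)" for x
  have int: "integrable lborel (e j)" for j
    unfolding e_def using b by (rule integrable_moment)
  obtain K where K: "\<And>x. \<bar>F x\<bar> \<le> K * exp (- \<bar>x\<bar>)"
    using tilted_weight_decay[OF b, of k h L] unfolding F_def by auto
  have "(LINT x|lborel. f x) = 0"
  proof (rule integral_derivative_eq_0)
    show "(F has_real_derivative f x) (at x)" for x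
    proof -
      have "((\<lambda>x. - b * (x ^ 4 / 4 + (L - 1) * x\<^sup>2 / 2)) has_real_derivative - b * (x ^ 3 + (L - 1) * x)) (at x)"
        by (auto intro!: derivative_eq_intros simp: eval_nat_numeral)
      then have w: "(weight L b has_real_derivative weight L b x * (- b * (x ^ 3 + (L - 1) * x))) (at x)"
        unfolding weight_def by (rule DERIV_chain2[OF DERIV_exp])
      have p: "((\<lambda>x. x ^ k) has_real_derivative real k * x ^ (k - 1)) (at x)"
        by (auto intro!: derivative_eq_intros)
      have q: "((\<lambda>x. exp (h * x)) has_real_derivative exp (h * x) * h) (at x)"
        by (auto intro!: derivative_eq_intros)
      have ring: "c * (a * e * w) + h * (p * e * w) - b * (p * q * e * w + l * (p * r * e * w))
          = (c * a * e + e * h * p) * w + w * (- b * (q + l * r)) * (p * e)"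
        for a c e w p q r l :: real by (simp add: algebra_simps)
      have "x ^ (k + 3) = x ^ k * x ^ 3" "x ^ (k + 1) = x ^ k * x" by (simp_all add: power_add)
      then have "f x = (real k * x ^ (k - 1) * exp (h * x) + exp (h * x) * h * x ^ k) * weight L b x
          + weight L b x * (- b * (x ^ 3 + (L - 1) * x)) * (x ^ k * exp (h * x))"
        unfolding f_def e_def by (simp only: ring)
      then show ?thesis
        unfolding F_def using DERIV_mult[OF DERIV_mult[OF p q] w] by simp
    qed
    show "continuous_on UNIV f"
      unfolding f_def e_def weight_def by (intro continuous_intros) auto
    show "integrable lborel f"
      unfolding f_def by (intro Bochner_Integration.integrable_add Bochner_Integration.integrable_diff
          integrable_mult_right int)
    have "((\<lambda>x. K * exp (- x)) \<longlongrightarrow> K * 0) at_top"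
      by (intro tendsto_intros filterlim_compose[OF exp_at_bot] filterlim_uminus_at_bot_at_top)
    then have "((\<lambda>x. K * exp (- x)) \<longlongrightarrow> 0) at_top" by simp
    moreover have "\<forall>\<^sub>F x in at_top. norm (F x) \<le> K * exp (- x)"
      using eventually_ge_at_top[of 0]
    proof eventually_elim
      case (elim x)
      then show ?case using K[of x] by simp
    qed
    ultimately show "(F \<longlongrightarrow> 0) at_top" by (rule Lim_null_comparison[rotated])
    have "((\<lambda>x. K * exp x) \<longlongrightarrow> K * 0) at_bot"
      by (intro tendsto_intros exp_at_bot)
    then have "((\<lambda>x. K * exp x) \<longlongrightarrow> 0) at_bot" by simp
    moreover have "\<forall>\<^sub>F x in at_bot. norm (F x) \<le> K * exp x"
      using eventually_le_at_bot[of 0]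
    proof eventually_elim
      case (elim x)
      then show ?case using K[of x] by simp
    qed
    ultimately show "(F \<longlongrightarrow> 0) at_bot" by (rule Lim_null_comparison[rotated])
  qed
  moreover have "(LINT x|lborel. f x)
      = real k * moment L (k - 1) b h + h * moment L k b h
        - b * (moment L (k + 3) b h + (L - 1) * moment L (k + 1) b h)"
    unfolding f_def moment_def e_def[symmetric] using int by simp
  ultimately show ?thesis by simp
qed

section \<open>Temperature dependence of the symmetric variance\<close>

lemma moment_scale:
  assumes "0 < c"
  shows "moment L k b 0 = c ^ Suc k *
    (LINT x|lborel. x ^ k * exp (- b * (c ^ 4 * x ^ 4 / 4 + (L - 1) * c\<^sup>2 * x\<^sup>2 / 2)))"
proof -
  have "moment L k b 0 = c * (LINT x|lborel. (c * x) ^ k * weight L b (c * x))"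
    unfolding moment_def using assms
    by (subst lborel_integral_real_affine[where c = c and t = 0]) auto
  also have "\<dots> = c * (LINT x|lborel. c ^ k * (x ^ k * exp (- b * (c ^ 4 * x ^ 4 / 4 + (L - 1) * c\<^sup>2 * x\<^sup>2 / 2))))"
    by (simp add: weight_def power_mult_distrib mult_ac)
  finally show ?thesis by simp
qed

text \<open>With \<open>V\<close> the variance of the untilted measure at temperature \<open>s = 1 / b\<close>, this says that \<open>V / s\<close>
  does not increase with \<open>s\<close>. For \<open>L \<ge> 1\<close>, integration by parts gives
  \<open>s / V = M\<^sub>4 / M\<^sub>2 + L - 1\<close> in terms of moments, and \<open>M\<^sub>4 / M\<^sub>2\<close> grows with the temperature by
  association, since the potential is increasing in \<open>\<bar>x\<bar>\<close>. For \<open>L < 1\<close> the potential is not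
  monotone; rescaling the variable equalises the quartic terms, and the remaining ratio of the two
  weights is increasing in \<open>\<bar>x\<bar>\<close>.\<close>

lemma variance_over_temperature_mono:
  assumes "0 < b" "b \<le> b'"
  shows "b * (moment L 2 b 0 / moment L 0 b 0) \<le> b' * (moment L 2 b' 0 / moment L 0 b' 0)"
proof (cases "1 \<le> L")
  case True
  have b': "0 < b'" using assms by simp
  have pos: "0 < moment L k c 0" if "c = b \<or> c = b'" "even k" for k c
    using that assms by (auto intro: moment_pos)
  have int: "integrable lborel (\<lambda>x. x ^ k * weight L c x)" if "c = b \<or> c = b'" for c k
    using that assms integrable_moment[of c k 0 L] by auto
  have "0 * (moment L 0 b 0 * moment L 0 b 0 - (moment L 0 b 0)\<^sup>2)
      \<le> moment L 4 b 0 * moment L 2 b' 0 - moment L 4 b' 0 * moment L 2 b 0"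
    unfolding moment_def
  proof (rule symmetrized_product_le)
    fix x y :: real
    define V where "V z = z ^ 4 / 4 + (L - 1) * z\<^sup>2 / 2" for z :: real
    have w: "weight L b' z = weight L b z * exp (- (b' - b) * V z)" for z
    proof -
      have "- b' * V z = - b * V z + - (b' - b) * V z" by (simp add: algebra_simps)
      then show ?thesis by (simp only: weight_def V_def[symmetric] exp_add)
    qed
    have cmp: "0 \<le> (x\<^sup>2 - y\<^sup>2) * (exp (- (b' - b) * V y) - exp (- (b' - b) * V x))" for x y
    proof -
      have "0 \<le> (x\<^sup>2 - y\<^sup>2) * (exp (- (b' - b) * V y) - exp (- (b' - b) * V x))"
        if le: "y\<^sup>2 \<le> x\<^sup>2" for x y
      proof -
        have "(y\<^sup>2)\<^sup>2 \<le> (x\<^sup>2)\<^sup>2" using le by (rule power_mono) simp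
        moreover have "(L - 1) * y\<^sup>2 \<le> (L - 1) * x\<^sup>2" using le True by (intro mult_left_mono) auto
        ultimately have "V y \<le> V x" by (simp add: V_def)
        then have "(b' - b) * V y \<le> (b' - b) * V x" using assms by (intro mult_left_mono) auto
        then have "exp (- (b' - b) * V x) \<le> exp (- (b' - b) * V y)"
          by (simp only: exp_le_cancel_iff minus_mult_left[symmetric] neg_le_iff_le)
        then show ?thesis using le by (intro mult_nonneg_nonneg) auto
      qed
      from this[of y x] this[of x y] show ?thesis
        by (cases "y\<^sup>2 \<le> x\<^sup>2") (auto simp: algebra_simps)
    qed
    have "0 \<le> x\<^sup>2 * y\<^sup>2 * weight L b x * weight L b y
        * ((x\<^sup>2 - y\<^sup>2) * (exp (- (b' - b) * V y) - exp (- (b' - b) * V x)))"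
      by (intro mult_nonneg_nonneg cmp) auto
    also have "\<dots> = x ^ 4 * exp (0 * x) * weight L b x * (y\<^sup>2 * exp (0 * y) * weight L b' y)
        + x\<^sup>2 * exp (0 * x) * weight L b' x * (y ^ 4 * exp (0 * y) * weight L b y)
        - x ^ 4 * exp (0 * x) * weight L b' x * (y\<^sup>2 * exp (0 * y) * weight L b y)
        - x\<^sup>2 * exp (0 * x) * weight L b x * (y ^ 4 * exp (0 * y) * weight L b' y)"
      unfolding w by (simp add: power2_eq_square eval_nat_numeral algebra_simps)
    finally show "0 * (x ^ 0 * exp (0 * x) * weight L b x * (y ^ 0 * exp (0 * y) * weight L b y)
        + x ^ 0 * exp (0 * x) * weight L b x * (y ^ 0 * exp (0 * y) * weight L b y)
        - 2 * (x ^ 0 * exp (0 * x) * weight L b x) * (y ^ 0 * exp (0 * y) * weight L b y))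
        \<le> x ^ 4 * exp (0 * x) * weight L b x * (y\<^sup>2 * exp (0 * y) * weight L b' y)
        + x\<^sup>2 * exp (0 * x) * weight L b' x * (y ^ 4 * exp (0 * y) * weight L b y)
        - x ^ 4 * exp (0 * x) * weight L b' x * (y\<^sup>2 * exp (0 * y) * weight L b y)
        - x\<^sup>2 * exp (0 * x) * weight L b x * (y ^ 4 * exp (0 * y) * weight L b' y)" by simp
  qed (intro integrable_moment assms b')+
  then have cross: "moment L 4 b' 0 * moment L 2 b 0 \<le> moment L 4 b 0 * moment L 2 b' 0" by simp
  have parts: "moment L 0 c 0 = c * (moment L 4 c 0 + (L - 1) * moment L 2 c 0)" if "0 < c" for c
    using moment_integration_by_parts[OF that, of 1 L 0] by (simp add: numeral_2_eq_2)
  have "c * (moment L 2 c 0 / moment L 0 c 0) = 1 / (moment L 4 c 0 / moment L 2 c 0 + (L - 1))"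
    if "c = b \<or> c = b'" for c
  proof -
    have c: "0 < c" using that assms b' by auto
    have M2: "0 < moment L 2 c 0" and M0: "0 < moment L 0 c 0" using pos that by auto
    have "0 < moment L 4 c 0 + (L - 1) * moment L 2 c 0"
      using M0 c unfolding parts[OF c] by (simp add: zero_less_mult_iff)
    moreover have "moment L 4 c 0 / moment L 2 c 0 + (L - 1)
        = (moment L 4 c 0 + (L - 1) * moment L 2 c 0) / moment L 2 c 0"
      using M2 by (simp add: add_divide_distrib)
    ultimately show ?thesis
      unfolding parts[OF c] using c M2 by simp
  qed
  moreover have "moment L 4 b' 0 / moment L 2 b' 0 \<le> moment L 4 b 0 / moment L 2 b 0"
    using cross pos[of b 2] pos[of b' 2] by (simp add: field_simps)
  moreover have "0 < moment L 4 b' 0 / moment L 2 b' 0 + (L - 1)"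
    using True pos[of b' 2] pos[of b' 4] by (intro add_pos_nonneg) auto
  ultimately show ?thesis by (simp add: frac_le)
next
  case False
  \<comment> \<open>The substitution \<open>x = c * y\<close> turns the quartic coefficient \<open>b\<close> into \<open>b * c ^ 4 = b'\<close> and the quadratic one into \<open>b * c\<^sup>2 = sqrt (b * b')\<close>.\<close>
  define c where "c = root 4 (b' / b)"
  have b': "0 < b'" using assms by simp
  have c: "0 < c" "c ^ 4 = b' / b" "1 \<le> c" using assms b' by (auto simp: c_def)
  define \<beta> where "\<beta> = b * c\<^sup>2"
  have \<beta>: "0 < \<beta>" "\<beta> \<le> b'"
  proof -
    have "c\<^sup>2 \<le> c ^ 4" using c by (intro power_increasing) auto
    then have "\<beta> \<le> b * c ^ 4" using assms by (simp add: \<beta>_def)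
    then show "\<beta> \<le> b'" using assms c by simp
    show "0 < \<beta>" using assms c by (simp add: \<beta>_def)
  qed
  define u where "u x = exp (- b' * x ^ 4 / 4 + \<beta> * (1 - L) * x\<^sup>2 / 2)" for x
  define u' where "u' = weight L b'"
  have u_weight: "u = weight (1 + (L - 1) * (\<beta> / b')) b'"
    using b' by (auto simp: u_def weight_def fun_eq_iff field_simps)
  have scale: "moment L k b 0 = c ^ Suc k * (LINT x|lborel. x ^ k * u x)" for k
  proof -
    have "b * c ^ 4 = b'" using c assms by simp
    note b'_eq = this[symmetric]
    have "- b * (c ^ 4 * x ^ 4 / 4 + (L - 1) * c\<^sup>2 * x\<^sup>2 / 2)
        = - b' * x ^ 4 / 4 + \<beta> * (1 - L) * x\<^sup>2 / 2" for x
      unfolding \<beta>_def b'_eq by (simp add: field_simps)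
    then show ?thesis unfolding moment_scale[OF c(1)] u_def by simp
  qed
  define U where "U k = (LINT x|lborel. x ^ k * u x)" for k
  define U' where "U' k = (LINT x|lborel. x ^ k * u' x)" for k
  have U': "U' k = moment L k b' 0" for k by (simp add: U'_def u'_def moment_def)
  have U: "U k = moment (1 + (L - 1) * (\<beta> / b')) k b' 0" for k
    by (simp add: U_def u_weight moment_def)
  have int: "integrable lborel (\<lambda>x. x ^ k * u x)" "integrable lborel (\<lambda>x. x ^ k * u' x)" for k
    using integrable_moment[OF b', where h = 0] by (auto simp: u_weight u'_def)
  have "0 * (U 0 * U 0 - (U 0)\<^sup>2) \<le> U' 2 * U 0 - U 2 * U' 0"
    unfolding U_def U'_def
  proof (rule symmetrized_product_le)
    fix x y :: real
    define r where "r z = exp ((b' - \<beta>) * (1 - L) * z\<^sup>2 / 2)" for z :: real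
    have w: "u' z = u z * r z" for z
      by (simp add: u_def u'_def r_def weight_def exp_add[symmetric] field_simps)
    have upos: "0 \<le> u z" for z by (simp add: u_def)
    have cmp: "0 \<le> (x\<^sup>2 - y\<^sup>2) * (r x - r y)" for x y
    proof -
      have "0 \<le> (x\<^sup>2 - y\<^sup>2) * (r x - r y)" if le: "y\<^sup>2 \<le> x\<^sup>2" for x y
      proof -
        have "(b' - \<beta>) * (1 - L) * y\<^sup>2 \<le> (b' - \<beta>) * (1 - L) * x\<^sup>2"
          using le False \<beta> by (intro mult_left_mono) auto
        then show ?thesis using le by (intro mult_nonneg_nonneg) (auto simp: r_def)
      qed
      from this[of y x] this[of x y] show ?thesis
        by (cases "y\<^sup>2 \<le> x\<^sup>2") (auto simp: algebra_simps)
    qed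
    have "0 \<le> u x * u y * ((x\<^sup>2 - y\<^sup>2) * (r x - r y))"
      by (intro mult_nonneg_nonneg cmp upos)
    also have "\<dots> = x\<^sup>2 * u' x * (y ^ 0 * u y) + x ^ 0 * u x * (y\<^sup>2 * u' y)
        - x\<^sup>2 * u x * (y ^ 0 * u' y) - x ^ 0 * u' x * (y\<^sup>2 * u y)"
      unfolding w by (simp add: algebra_simps)
    finally show "0 * (x ^ 0 * u x * (y ^ 0 * u y) + x ^ 0 * u x * (y ^ 0 * u y) - 2 * (x ^ 0 * u x) * (y ^ 0 * u y))
        \<le> x\<^sup>2 * u' x * (y ^ 0 * u y) + x ^ 0 * u x * (y\<^sup>2 * u' y)
        - x\<^sup>2 * u x * (y ^ 0 * u' y) - x ^ 0 * u' x * (y\<^sup>2 * u y)" by simp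
  qed (rule int)+
  moreover have pos: "0 < U 0" "0 < U' 0" "0 < U' 2"
    unfolding U U' using b' by (auto intro: moment_pos)
  ultimately have "U 2 / U 0 \<le> U' 2 / U' 0"
    by (simp add: field_simps)
  then have "b * (c\<^sup>2 * (U 2 / U 0)) \<le> b * (c\<^sup>2 * (U' 2 / U' 0))"
    using assms by (intro mult_left_mono) auto
  also have "\<dots> = \<beta> * (U' 2 / U' 0)" by (simp add: \<beta>_def)
  also have "\<dots> \<le> b' * (U' 2 / U' 0)" using \<beta> pos by (intro mult_right_mono) auto
  also have "b * (c\<^sup>2 * (U 2 / U 0)) = b * (moment L 2 b 0 / moment L 0 b 0)"
    unfolding scale U_def[symmetric] using c(1) by (simp add: eval_nat_numeral)
  finally show ?thesis by (simp add: U')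
qed


section \<open>The self-consistency equation\<close>

definition gibbs_mean :: "real \<Rightarrow> real \<Rightarrow> real \<Rightarrow> real" where
  "gibbs_mean L s h = moment L 1 (1 / s) h / moment L 0 (1 / s) h"

definition gibbs_variance :: "real \<Rightarrow> real \<Rightarrow> real \<Rightarrow> real" where
  "gibbs_variance L s h = moment L 2 (1 / s) h / moment L 0 (1 / s) h - (gibbs_mean L s h)\<^sup>2"

definition self_consistent :: "real \<Rightarrow> real \<Rightarrow> real \<Rightarrow> bool" where
  "self_consistent L s h \<longleftrightarrow> gibbs_mean L s h = s * h / L"

text \<open>The ratio of the third to the first tilted moment for \<open>h \<noteq> 0\<close>; at \<open>h = 0\<close> it is its limit, the
  ratio of the fourth to the second moment.\<close>

definition cubic_ratio :: "real \<Rightarrow> real \<Rightarrow> real \<Rightarrow> real" where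
  "cubic_ratio L b h = sinhc_moment L 4 b h / sinhc_moment L 2 b h"

lemma moment_3_1:
  assumes "0 < b"
  shows "moment L 3 b h = h * sinhc_moment L 4 b h" "moment L (Suc 0) b h = h * sinhc_moment L 2 b h"
proof -
  have "odd (3::nat)" "Suc 3 = 4" by simp_all
  then show "moment L 3 b h = h * sinhc_moment L 4 b h"
    using moment_odd[OF assms, of 3 L h] by simp
  show "moment L (Suc 0) b h = h * sinhc_moment L 2 b h"
    using moment_odd[OF assms, of 1 L h] by (simp add: numeral_2_eq_2)
qed

lemma gibbs_mean_0 [simp]: "0 < s \<Longrightarrow> gibbs_mean L s 0 = 0"
  by (simp add: gibbs_mean_def moment_3_1)

lemma gibbs_mean_minus: "gibbs_mean L s (- h) = - gibbs_mean L s h"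
  by (simp add: gibbs_mean_def moment_minus)

lemma gibbs_variance_minus: "gibbs_variance L s (- h) = gibbs_variance L s h"
  by (simp add: gibbs_variance_def moment_minus gibbs_mean_minus)

lemma self_consistent_0 [simp]: "0 < s \<Longrightarrow> self_consistent L s 0"
  by (simp add: self_consistent_def)

lemma self_consistent_minus: "self_consistent L s (- h) \<longleftrightarrow> self_consistent L s h"
  by (simp add: self_consistent_def gibbs_mean_minus)

text \<open>Integration by parts expresses \<open>h\<close> times the mass through the third and first moments; in the
  self-consistency equation the terms with \<open>L\<close> then cancel, leaving equality of these two moments.\<close>

lemma self_consistent_iff_cubic_ratio:
  assumes "0 < L" "0 < s" "h \<noteq> 0"
  shows "self_consistent L s h \<longleftrightarrow> cubic_ratio L (1 / s) h = 1"
proof -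
  have b: "0 < 1 / s" using assms by simp
  let ?M = "\<lambda>k. moment L k (1 / s) h" and ?S = "\<lambda>k. sinhc_moment L k (1 / s) h"
  have pos: "0 < ?M 0" "0 < ?S 2" using b by (auto intro: moment_pos sinhc_moment_pos)
  have "h * ?M 0 = 1 / s * (?M 3 + (L - 1) * ?M 1)"
    using moment_integration_by_parts[OF b, of 0 L h] by (simp add: numeral_3_eq_3)
  then have parts: "s * (h * ?M 0) = ?M 3 + (L - 1) * ?M 1"
    using assms by simp
  have "self_consistent L s h \<longleftrightarrow> L * ?M 1 = s * (h * ?M 0)"
    using assms pos by (auto simp: self_consistent_def gibbs_mean_def field_simps)
  also have "\<dots> \<longleftrightarrow> ?M 3 = ?M 1"
    unfolding parts by (auto simp: algebra_simps)
  also have "\<dots> \<longleftrightarrow> ?S 4 = ?S 2"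
    using assms b by (simp add: moment_3_1)
  also have "\<dots> \<longleftrightarrow> cubic_ratio L (1 / s) h = 1"
    using pos by (auto simp: cubic_ratio_def)
  finally show ?thesis .
qed

text \<open>Integration by parts with equal second and fourth moments reads \<open>s * M\<^sub>0 = L * M\<^sub>2\<close>.\<close>

lemma critical_variance:
  assumes "0 < L" "0 < s" "cubic_ratio L (1 / s) 0 = 1"
  shows "gibbs_variance L s 0 = s / L"
proof -
  have b: "0 < 1 / s" using assms by simp
  let ?M = "\<lambda>k. moment L k (1 / s) 0"
  have pos: "0 < ?M 0" "0 < ?M 2" using b by (auto intro: moment_pos)
  have "?M 4 = ?M 2"
    using assms pos by (simp add: cubic_ratio_def sinhc_moment_0)
  moreover have "?M 0 = 1 / s * (?M 4 + (L - 1) * ?M 2)"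
    using moment_integration_by_parts[OF b, of 1 L 0] by (simp add: numeral_2_eq_2)
  ultimately have "s * ?M 0 = L * ?M 2"
    using assms by (simp add: algebra_simps)
  then show ?thesis
    using assms pos by (simp add: gibbs_variance_def field_simps)
qed

text \<open>The variance of \<open>x ^ k\<close> is nonnegative.\<close>

lemma moment_jensen:
  assumes "0 < b"
  shows "(moment L k b h / moment L 0 b h)\<^sup>2 \<le> moment L (2 * k) b h / moment L 0 b h"
proof -
  let ?M = "\<lambda>k. moment L k b h"
  define t where "t = ?M k / ?M 0"
  have M0: "0 < ?M 0" using assms by (simp add: moment_pos)
  have int: "integrable lborel (\<lambda>x. x ^ k * exp (h * x) * weight L b x)" for k
    using assms by (rule integrable_moment)
  have eq: "(x ^ k - t)\<^sup>2 * exp (h * x) * weight L b x = x ^ (2 * k) * exp (h * x) * weight L b x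
      - 2 * t * (x ^ k * exp (h * x) * weight L b x) + t\<^sup>2 * (x ^ 0 * exp (h * x) * weight L b x)" for x
  proof -
    have "(p - t)\<^sup>2 * e * w = p\<^sup>2 * e * w - 2 * t * (p * e * w) + t\<^sup>2 * (x ^ 0 * e * w)" for p e w
      by (simp add: power2_eq_square algebra_simps)
    then show ?thesis by (simp only: power_even_eq)
  qed
  have "0 \<le> (LINT x|lborel. (x ^ k - t)\<^sup>2 * exp (h * x) * weight L b x)"
    by (intro Bochner_Integration.integral_nonneg) auto
  also have "\<dots> = ?M (2 * k) - 2 * t * ?M k + t\<^sup>2 * ?M 0"
    unfolding eq moment_def using int int[of 0] by (simp del: power_0)
  also have "\<dots> = ?M 0 * (?M (2 * k) / ?M 0 - t\<^sup>2)"
    using M0 by (simp add: t_def power2_eq_square field_simps)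
  finally show ?thesis
    using M0 by (simp add: zero_le_mult_iff t_def)
qed

lemma gibbs_variance_nonneg: "0 < s \<Longrightarrow> 0 \<le> gibbs_variance L s h"
  using moment_jensen[of "1 / s" L 1 h] by (simp add: gibbs_variance_def gibbs_mean_def)

text \<open>With \<open>m\<close> the mean and \<open>E\<^sub>k\<close> the normalised moments, integration by parts gives
  \<open>E\<^sub>4 = s + E\<^sub>2 - L * (E\<^sub>2 - m\<^sup>2) \<le> s + E\<^sub>2\<close>. Since \<open>E\<^sub>2\<^sup>2 \<le> E\<^sub>4\<close>, this bounds
  \<open>E\<^sub>2\<close>, hence \<open>m\<close> and \<open>h = L * m / s\<close>. It confines the branches to a compact set.\<close>

lemma self_consistent_bound:
  assumes "0 < L" "0 < s" "self_consistent L s h"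
  shows "h \<le> L * (1 / s + 1)"
proof -
  have b: "0 < 1 / s" using assms by simp
  let ?M = "\<lambda>k. moment L k (1 / s) h"
  define m E2 E4 where "m = s * h / L" and "E2 = ?M 2 / ?M 0" and "E4 = ?M 4 / ?M 0"
  have M0: "0 < ?M 0" using b by (simp add: moment_pos)
  have m: "m = ?M 1 / ?M 0" using assms by (simp add: m_def self_consistent_def gibbs_mean_def)
  have jensen: "E2\<^sup>2 \<le> E4" "m\<^sup>2 \<le> E2"
    using moment_jensen[OF b, of L 2 h] moment_jensen[OF b, of L 1 h] by (simp_all add: E2_def E4_def m)
  have "?M 0 + h * ?M 1 = 1 / s * (?M 4 + (L - 1) * ?M 2)"
    using moment_integration_by_parts[OF b, of 1 L h] by (simp add: numeral_2_eq_2)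
  then have "s * (?M 0 + h * ?M 1) = ?M 4 + (L - 1) * ?M 2"
    using assms by simp
  then have "s * (?M 0 + h * ?M 1) / ?M 0 = (?M 4 + (L - 1) * ?M 2) / ?M 0" by simp
  moreover have "s * (?M 0 + h * ?M 1) / ?M 0 = s + s * h * m"
    using M0 unfolding m by (simp add: field_simps)
  ultimately have "s + s * h * m = E4 + (L - 1) * E2"
    unfolding E2_def E4_def by (simp add: add_divide_distrib)
  moreover have "s * h = L * m" using assms by (simp add: m_def)
  then have "s * h * m = L * m\<^sup>2" by (simp add: power2_eq_square)
  ultimately have "E4 = s + E2 - L * (E2 - m\<^sup>2)"
    by (simp add: algebra_simps)
  moreover have "0 \<le> L * (E2 - m\<^sup>2)" using assms jensen by simp
  ultimately have E2: "E2\<^sup>2 \<le> s + E2" using jensen(1) by linarith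
  have "E2 \<le> 1 + s"
  proof (rule ccontr)
    assume "\<not> E2 \<le> 1 + s"
    then have "(1 + s) * s < E2 * (E2 - 1)" using assms by (intro mult_strict_mono) auto
    moreover have "s \<le> (1 + s) * s"
      using assms mult_pos_pos[of s s] unfolding distrib_right by linarith
    moreover have "E2 * (E2 - 1) = E2\<^sup>2 - E2" by (simp add: power2_eq_square right_diff_distrib)
    ultimately show False using E2 by linarith
  qed
  then have "m\<^sup>2 \<le> (1 + s)" using jensen by linarith
  also have "1 + s \<le> (1 + s)\<^sup>2"
  proof -
    have "(1 + s)\<^sup>2 = 1 + s + (s + s * s)" by (simp add: power2_eq_square algebra_simps)
    moreover have "0 \<le> s + s * s" using assms by simp
    ultimately show ?thesis by linarith
  qed
  finally have "m\<^sup>2 \<le> (1 + s)\<^sup>2" .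
  then have "m \<le> 1 + s" by (rule power2_le_imp_le) (use assms(2) in simp)
  then have "L * m / s \<le> L * (1 + s) / s" using assms by (intro divide_right_mono mult_left_mono) auto
  also have "L * (1 + s) / s = L * (1 / s + 1)" using assms by (simp add: field_simps)
  also have "L * m / s = h" using assms by (simp add: m_def)
  finally show ?thesis .
qed

lemma abs_divide_diff_le:
  fixes p q p' q' :: real
  assumes "\<bar>p - p'\<bar> \<le> d" "\<bar>q - q'\<bar> \<le> d'" "0 \<le> p'" "p' \<le> B" "0 < l" "l \<le> q" "l \<le> q'"
  shows "\<bar>p / q - p' / q'\<bar> \<le> d / l + B * d' / l\<^sup>2"
proof -
  have q: "0 < q" "0 < q'" using assms by auto
  have "p / q - p' / q' = (p - p') / q + p' * (q' - q) / (q * q')"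
  proof -
    have "p' * (q' - q) / (q * q') = p' / q - p' / q'"
      using q by (simp add: right_diff_distrib diff_divide_distrib)
    then show ?thesis by (simp add: diff_divide_distrib)
  qed
  then have "\<bar>p / q - p' / q'\<bar> \<le> \<bar>(p - p') / q\<bar> + \<bar>p' * (q' - q) / (q * q')\<bar>"
    using abs_triangle_ineq[of "(p - p') / q" "p' * (q' - q) / (q * q')"] by simp
  also have "\<bar>(p - p') / q\<bar> = \<bar>p - p'\<bar> / q" using q by simp
  also have "\<bar>p' * (q' - q) / (q * q')\<bar> = p' * \<bar>q - q'\<bar> / (q * q')"
    using q assms by (simp add: abs_mult abs_minus_commute)
  also have "\<bar>p - p'\<bar> / q + p' * \<bar>q - q'\<bar> / (q * q') \<le> d / l + B * d' / l\<^sup>2"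
  proof (rule add_mono)
    have d: "0 \<le> d" "0 \<le> d'" using assms(1,2) by linarith+
    show "\<bar>p - p'\<bar> / q \<le> d / l" using assms d by (intro frac_le) auto
    have "p' * \<bar>q - q'\<bar> \<le> B * d'" using assms d by (intro mult_mono) auto
    moreover have "l\<^sup>2 \<le> q * q'" unfolding power2_eq_square using assms q by (intro mult_mono) auto
    moreover have "0 \<le> B * d'" "0 < l\<^sup>2" using assms d by auto
    ultimately show "p' * \<bar>q - q'\<bar> / (q * q') \<le> B * d' / l\<^sup>2" by (intro frac_le)
  qed
  finally show ?thesis .
qed

lemma cubic_ratio_lipschitz:
  assumes "0 < b\<^sub>1"
  shows "\<exists>C>0. \<forall>b\<in>{b\<^sub>1..b\<^sub>0}. \<forall>b'\<in>{b\<^sub>1..b\<^sub>0}. \<forall>h. \<bar>h\<bar> \<le> H \<longrightarrow>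
    \<bar>cubic_ratio L b h - cubic_ratio L b' h\<bar> \<le> C * \<bar>b - b'\<bar>"
proof (cases "b\<^sub>1 \<le> b\<^sub>0")
  case True
  obtain C\<^sub>4 where C4: "0 < C\<^sub>4" "\<And>b b' h. b \<in> {b\<^sub>1..b\<^sub>0} \<Longrightarrow> b' \<in> {b\<^sub>1..b\<^sub>0} \<Longrightarrow> \<bar>h\<bar> \<le> H \<Longrightarrow>
      \<bar>sinhc_moment L 4 b h - sinhc_moment L 4 b' h\<bar> \<le> C\<^sub>4 * \<bar>b - b'\<bar>"
    using sinhc_moment_lipschitz[OF assms, of b\<^sub>0 H L 4] by blast
  obtain C\<^sub>2 where C2: "0 < C\<^sub>2" "\<And>b b' h. b \<in> {b\<^sub>1..b\<^sub>0} \<Longrightarrow> b' \<in> {b\<^sub>1..b\<^sub>0} \<Longrightarrow> \<bar>h\<bar> \<le> H \<Longrightarrow>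
      \<bar>sinhc_moment L 2 b h - sinhc_moment L 2 b' h\<bar> \<le> C\<^sub>2 * \<bar>b - b'\<bar>"
    using sinhc_moment_lipschitz[OF assms, of b\<^sub>0 H L 2] by blast
  obtain B where B: "0 < B" "\<And>b h. b \<in> {b\<^sub>1..b\<^sub>0} \<Longrightarrow> \<bar>h\<bar> \<le> H \<Longrightarrow> sinhc_moment L 4 b h \<le> B"
    using sinhc_moment_bounded[OF assms, of b\<^sub>0 H L 4] by blast
  define l where "l = moment (1 + \<bar>L - 1\<bar>) 2 b\<^sub>0 0"
  have l: "0 < l" using assms True by (simp add: l_def moment_pos)
  have l_le: "l \<le> sinhc_moment L 2 b h" if "b \<in> {b\<^sub>1..b\<^sub>0}" for b h
    unfolding l_def using that assms
    by (intro order_trans[OF moment_0_ge[of b b\<^sub>0 2 L] sinhc_moment_ge]) auto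
  show ?thesis
  proof (intro exI[of _ "C\<^sub>4 / l + B * C\<^sub>2 / l\<^sup>2"] conjI ballI allI impI)
    show "0 < C\<^sub>4 / l + B * C\<^sub>2 / l\<^sup>2" using C4(1) C2(1) B(1) l by (simp add: add_pos_pos)
    fix b b' h assume *: "b \<in> {b\<^sub>1..b\<^sub>0}" "b' \<in> {b\<^sub>1..b\<^sub>0}" "\<bar>h\<bar> \<le> H"
    have "\<bar>cubic_ratio L b h - cubic_ratio L b' h\<bar> \<le> C\<^sub>4 * \<bar>b - b'\<bar> / l + B * (C\<^sub>2 * \<bar>b - b'\<bar>) / l\<^sup>2"
      unfolding cubic_ratio_def
      using * assms by (intro abs_divide_diff_le C4 C2 B l l_le) (auto intro!: order_less_imp_le[OF sinhc_moment_pos])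
    then show "\<bar>cubic_ratio L b h - cubic_ratio L b' h\<bar> \<le> (C\<^sub>4 / l + B * C\<^sub>2 / l\<^sup>2) * \<bar>b - b'\<bar>"
      by (simp add: distrib_right mult.assoc)
  qed
qed (auto intro: exI[of _ 1])

text \<open>The nondegeneracy on which everything rests: the increase is at least of order \<open>h\<^sup>2 - h'\<^sup>2\<close>, uniformly
  down to \<open>h' = 0\<close>. It makes the positive solution unique and the bifurcation a square root.\<close>

lemma cubic_ratio_strict_mono_quantitative:
  assumes "0 < b\<^sub>1"
  shows "\<exists>c>0. \<forall>b\<in>{b\<^sub>1..b\<^sub>0}. \<forall>h h'. 0 \<le> h' \<and> h' \<le> h \<and> h \<le> H \<longrightarrow>
    c * (h\<^sup>2 - h'\<^sup>2) \<le> cubic_ratio L b h - cubic_ratio L b h'"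
proof (cases "b\<^sub>1 \<le> b\<^sub>0")
  case True
  then have b0: "0 < b\<^sub>0" using assms by simp
  obtain B where B: "0 < B" "\<And>b h. b \<in> {b\<^sub>1..b\<^sub>0} \<Longrightarrow> \<bar>h\<bar> \<le> H \<Longrightarrow> sinhc_moment L 2 b h \<le> B"
    using sinhc_moment_bounded[OF assms, of b\<^sub>0 H L 2] by blast
  define M where "M k = moment (1 + \<bar>L - 1\<bar>) k b\<^sub>0 0" for k
  define d where "d = M 2 * M 6 - (M 4)\<^sup>2"
  have d: "0 < d"
    using moment_cauchy_schwarz_strict[OF b0, of "1 + \<bar>L - 1\<bar>"] by (simp add: d_def M_def)
  show ?thesis
  proof (intro exI[of _ "d / (6 * B\<^sup>2)"] conjI ballI allI impI)
    show "0 < d / (6 * B\<^sup>2)" using d B(1) by simp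
    fix b h h' assume b: "b \<in> {b\<^sub>1..b\<^sub>0}" and h: "0 \<le> h' \<and> h' \<le> h \<and> h \<le> H"
    let ?S = "\<lambda>k h. sinhc_moment L k b h"
    have pos: "0 < ?S 2 h" "0 < ?S 2 h'" using b assms by (auto intro: sinhc_moment_pos)
    have "h'\<^sup>2 \<le> h\<^sup>2" using h by (intro power_mono) auto
    then have nn: "0 \<le> (h\<^sup>2 - h'\<^sup>2) / 6 * d" using d by simp
    have "d / (6 * B\<^sup>2) * (h\<^sup>2 - h'\<^sup>2) = (h\<^sup>2 - h'\<^sup>2) / 6 * d / (B * B)"
      by (simp add: power2_eq_square)
    also have "\<dots> \<le> (h\<^sup>2 - h'\<^sup>2) / 6 * d / (?S 2 h * ?S 2 h')"
      using b h B pos nn by (intro divide_left_mono mult_mono mult_pos_pos) auto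
    also have "\<dots> \<le> (?S 4 h * ?S 2 h' - ?S 4 h' * ?S 2 h) / (?S 2 h * ?S 2 h')"
      using sinhc_moment_cross_diff_ge[of b b\<^sub>0 h' h L] b h assms pos
      by (intro divide_right_mono) (auto simp: d_def M_def)
    also have "\<dots> = cubic_ratio L b h - cubic_ratio L b h'"
      using pos by (simp add: cubic_ratio_def field_simps)
    finally show "d / (6 * B\<^sup>2) * (h\<^sup>2 - h'\<^sup>2) \<le> cubic_ratio L b h - cubic_ratio L b h'" .
  qed
qed (auto intro: exI[of _ 1])

lemma sinhc_moment_continuous_on:
  assumes "0 < b"
  shows "continuous_on {- H..H} (sinhc_moment L k b)"
proof (rule continuous_on_sequentiallyI)
  fix u :: "nat \<Rightarrow> real" and a
  assume u: "\<forall>n. u n \<in> {- H..H}" "u \<longlonglongrightarrow> a"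
  show "(\<lambda>n. sinhc_moment L k b (u n)) \<longlonglongrightarrow> sinhc_moment L k b a"
    unfolding sinhc_moment_def
  proof (rule integral_dominated_convergence[where w = "\<lambda>x. \<bar>x\<bar> ^ k * exp (H * \<bar>x\<bar>) * weight L b x"])
    show "integrable lborel (\<lambda>x. \<bar>x\<bar> ^ k * exp (H * \<bar>x\<bar>) * weight L b x)"
      using assms by (intro integrable_times_weight[where k = k and H = H]) (auto simp: abs_mult)
    have "(\<lambda>n. x ^ k * sinhc (u n * x) * weight L b x) \<longlonglongrightarrow> x ^ k * sinhc (a * x) * weight L b x" for x
      by (intro tendsto_intros isCont_tendsto_compose[OF isCont_sinhc] u)
    then show "AE x in lborel. (\<lambda>n. x ^ k * sinhc (u n * x) * weight L b x) \<longlonglongrightarrow> x ^ k * sinhc (a * x) * weight L b x"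
      by simp
    have "\<bar>x ^ k * sinhc (u n * x) * weight L b x\<bar> \<le> \<bar>x\<bar> ^ k * exp (H * \<bar>x\<bar>) * weight L b x" for n x
    proof -
      have "\<bar>sinhc (u n * x)\<bar> \<le> exp (H * \<bar>x\<bar>)"
        using u(1)[rule_format, of n] by (intro order_trans[OF sinhc_abs_le exp_abs_mono_tilt]) auto
      then show ?thesis by (simp add: abs_mult power_abs mult_left_mono mult_right_mono)
    qed
    then show "AE x in lborel. norm (x ^ k * sinhc (u n * x) * weight L b x) \<le> \<bar>x\<bar> ^ k * exp (H * \<bar>x\<bar>) * weight L b x" for n
      by simp
  qed measurable
qed

lemma cubic_ratio_continuous_on:
  assumes "0 < b"
  shows "continuous_on {0..H} (cubic_ratio L b)"
proof -
  have "sinhc_moment L 2 b h \<noteq> 0" for h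
    using sinhc_moment_pos[OF assms, of 2 L h] by simp
  moreover have "continuous_on {0..H} (sinhc_moment L k b)" for k
    by (rule continuous_on_subset[OF sinhc_moment_continuous_on[OF assms]]) auto
  ultimately show ?thesis unfolding cubic_ratio_def by (intro continuous_intros) auto
qed

lemma second_moment_lipschitz:
  assumes "0 < b\<^sub>1"
  shows "\<exists>C>0. \<forall>b\<in>{b\<^sub>1..b\<^sub>0}. \<forall>b'\<in>{b\<^sub>1..b\<^sub>0}. \<forall>h h'. \<bar>h\<bar> \<le> H \<longrightarrow> \<bar>h'\<bar> \<le> H \<longrightarrow>
    \<bar>moment L 2 b h / moment L 0 b h - moment L 2 b' h' / moment L 0 b' h'\<bar>
      \<le> C * (\<bar>b - b'\<bar> + \<bar>h\<^sup>2 - h'\<^sup>2\<bar>)"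
proof (cases "b\<^sub>1 \<le> b\<^sub>0")
  case True
  obtain C\<^sub>2 where C2: "0 < C\<^sub>2" "\<And>b b' h h'. b \<in> {b\<^sub>1..b\<^sub>0} \<Longrightarrow> b' \<in> {b\<^sub>1..b\<^sub>0} \<Longrightarrow> \<bar>h\<bar> \<le> H \<Longrightarrow> \<bar>h'\<bar> \<le> H \<Longrightarrow>
      \<bar>cosh_moment L 2 b h - cosh_moment L 2 b' h'\<bar> \<le> C\<^sub>2 * (\<bar>b - b'\<bar> + \<bar>h\<^sup>2 - h'\<^sup>2\<bar>)"
    using cosh_moment_lipschitz[OF assms, of b\<^sub>0 H L 2] by blast
  obtain C\<^sub>0 where C0: "0 < C\<^sub>0" "\<And>b b' h h'. b \<in> {b\<^sub>1..b\<^sub>0} \<Longrightarrow> b' \<in> {b\<^sub>1..b\<^sub>0} \<Longrightarrow> \<bar>h\<bar> \<le> H \<Longrightarrow> \<bar>h'\<bar> \<le> H \<Longrightarrow>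
      \<bar>cosh_moment L 0 b h - cosh_moment L 0 b' h'\<bar> \<le> C\<^sub>0 * (\<bar>b - b'\<bar> + \<bar>h\<^sup>2 - h'\<^sup>2\<bar>)"
    using cosh_moment_lipschitz[OF assms, of b\<^sub>0 H L 0] by blast
  obtain B where B: "0 < B" "\<And>b h. b \<in> {b\<^sub>1..b\<^sub>0} \<Longrightarrow> \<bar>h\<bar> \<le> H \<Longrightarrow> cosh_moment L 2 b h \<le> B"
    using cosh_moment_bounded[OF assms, of b\<^sub>0 H L 2] by blast
  define l where "l = moment (1 + \<bar>L - 1\<bar>) 0 b\<^sub>0 0"
  have l: "0 < l" using assms True by (simp add: l_def moment_pos)
  have l_le: "l \<le> cosh_moment L 0 b h" if "b \<in> {b\<^sub>1..b\<^sub>0}" for b h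
    unfolding l_def using that assms
    by (intro order_trans[OF moment_0_ge[of b b\<^sub>0 0 L] cosh_moment_ge]) auto
  show ?thesis
  proof (intro exI[of _ "C\<^sub>2 / l + B * C\<^sub>0 / l\<^sup>2"] conjI ballI allI impI)
    show "0 < C\<^sub>2 / l + B * C\<^sub>0 / l\<^sup>2" using C2(1) C0(1) B(1) l by (simp add: add_pos_pos)
    fix b b' h h' assume *: "b \<in> {b\<^sub>1..b\<^sub>0}" "b' \<in> {b\<^sub>1..b\<^sub>0}" "\<bar>h\<bar> \<le> H" "\<bar>h'\<bar> \<le> H"
    define D where "D = \<bar>b - b'\<bar> + \<bar>h\<^sup>2 - h'\<^sup>2\<bar>"
    have bb: "0 < b" "0 < b'" using * assms by auto
    have "\<bar>cosh_moment L 2 b h / cosh_moment L 0 b h - cosh_moment L 2 b' h' / cosh_moment L 0 b' h'\<bar>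
        \<le> C\<^sub>2 * D / l + B * (C\<^sub>0 * D) / l\<^sup>2"
      unfolding D_def
      using * assms by (intro abs_divide_diff_le C2 C0 B l l_le) (auto intro!: order_less_imp_le[OF cosh_moment_pos])
    also have "\<dots> = (C\<^sub>2 / l + B * C\<^sub>0 / l\<^sup>2) * D"
      by (simp add: distrib_right mult.assoc)
    finally show "\<bar>moment L 2 b h / moment L 0 b h - moment L 2 b' h' / moment L 0 b' h'\<bar>
        \<le> (C\<^sub>2 / l + B * C\<^sub>0 / l\<^sup>2) * (\<bar>b - b'\<bar> + \<bar>h\<^sup>2 - h'\<^sup>2\<bar>)"
      unfolding D_def using bb by (simp add: moment_even)
  qed
qed (auto intro: exI[of _ 1])


section \<open>The branches of self-consistent states\<close>

lemma self_consistent_unique: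
  assumes "0 < L" "0 < s" "self_consistent L s h" "self_consistent L s h'" "0 < h" "0 < h'"
  shows "h = h'"
proof -
  have le: "h \<le> h'" if *: "h' \<le> h" "self_consistent L s h" "self_consistent L s h'" "0 < h" "0 < h'" for h h'
  proof -
    obtain c where c: "0 < c" "c * (h\<^sup>2 - h'\<^sup>2) \<le> cubic_ratio L (1 / s) h - cubic_ratio L (1 / s) h'"
      using cubic_ratio_strict_mono_quantitative[of "1 / s" "1 / s" h L] assms(2) * by force
    have "cubic_ratio L (1 / s) h = 1" "cubic_ratio L (1 / s) h' = 1"
      using self_consistent_iff_cubic_ratio[OF assms(1,2)] * by auto
    then have "c * (h\<^sup>2 - h'\<^sup>2) \<le> 0" using c(2) by linarith
    then have "h\<^sup>2 \<le> h'\<^sup>2" using c(1) by (simp add: mult_le_0_iff)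
    then show ?thesis by (rule power2_le_imp_le) (use * in simp)
  qed
  show ?thesis
    using le[of h h'] le[of h' h] assms by (cases "h' \<le> h") auto
qed

lemma abs_inverse_diff_le:
  fixes s s' :: real
  assumes "0 < a" "a \<le> s" "a \<le> s'"
  shows "\<bar>1 / s - 1 / s'\<bar> \<le> \<bar>s - s'\<bar> / a\<^sup>2"
proof -
  have pos: "0 < s" "0 < s'" using assms by auto
  have "1 / s - 1 / s' = (s' - s) / (s * s')" using pos by (simp add: diff_divide_distrib)
  then have "\<bar>1 / s - 1 / s'\<bar> = \<bar>s - s'\<bar> / (s * s')"
    using pos by (simp add: abs_mult abs_minus_commute)
  also have "\<dots> \<le> \<bar>s - s'\<bar> / (a * a)"
    using assms pos by (intro divide_left_mono mult_mono mult_pos_pos) auto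
  finally show ?thesis by (simp only: power2_eq_square)
qed

lemma inverse_mem_interval:
  fixes s :: real
  assumes "0 < a" "s \<in> {a..c}" shows "1 / s \<in> {1 / c..1 / a}"
  using assms by (auto intro: divide_left_mono)

text \<open>If the ratio were not \<open>1\<close> at \<open>h = 0\<close>, then at \<open>\<sigma>\<^sub>c\<close> it would avoid \<open>1\<close> on the whole compact
  interval of admissible tilts, with a margin. This would persist for \<open>s\<close> slightly below \<open>\<sigma>\<^sub>c\<close>,
  where a solution exists.\<close>

lemma critical_cubic_ratio:
  assumes L: "0 < L" and \<sigma>: "0 < \<sigma>\<^sub>c"
    and none: "\<And>h. 0 < h \<Longrightarrow> \<not> self_consistent L \<sigma>\<^sub>c h"
    and ex: "\<And>s. 0 < s \<Longrightarrow> s < \<sigma>\<^sub>c \<Longrightarrow> \<exists>h>0. self_consistent L s h"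
  shows "cubic_ratio L (1 / \<sigma>\<^sub>c) 0 = 1"
proof (rule ccontr)
  assume ne: "cubic_ratio L (1 / \<sigma>\<^sub>c) 0 \<noteq> 1"
  define a where "a = \<sigma>\<^sub>c / 2"
  have a: "0 < a" "a < \<sigma>\<^sub>c" using \<sigma> by (auto simp: a_def)
  define H where "H = L * (1 / a + 1)"
  have H: "0 \<le> H" using L a by (auto simp: H_def)
  have ne': "cubic_ratio L (1 / \<sigma>\<^sub>c) h \<noteq> 1" if "h \<in> {0..H}" for h
    using that ne none[of h] self_consistent_iff_cubic_ratio[OF L \<sigma>, of h] by (cases "h = 0") auto
  have "continuous_on {0..H} (\<lambda>h. \<bar>cubic_ratio L (1 / \<sigma>\<^sub>c) h - 1\<bar>)"
    using \<sigma> by (intro continuous_intros cubic_ratio_continuous_on) auto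
  then obtain h\<^sub>0 where h0: "h\<^sub>0 \<in> {0..H}"
    "\<And>h. h \<in> {0..H} \<Longrightarrow> \<bar>cubic_ratio L (1 / \<sigma>\<^sub>c) h\<^sub>0 - 1\<bar> \<le> \<bar>cubic_ratio L (1 / \<sigma>\<^sub>c) h - 1\<bar>"
    using continuous_attains_inf[of "{0..H}"] H by (metis atLeastAtMost_iff compact_Icc empty_iff order_refl)
  define \<eta> where "\<eta> = \<bar>cubic_ratio L (1 / \<sigma>\<^sub>c) h\<^sub>0 - 1\<bar>"
  have \<eta>: "0 < \<eta>" using ne'[OF h0(1)] by (simp add: \<eta>_def)
  have "0 < 1 / \<sigma>\<^sub>c" using \<sigma> by simp
  then obtain C where C: "0 < C" "\<And>b b' h. b \<in> {1 / \<sigma>\<^sub>c..1 / a} \<Longrightarrow> b' \<in> {1 / \<sigma>\<^sub>c..1 / a} \<Longrightarrow> \<bar>h\<bar> \<le> H \<Longrightarrow>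
      \<bar>cubic_ratio L b h - cubic_ratio L b' h\<bar> \<le> C * \<bar>b - b'\<bar>"
    using cubic_ratio_lipschitz[of "1 / \<sigma>\<^sub>c" "1 / a" H L] by blast
  \<comment> \<open>A distance below \<open>\<sigma>\<^sub>c\<close> over which the ratio changes by at most \<open>\<eta> / 2\<close>.\<close>
  define t where "t = min a (\<eta> * a\<^sup>2 / (2 * C))"
  have t: "0 < t" "t \<le> a" "t \<le> \<eta> * a\<^sup>2 / (2 * C)" using a \<eta> C(1) by (auto simp: t_def)
  define s where "s = \<sigma>\<^sub>c - t"
  have s: "a \<le> s" "s < \<sigma>\<^sub>c" "0 < s" using t a by (auto simp: s_def a_def)
  obtain h where h: "0 < h" "self_consistent L s h" using ex[OF s(3,2)] by blast
  have hH: "h \<le> H"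
  proof -
    have "h \<le> L * (1 / s + 1)" using self_consistent_bound[OF L s(3) h(2)] .
    also have "\<dots> \<le> H" unfolding H_def using L s a by (intro mult_left_mono add_right_mono divide_left_mono) auto
    finally show ?thesis .
  qed
  have one: "cubic_ratio L (1 / s) h = 1"
    using self_consistent_iff_cubic_ratio[OF L s(3)] h by auto
  have "\<eta> \<le> \<bar>cubic_ratio L (1 / \<sigma>\<^sub>c) h - cubic_ratio L (1 / s) h\<bar>"
    unfolding one \<eta>_def using h0(2)[of h] h hH by simp
  also have "\<dots> \<le> C * \<bar>1 / \<sigma>\<^sub>c - 1 / s\<bar>"
    using h hH s a by (intro C inverse_mem_interval) auto
  also have "\<dots> \<le> C * (\<bar>\<sigma>\<^sub>c - s\<bar> / a\<^sup>2)"
    using C(1) a s by (intro mult_left_mono abs_inverse_diff_le) auto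
  also have "\<dots> = C * (t / a\<^sup>2)" using t by (simp add: s_def)
  also have "\<dots> \<le> C * (\<eta> * a\<^sup>2 / (2 * C) / a\<^sup>2)"
    using C(1) t by (intro mult_left_mono divide_right_mono) auto
  also have "\<dots> = \<eta> / 2" using C(1) a by simp
  finally show False using \<eta> by simp
qed

text \<open>If the ratio is \<open>1\<close> at both \<open>(s, h)\<close> and \<open>(s', h')\<close>, then its increase from \<open>h'\<close> to \<open>h\<close> at fixed
  \<open>s\<close> equals its change from \<open>s\<close> to \<open>s'\<close> at fixed \<open>h'\<close>. The former dominates
  \<open>\<bar>h\<^sup>2 - h'\<^sup>2\<bar>\<close> and the latter is Lipschitz. On the branch the mean is \<open>s * h / L\<close>, so the variance
  is a Lipschitz function of \<open>s\<close> and \<open>h\<^sup>2\<close>.\<close>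

lemma branch_variance_lipschitz:
  assumes L: "0 < L" and a: "0 < a" and H: "0 \<le> H"
  shows "\<exists>C>0. \<forall>s\<in>{a..c}. \<forall>s'\<in>{a..c}. \<forall>h\<in>{0..H}. \<forall>h'\<in>{0..H}.
    cubic_ratio L (1 / s) h = 1 \<longrightarrow> cubic_ratio L (1 / s') h' = 1 \<longrightarrow>
    \<bar>gibbs_variance L s h - gibbs_variance L s' h'\<bar> \<le> C * \<bar>s - s'\<bar>"
proof (cases "a \<le> c")
  case True
  then have c: "0 < c" "0 < 1 / c" using a by auto
  obtain k where k: "0 < k" "\<And>b h h'. b \<in> {1 / c..1 / a} \<Longrightarrow> 0 \<le> h' \<Longrightarrow> h' \<le> h \<Longrightarrow> h \<le> H \<Longrightarrow>
      k * (h\<^sup>2 - h'\<^sup>2) \<le> cubic_ratio L b h - cubic_ratio L b h'"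
    using cubic_ratio_strict_mono_quantitative[OF c(2), of "1 / a" H L] by blast
  obtain C\<^sub>1 where C1: "0 < C\<^sub>1" "\<And>b b' h. b \<in> {1 / c..1 / a} \<Longrightarrow> b' \<in> {1 / c..1 / a} \<Longrightarrow> \<bar>h\<bar> \<le> H \<Longrightarrow>
      \<bar>cubic_ratio L b h - cubic_ratio L b' h\<bar> \<le> C\<^sub>1 * \<bar>b - b'\<bar>"
    using cubic_ratio_lipschitz[OF c(2), of "1 / a" H L] by blast
  obtain C\<^sub>2 where C2: "0 < C\<^sub>2" "\<And>b b' h h'. b \<in> {1 / c..1 / a} \<Longrightarrow> b' \<in> {1 / c..1 / a} \<Longrightarrow> \<bar>h\<bar> \<le> H \<Longrightarrow> \<bar>h'\<bar> \<le> H \<Longrightarrow>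
      \<bar>moment L 2 b h / moment L 0 b h - moment L 2 b' h' / moment L 0 b' h'\<bar>
        \<le> C\<^sub>2 * (\<bar>b - b'\<bar> + \<bar>h\<^sup>2 - h'\<^sup>2\<bar>)"
    using second_moment_lipschitz[OF c(2), of "1 / a" H L] by blast
  define D where "D = C\<^sub>1 / k"
  have D: "0 < D" using C1(1) k(1) by (simp add: D_def)
  define C where "C = C\<^sub>2 * (1 + D) / a\<^sup>2 + (c\<^sup>2 * (D / a\<^sup>2) + H\<^sup>2 * (2 * c)) / L\<^sup>2"
  show ?thesis
  proof (intro exI[of _ C] conjI ballI impI)
    have "0 < C\<^sub>2 * (1 + D) / a\<^sup>2" "0 \<le> (c\<^sup>2 * (D / a\<^sup>2) + H\<^sup>2 * (2 * c)) / L\<^sup>2"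
      using C2(1) D a c by auto
    then show "0 < C" unfolding C_def by linarith
    fix s s' h h'
    assume s: "s \<in> {a..c}" "s' \<in> {a..c}" and h: "h \<in> {0..H}" "h' \<in> {0..H}"
      and one: "cubic_ratio L (1 / s) h = 1" "cubic_ratio L (1 / s') h' = 1"
    define d where "d = \<bar>s - s'\<bar>"
    have d: "0 \<le> d" by (simp add: d_def)
    have pos: "0 < s" "0 < s'" using s a by auto
    have b: "1 / s \<in> {1 / c..1 / a}" "1 / s' \<in> {1 / c..1 / a}"
      using inverse_mem_interval[OF a] s by auto
    have db: "\<bar>1 / s - 1 / s'\<bar> \<le> d / a\<^sup>2"
      unfolding d_def using s by (intro abs_inverse_diff_le a) auto
    have dh: "\<bar>h\<^sup>2 - h'\<^sup>2\<bar> \<le> D * \<bar>1 / s - 1 / s'\<bar>"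
    proof -
      have "k * \<bar>h\<^sup>2 - h'\<^sup>2\<bar> \<le> \<bar>cubic_ratio L (1 / s) h - cubic_ratio L (1 / s) h'\<bar>"
      proof (cases "h' \<le> h")
        case True
        then have "h'\<^sup>2 \<le> h\<^sup>2" using h by (simp add: power_mono)
        then show ?thesis using k(2)[OF b(1), of h' h] h True by simp
      next
        case False
        then have "h\<^sup>2 \<le> h'\<^sup>2" using h by (simp add: power_mono)
        then show ?thesis using k(2)[OF b(1), of h h'] h False by simp
      qed
      also have "\<dots> = \<bar>cubic_ratio L (1 / s) h' - cubic_ratio L (1 / s') h'\<bar>"
        unfolding one by (rule abs_minus_commute)
      also have "\<dots> \<le> C\<^sub>1 * \<bar>1 / s - 1 / s'\<bar>" using h by (intro C1 b) auto
      finally show ?thesis using k(1) by (simp add: D_def field_simps)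
    qed
    have dh': "\<bar>h\<^sup>2 - h'\<^sup>2\<bar> \<le> D * (d / a\<^sup>2)"
      using dh mult_left_mono[OF db, of D] D by linarith
    have sc: "self_consistent L s h" "self_consistent L s' h'"
      using one self_consistent_iff_cubic_ratio[OF L] pos by (metis self_consistent_0)+
    have var: "gibbs_variance L s h = moment L 2 (1 / s) h / moment L 0 (1 / s) h - (s * h / L)\<^sup>2"
      "gibbs_variance L s' h' = moment L 2 (1 / s') h' / moment L 0 (1 / s') h' - (s' * h' / L)\<^sup>2"
      using sc by (simp_all add: gibbs_variance_def self_consistent_def)
    have "\<bar>moment L 2 (1 / s) h / moment L 0 (1 / s) h - moment L 2 (1 / s') h' / moment L 0 (1 / s') h'\<bar>
        \<le> C\<^sub>2 * (\<bar>1 / s - 1 / s'\<bar> + \<bar>h\<^sup>2 - h'\<^sup>2\<bar>)"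
      using h by (intro C2 b) auto
    also have "\<dots> \<le> C\<^sub>2 * (d / a\<^sup>2 + D * (d / a\<^sup>2))"
      using C2(1) db dh' by (intro mult_left_mono add_mono) auto
    also have "\<dots> = C\<^sub>2 * (1 + D) / a\<^sup>2 * d" by (simp add: add_divide_distrib algebra_simps)
    finally have 1: "\<bar>moment L 2 (1 / s) h / moment L 0 (1 / s) h - moment L 2 (1 / s') h' / moment L 0 (1 / s') h'\<bar>
        \<le> C\<^sub>2 * (1 + D) / a\<^sup>2 * d" .
    have "\<bar>s\<^sup>2 * h\<^sup>2 - s'\<^sup>2 * h'\<^sup>2\<bar> = \<bar>s\<^sup>2 * (h\<^sup>2 - h'\<^sup>2) + h'\<^sup>2 * (s\<^sup>2 - s'\<^sup>2)\<bar>"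
      by (simp add: algebra_simps)
    also have "\<dots> \<le> \<bar>s\<^sup>2 * (h\<^sup>2 - h'\<^sup>2)\<bar> + \<bar>h'\<^sup>2 * (s\<^sup>2 - s'\<^sup>2)\<bar>" by (rule abs_triangle_ineq)
    also have "\<dots> = s\<^sup>2 * \<bar>h\<^sup>2 - h'\<^sup>2\<bar> + h'\<^sup>2 * \<bar>s\<^sup>2 - s'\<^sup>2\<bar>" by (simp add: abs_mult)
    also have "\<dots> \<le> c\<^sup>2 * (D * (d / a\<^sup>2)) + H\<^sup>2 * (2 * c * d)"
    proof (intro add_mono mult_mono dh')
      show "s\<^sup>2 \<le> c\<^sup>2" "h'\<^sup>2 \<le> H\<^sup>2" using s h pos by (simp_all add: power_mono)
      have "s\<^sup>2 - s'\<^sup>2 = (s + s') * (s - s')" by (simp add: power2_eq_square algebra_simps)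
      then have "\<bar>s\<^sup>2 - s'\<^sup>2\<bar> = (s + s') * d" using pos by (simp add: abs_mult d_def)
      also have "\<dots> \<le> 2 * c * d" using s d by (intro mult_right_mono) auto
      finally show "\<bar>s\<^sup>2 - s'\<^sup>2\<bar> \<le> 2 * c * d" .
    qed auto
    finally have "\<bar>s\<^sup>2 * h\<^sup>2 - s'\<^sup>2 * h'\<^sup>2\<bar> / L\<^sup>2 \<le> (c\<^sup>2 * (D * (d / a\<^sup>2)) + H\<^sup>2 * (2 * c * d)) / L\<^sup>2"
      by (rule divide_right_mono) simp
    moreover have "(s * h / L)\<^sup>2 - (s' * h' / L)\<^sup>2 = (s\<^sup>2 * h\<^sup>2 - s'\<^sup>2 * h'\<^sup>2) / L\<^sup>2"
      by (simp add: power_mult_distrib power_divide diff_divide_distrib)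
    ultimately have 2: "\<bar>(s * h / L)\<^sup>2 - (s' * h' / L)\<^sup>2\<bar> \<le> (c\<^sup>2 * (D / a\<^sup>2) + H\<^sup>2 * (2 * c)) / L\<^sup>2 * d"
      by (simp add: abs_divide algebra_simps)
    have "C * \<bar>s - s'\<bar> = C\<^sub>2 * (1 + D) / a\<^sup>2 * d + (c\<^sup>2 * (D / a\<^sup>2) + H\<^sup>2 * (2 * c)) / L\<^sup>2 * d"
      unfolding C_def d_def by (rule distrib_right)
    then show "\<bar>gibbs_variance L s h - gibbs_variance L s' h'\<bar> \<le> C * \<bar>s - s'\<bar>"
      unfolding var using 1 2 by linarith
  qed
qed (auto intro: exI[of _ 1])

lemma continuous_on_of_lipschitz:
  fixes f :: "real \<Rightarrow> real"
  assumes "0 < C" "\<And>x y. x \<in> S \<Longrightarrow> y \<in> S \<Longrightarrow> \<bar>f x - f y\<bar> \<le> C * \<bar>x - y\<bar>"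
  shows "continuous_on S f"
proof -
  have "C-lipschitz_on S f"
    using assms by (intro lipschitz_onI) (auto simp: dist_real_def)
  then show ?thesis by (rule lipschitz_on_continuous_on)
qed

lemma symmetric_variance_continuous_on:
  assumes a: "0 < a"
  shows "continuous_on {a..c} (\<lambda>s. gibbs_variance L s 0)"
proof (cases "a \<le> c")
  case True
  then have c: "0 < 1 / c" using a by auto
  obtain C where C: "0 < C" "\<And>b b' h h'. b \<in> {1 / c..1 / a} \<Longrightarrow> b' \<in> {1 / c..1 / a} \<Longrightarrow> \<bar>h\<bar> \<le> 0 \<Longrightarrow> \<bar>h'\<bar> \<le> 0 \<Longrightarrow>
      \<bar>moment L 2 b h / moment L 0 b h - moment L 2 b' h' / moment L 0 b' h'\<bar>
        \<le> C * (\<bar>b - b'\<bar> + \<bar>h\<^sup>2 - h'\<^sup>2\<bar>)"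
    using second_moment_lipschitz[OF c, of "1 / a" 0 L] by blast
  show ?thesis
  proof (rule continuous_on_of_lipschitz[of "C / a\<^sup>2"])
    show "0 < C / a\<^sup>2" using C(1) a by simp
    fix s s' assume s: "s \<in> {a..c}" "s' \<in> {a..c}"
    have "\<bar>gibbs_variance L s 0 - gibbs_variance L s' 0\<bar> \<le> C * \<bar>1 / s - 1 / s'\<bar>"
      using C(2)[of "1 / s" "1 / s'" 0 0] inverse_mem_interval[OF a] s a by (simp add: gibbs_variance_def)
    also have "\<dots> \<le> C * (\<bar>s - s'\<bar> / a\<^sup>2)"
      using C(1) s a by (intro mult_left_mono abs_inverse_diff_le) auto
    finally show "\<bar>gibbs_variance L s 0 - gibbs_variance L s' 0\<bar> \<le> C / a\<^sup>2 * \<bar>s - s'\<bar>" by simp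
  qed
qed simp

text \<open>Because \<open>V / s\<close> does not increase, a one-sided Lipschitz bound and linear growth hold on all of
  \<open>[a, \<infinity>)\<close>, with the single constant \<open>V / s\<close> at \<open>s = a\<close>. Upper bounds suffice to make
  \<open>s - \<epsilon> * V\<close> increase.\<close>

lemma symmetric_variance_growth:
  assumes "0 < a" "a \<le> s" "s \<le> t"
  shows "gibbs_variance L t 0 - gibbs_variance L s 0 \<le> (t - s) * (gibbs_variance L a 0 / a)"
    and "gibbs_variance L t 0 \<le> t * (gibbs_variance L a 0 / a)"
proof -
  have mono: "gibbs_variance L y 0 / y \<le> gibbs_variance L x 0 / x" if "0 < x" "x \<le> y" for x y
    using variance_over_temperature_mono[of "1 / y" "1 / x" L] that
    by (simp add: gibbs_variance_def mult.commute frac_le)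
  have pos: "0 < s" "0 < t" using assms by auto
  have "gibbs_variance L t 0 = t * (gibbs_variance L t 0 / t)" using pos by simp
  also have "\<dots> \<le> t * (gibbs_variance L s 0 / s)" using pos assms by (intro mult_left_mono mono) auto
  finally have "gibbs_variance L t 0 \<le> t * (gibbs_variance L s 0 / s)" .
  moreover have "gibbs_variance L s 0 = s * (gibbs_variance L s 0 / s)" using pos by simp
  ultimately have "gibbs_variance L t 0 - gibbs_variance L s 0 \<le> (t - s) * (gibbs_variance L s 0 / s)"
    unfolding left_diff_distrib by linarith
  also have "\<dots> \<le> (t - s) * (gibbs_variance L a 0 / a)"
    using assms by (intro mult_left_mono mono) auto
  finally show "gibbs_variance L t 0 - gibbs_variance L s 0 \<le> (t - s) * (gibbs_variance L a 0 / a)" .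
  have "gibbs_variance L t 0 = t * (gibbs_variance L t 0 / t)" using pos by simp
  also have "\<dots> \<le> t * (gibbs_variance L a 0 / a)" using pos assms by (intro mult_left_mono mono) auto
  finally show "gibbs_variance L t 0 \<le> t * (gibbs_variance L a 0 / a)" .
qed


section \<open>Phase transition for the effective parameters\<close>

text \<open>The pair \<open>(s, h)\<close> describes a stationary distribution of the effective dynamics with diffusion
  coefficient \<open>\<sigma>\<close>: a self-consistent state at temperature \<open>s\<close>, where \<open>s\<close> is produced by its own
  variance.\<close>

definition effective_state :: "real \<Rightarrow> real \<Rightarrow> real \<Rightarrow> real \<Rightarrow> real \<Rightarrow> bool" where
  "effective_state L \<epsilon> \<sigma> s h \<longleftrightarrow>
    0 < s \<and> self_consistent L s h \<and> s = \<sigma> + \<epsilon> * gibbs_variance L s h"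

lemma effective_stateI:
  "0 < s \<Longrightarrow> self_consistent L s h \<Longrightarrow> s = \<sigma> + \<epsilon> * gibbs_variance L s h \<Longrightarrow> effective_state L \<epsilon> \<sigma> s h"
  unfolding effective_state_def by (intro conjI)

lemma effective_stateD:
  assumes "effective_state L \<epsilon> \<sigma> s h"
  shows "0 < s" "self_consistent L s h" "s = \<sigma> + \<epsilon> * gibbs_variance L s h"
proof -
  note st = assms[unfolded effective_state_def]
  show "0 < s" by (rule conjunct1[OF st])
  show "self_consistent L s h" by (rule conjunct1[OF conjunct2[OF st]])
  show "s = \<sigma> + \<epsilon> * gibbs_variance L s h" by (rule conjunct2[OF conjunct2[OF st]])
qed

lemma effective_state_minus: "effective_state L \<epsilon> \<sigma> s (- h) \<longleftrightarrow> effective_state L \<epsilon> \<sigma> s h"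
  by (simp add: effective_state_def self_consistent_minus gibbs_variance_minus)

lemma effective_state_ge: "0 \<le> \<epsilon> \<Longrightarrow> effective_state L \<epsilon> \<sigma> s h \<Longrightarrow> \<sigma> \<le> s"
  by (metis effective_state_def gibbs_variance_nonneg le_add_same_cancel1 mult_nonneg_nonneg)

text \<open>Along the symmetric branch \<open>k s = s - \<epsilon> * V\<close> and along the positive branch
  \<open>g s = s - \<epsilon> * V\<close> are continuous and strictly increasing, and they agree at \<open>\<sigma>\<^sub>c\<close>. States for
  \<open>\<sigma>\<close> are the points where these functions take the value \<open>\<sigma>\<close>, so the intermediate value theorem
  and injectivity count them.\<close>

lemma effective_phase_transition:
  assumes L: "0 < L" and \<sigma>: "0 < \<sigma>\<^sub>0" "\<sigma>\<^sub>0 < \<sigma>\<^sub>c"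
    and none: "\<And>s h. \<sigma>\<^sub>c \<le> s \<Longrightarrow> 0 < h \<Longrightarrow> \<not> self_consistent L s h"
    and ex: "\<And>s. 0 < s \<Longrightarrow> s < \<sigma>\<^sub>c \<Longrightarrow> \<exists>h>0. self_consistent L s h"
  shows "\<exists>\<epsilon>\<^sub>0>0. \<forall>\<epsilon>. 0 < \<epsilon> \<and> \<epsilon> \<le> \<epsilon>\<^sub>0 \<longrightarrow>
    \<sigma>\<^sub>0 \<le> \<sigma>\<^sub>c - \<epsilon> * (\<sigma>\<^sub>c / L) \<and>
    (\<forall>\<sigma>\<ge>\<sigma>\<^sub>0. \<exists>!s. effective_state L \<epsilon> \<sigma> s 0) \<and>
    (\<forall>\<sigma>\<ge>\<sigma>\<^sub>c - \<epsilon> * (\<sigma>\<^sub>c / L). \<forall>s h. 0 < h \<longrightarrow> \<not> effective_state L \<epsilon> \<sigma> s h) \<and>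
    (\<forall>\<sigma>\<in>{\<sigma>\<^sub>0..<\<sigma>\<^sub>c - \<epsilon> * (\<sigma>\<^sub>c / L)}. \<exists>s h. 0 < h \<and> effective_state L \<epsilon> \<sigma> s h \<and>
      (\<forall>s' h'. 0 < h' \<and> effective_state L \<epsilon> \<sigma> s' h' \<longrightarrow> s' = s \<and> h' = h))"
proof -
  have \<sigma>c: "0 < \<sigma>\<^sub>c" using \<sigma> by simp
  define H where "H = L * (1 / \<sigma>\<^sub>0 + 1)"
  have H: "0 \<le> H" using L \<sigma> by (auto simp: H_def)
  have crit: "cubic_ratio L (1 / \<sigma>\<^sub>c) 0 = 1"
    using none[OF order_refl] ex by (intro critical_cubic_ratio L \<sigma>c)
  define Q where "Q = gibbs_variance L \<sigma>\<^sub>0 0 / \<sigma>\<^sub>0"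
  have Q: "0 \<le> Q" using \<sigma> gibbs_variance_nonneg[of \<sigma>\<^sub>0 L 0] by (simp add: Q_def)
  obtain C where C: "0 < C" "\<And>s s' h h'. s \<in> {\<sigma>\<^sub>0..\<sigma>\<^sub>c} \<Longrightarrow> s' \<in> {\<sigma>\<^sub>0..\<sigma>\<^sub>c} \<Longrightarrow> h \<in> {0..H} \<Longrightarrow> h' \<in> {0..H} \<Longrightarrow>
      cubic_ratio L (1 / s) h = 1 \<Longrightarrow> cubic_ratio L (1 / s') h' = 1 \<Longrightarrow>
      \<bar>gibbs_variance L s h - gibbs_variance L s' h'\<bar> \<le> C * \<bar>s - s'\<bar>"
    using branch_variance_lipschitz[OF L \<sigma>(1) H, of \<sigma>\<^sub>c] by blast
  define branch where "branch s = (if s < \<sigma>\<^sub>c then SOME h. 0 < h \<and> self_consistent L s h else 0)" for s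
  have branch: "0 < branch s" "self_consistent L s (branch s)" if "0 < s" "s < \<sigma>\<^sub>c" for s
    using someI_ex[OF ex[OF that]] that by (simp_all add: branch_def)
  have branch_c: "branch \<sigma>\<^sub>c = 0" by (simp add: branch_def)
  have branch_ratio: "branch s \<in> {0..H}" "cubic_ratio L (1 / s) (branch s) = 1" if s: "s \<in> {\<sigma>\<^sub>0..\<sigma>\<^sub>c}" for s
  proof -
    have "branch s \<in> {0..H} \<and> cubic_ratio L (1 / s) (branch s) = 1"
    proof (cases "s = \<sigma>\<^sub>c")
      case True
      then show ?thesis using crit H by (simp add: branch_c)
    next
      case False
      then have s': "0 < s" "s < \<sigma>\<^sub>c" using s \<sigma> by auto
      have "branch s \<le> L * (1 / s + 1)"
        by (rule self_consistent_bound[OF L s'(1) branch(2)[OF s']])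
      also have "\<dots> \<le> H"
        unfolding H_def using L s \<sigma> by (intro mult_left_mono add_right_mono divide_left_mono) auto
      finally have "branch s \<le> H" .
      moreover have "cubic_ratio L (1 / s) (branch s) = 1"
        using self_consistent_iff_cubic_ratio[OF L s'(1), of "branch s"] branch[OF s'] by auto
      ultimately show ?thesis using branch(1)[OF s'] by simp
    qed
    then show "branch s \<in> {0..H}" "cubic_ratio L (1 / s) (branch s) = 1" by auto
  qed
  \<comment> \<open>The first bound keeps the slopes of \<open>s - \<epsilon> * V\<close> at least \<open>1 / 2\<close>; the second keeps the critical value above \<open>\<sigma>\<^sub>0\<close>.\<close>
  define \<epsilon>\<^sub>0 where "\<epsilon>\<^sub>0 = min (1 / (2 * (C + Q))) ((\<sigma>\<^sub>c - \<sigma>\<^sub>0) * L / \<sigma>\<^sub>c)"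
  show ?thesis
  proof (intro exI[of _ \<epsilon>\<^sub>0] conjI allI impI)
    show "0 < \<epsilon>\<^sub>0" using C(1) Q \<sigma> \<sigma>c L by (simp add: \<epsilon>\<^sub>0_def)
    fix \<epsilon> assume \<epsilon>: "0 < \<epsilon> \<and> \<epsilon> \<le> \<epsilon>\<^sub>0"
    have "\<epsilon> * (C + Q) \<le> 1 / (2 * (C + Q)) * (C + Q)"
      using \<epsilon> C(1) Q by (intro mult_right_mono) (auto simp: \<epsilon>\<^sub>0_def)
    also have "\<dots> = 1 / 2" using add_pos_nonneg[OF C(1) Q] by simp
    finally have "\<epsilon> * C + \<epsilon> * Q \<le> 1 / 2" by (simp only: distrib_left)
    moreover have "0 \<le> \<epsilon> * C" "0 \<le> \<epsilon> * Q" using \<epsilon> C(1) Q by auto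
    ultimately have \<epsilon>C: "\<epsilon> * C \<le> 1 / 2" and \<epsilon>Q: "\<epsilon> * Q \<le> 1 / 2" by linarith+
    define \<sigma>\<^sub>e where "\<sigma>\<^sub>e = \<sigma>\<^sub>c - \<epsilon> * (\<sigma>\<^sub>c / L)"
    have "\<epsilon> * (\<sigma>\<^sub>c / L) \<le> (\<sigma>\<^sub>c - \<sigma>\<^sub>0) * L / \<sigma>\<^sub>c * (\<sigma>\<^sub>c / L)"
      using \<epsilon> \<sigma>c L by (intro mult_right_mono) (auto simp: \<epsilon>\<^sub>0_def)
    also have "\<dots> = \<sigma>\<^sub>c - \<sigma>\<^sub>0" using \<sigma>c L by simp
    finally show \<sigma>e: "\<sigma>\<^sub>0 \<le> \<sigma>\<^sub>c - \<epsilon> * (\<sigma>\<^sub>c / L)" by simp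
    define k where "k s = s - \<epsilon> * gibbs_variance L s 0" for s
    define g where "g s = s - \<epsilon> * gibbs_variance L s (branch s)" for s
    have k_mono: "k s < k t" if "\<sigma>\<^sub>0 \<le> s" "s < t" for s t
    proof -
      have "\<epsilon> * (gibbs_variance L t 0 - gibbs_variance L s 0) \<le> \<epsilon> * ((t - s) * Q)"
        unfolding Q_def using \<epsilon> that \<sigma> by (intro mult_left_mono symmetric_variance_growth) auto
      also have "\<dots> = (t - s) * (\<epsilon> * Q)" by simp
      also have "\<dots> \<le> (t - s) * (1 / 2)" using that \<epsilon>Q by (intro mult_left_mono) auto
      also have "\<dots> < t - s" using that by simp
      finally show ?thesis by (simp add: k_def right_diff_distrib)
    qed
    have k_inj: "s = t" if "k s = k t" "\<sigma>\<^sub>0 \<le> s" "\<sigma>\<^sub>0 \<le> t" for s t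
      using that k_mono[of s t] k_mono[of t s] by (cases s t rule: linorder_cases) auto
    have g_lip: "\<bar>gibbs_variance L s (branch s) - gibbs_variance L t (branch t)\<bar> \<le> C * \<bar>s - t\<bar>"
      if "s \<in> {\<sigma>\<^sub>0..\<sigma>\<^sub>c}" "t \<in> {\<sigma>\<^sub>0..\<sigma>\<^sub>c}" for s t
      using that branch_ratio by (intro C) auto
    have g_mono: "g s < g t" if "s \<in> {\<sigma>\<^sub>0..\<sigma>\<^sub>c}" "t \<in> {\<sigma>\<^sub>0..\<sigma>\<^sub>c}" "s < t" for s t
    proof -
      have "gibbs_variance L t (branch t) - gibbs_variance L s (branch s) \<le> C * (t - s)"
        using g_lip[OF that(2,1)] that(3) by simp
      then have "\<epsilon> * (gibbs_variance L t (branch t) - gibbs_variance L s (branch s)) \<le> \<epsilon> * (C * (t - s))"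
        using \<epsilon> by (intro mult_left_mono) auto
      also have "\<dots> = (t - s) * (\<epsilon> * C)" by simp
      also have "\<dots> \<le> (t - s) * (1 / 2)" using that \<epsilon>C by (intro mult_left_mono) auto
      also have "\<dots> < t - s" using that by simp
      finally show ?thesis by (simp add: g_def right_diff_distrib)
    qed
    have g_inj: "s = t" if "g s = g t" "s \<in> {\<sigma>\<^sub>0..\<sigma>\<^sub>c}" "t \<in> {\<sigma>\<^sub>0..\<sigma>\<^sub>c}" for s t
      using that g_mono[of s t] g_mono[of t s] by (cases s t rule: linorder_cases) auto
    have g_c: "g \<sigma>\<^sub>c = \<sigma>\<^sub>e"
      unfolding g_def branch_c \<sigma>\<^sub>e_def critical_variance[OF L \<sigma>c crit] ..
    have k_0: "k \<sigma>\<^sub>0 \<le> \<sigma>\<^sub>0" "g \<sigma>\<^sub>0 \<le> \<sigma>\<^sub>0"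
      using \<epsilon> \<sigma> gibbs_variance_nonneg[of \<sigma>\<^sub>0 L] by (simp_all add: k_def g_def)
    have state_sym: "effective_state L \<epsilon> \<sigma> s 0 \<longleftrightarrow> \<sigma>\<^sub>0 \<le> s \<and> k s = \<sigma>" if "\<sigma>\<^sub>0 \<le> \<sigma>" for \<sigma> s
    proof
      assume *: "effective_state L \<epsilon> \<sigma> s 0"
      have "\<sigma> \<le> s" using \<epsilon> by (intro effective_state_ge[OF _ *]) auto
      then have "\<sigma>\<^sub>0 \<le> s" using that by linarith
      moreover have "k s = \<sigma>" unfolding k_def using effective_stateD(3)[OF *] by linarith
      ultimately show "\<sigma>\<^sub>0 \<le> s \<and> k s = \<sigma>" ..
    next
      assume "\<sigma>\<^sub>0 \<le> s \<and> k s = \<sigma>"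
      then have *: "\<sigma>\<^sub>0 \<le> s" "k s = \<sigma>" by blast+
      have s: "0 < s" using \<sigma>(1) *(1) by linarith
      have "s = \<sigma> + \<epsilon> * gibbs_variance L s 0" using *(2) unfolding k_def by linarith
      then show "effective_state L \<epsilon> \<sigma> s 0" by (rule effective_stateI[OF s self_consistent_0[OF s]])
    qed
    have state_branch: "effective_state L \<epsilon> \<sigma> s h \<longleftrightarrow> s \<in> {\<sigma>\<^sub>0..<\<sigma>\<^sub>c} \<and> h = branch s \<and> g s = \<sigma>"
      if "\<sigma>\<^sub>0 \<le> \<sigma>" "0 < h" for \<sigma> s h
    proof
      assume *: "effective_state L \<epsilon> \<sigma> s h"
      have "\<sigma> \<le> s" using \<epsilon> by (intro effective_state_ge[OF _ *]) auto
      then have s: "\<sigma>\<^sub>0 \<le> s" using that by linarith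
      have s_c: "s < \<sigma>\<^sub>c"
      proof (rule ccontr)
        assume "\<not> s < \<sigma>\<^sub>c"
        then show False using none[of s h] effective_stateD(2)[OF *] that(2) by simp
      qed
      have h: "h = branch s"
        by (rule self_consistent_unique[OF L effective_stateD(1,2)[OF *] branch(2) that(2) branch(1)])
          (rule effective_stateD(1)[OF *] s_c)+
      have "g s = \<sigma>"
        unfolding g_def h[symmetric] using effective_stateD(3)[OF *] by linarith
      then show "s \<in> {\<sigma>\<^sub>0..<\<sigma>\<^sub>c} \<and> h = branch s \<and> g s = \<sigma>"
        using s s_c h by simp
    next
      assume *: "s \<in> {\<sigma>\<^sub>0..<\<sigma>\<^sub>c} \<and> h = branch s \<and> g s = \<sigma>"
      then have s: "0 < s" "s < \<sigma>\<^sub>c" and h: "h = branch s" and g: "g s = \<sigma>" using \<sigma> by auto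
      have "s = \<sigma> + \<epsilon> * gibbs_variance L s (branch s)" using g unfolding g_def by linarith
      then show "effective_state L \<epsilon> \<sigma> s h"
        unfolding h by (rule effective_stateI[OF s(1) branch(2)[OF s]])
    qed
    fix \<sigma>
    show "\<exists>!s. effective_state L \<epsilon> \<sigma> s 0" if \<sigma>0: "\<sigma>\<^sub>0 \<le> \<sigma>"
    proof -
      \<comment> \<open>At \<open>s = 2 * \<sigma>\<close> the correction is at most half of \<open>s\<close>, so \<open>k\<close> has reached \<open>\<sigma>\<close> there.\<close>
      have "gibbs_variance L (2 * \<sigma>) 0 \<le> (2 * \<sigma>) * Q"
        unfolding Q_def using \<sigma> \<sigma>0 by (intro symmetric_variance_growth(2)) auto
      then have "\<epsilon> * gibbs_variance L (2 * \<sigma>) 0 \<le> \<epsilon> * ((2 * \<sigma>) * Q)"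
        using \<epsilon> by (intro mult_left_mono) auto
      also have "\<dots> = (2 * \<sigma>) * (\<epsilon> * Q)" by simp
      also have "\<dots> \<le> (2 * \<sigma>) * (1 / 2)" using \<sigma> \<sigma>0 \<epsilon>Q by (intro mult_left_mono) auto
      finally have "\<sigma> \<le> k (2 * \<sigma>)" by (simp add: k_def)
      moreover have "continuous_on {\<sigma>\<^sub>0..2 * \<sigma>} k"
        unfolding k_def by (intro continuous_intros symmetric_variance_continuous_on \<sigma>)
      ultimately obtain s where "\<sigma>\<^sub>0 \<le> s" "k s = \<sigma>"
        using IVT'[of k \<sigma>\<^sub>0 \<sigma> "2 * \<sigma>"] k_0(1) \<sigma> \<sigma>0 by auto
      then show ?thesis
        unfolding state_sym[OF \<sigma>0] using k_inj by blast
    qed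
    show "\<not> effective_state L \<epsilon> \<sigma> s h" if "\<sigma>\<^sub>c - \<epsilon> * (\<sigma>\<^sub>c / L) \<le> \<sigma>" "0 < h" for s h
    proof
      assume *: "effective_state L \<epsilon> \<sigma> s h"
      have "\<sigma>\<^sub>0 \<le> \<sigma>" using that(1) \<sigma>e by linarith
      from state_branch[OF this that(2), THEN iffD1, OF *]
      have s: "s \<in> {\<sigma>\<^sub>0..<\<sigma>\<^sub>c}" "g s = \<sigma>" by blast+
      have "g s < g \<sigma>\<^sub>c" using s(1) \<sigma> by (intro g_mono) simp_all
      then show False unfolding g_c s(2) \<sigma>\<^sub>e_def using that(1) by linarith
    qed
    show "\<forall>\<sigma>\<in>{\<sigma>\<^sub>0..<\<sigma>\<^sub>c - \<epsilon> * (\<sigma>\<^sub>c / L)}. \<exists>s h. 0 < h \<and> effective_state L \<epsilon> \<sigma> s h \<and>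
      (\<forall>s' h'. 0 < h' \<and> effective_state L \<epsilon> \<sigma> s' h' \<longrightarrow> s' = s \<and> h' = h)"
    proof
      fix \<sigma> assume \<sigma>_in: "\<sigma> \<in> {\<sigma>\<^sub>0..<\<sigma>\<^sub>c - \<epsilon> * (\<sigma>\<^sub>c / L)}"
      then have \<sigma>0: "\<sigma>\<^sub>0 \<le> \<sigma>" and \<sigma>_less: "\<sigma> < g \<sigma>\<^sub>c" by (simp_all add: g_c \<sigma>\<^sub>e_def)
      have "continuous_on {\<sigma>\<^sub>0..\<sigma>\<^sub>c} (\<lambda>s. gibbs_variance L s (branch s))"
        using C(1) g_lip by (rule continuous_on_of_lipschitz)
      then have "continuous_on {\<sigma>\<^sub>0..\<sigma>\<^sub>c} g"
        unfolding g_def by (intro continuous_intros)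
      then obtain s where s: "s \<in> {\<sigma>\<^sub>0..\<sigma>\<^sub>c}" "g s = \<sigma>"
        using IVT'[of g \<sigma>\<^sub>0 \<sigma> \<sigma>\<^sub>c] k_0(2) \<sigma> \<sigma>0 \<sigma>_less by auto
      have "s \<noteq> \<sigma>\<^sub>c" using s(2) \<sigma>_less by blast
      then have s': "s \<in> {\<sigma>\<^sub>0..<\<sigma>\<^sub>c}" using s by auto
      then have pos: "0 < branch s" using \<sigma> by (intro branch) auto
      have "s' = s \<and> h' = branch s" if "0 < h'" "effective_state L \<epsilon> \<sigma> s' h'" for s' h'
      proof -
        from state_branch[OF \<sigma>0 that(1), THEN iffD1, OF that(2)]
        have *: "s' \<in> {\<sigma>\<^sub>0..<\<sigma>\<^sub>c}" "h' = branch s'" "g s' = \<sigma>" by blast+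
        have "s' = s"
        proof (rule g_inj)
          show "g s' = g s" unfolding *(3) s(2) ..
          show "s' \<in> {\<sigma>\<^sub>0..\<sigma>\<^sub>c}" using *(1) by simp
        qed (rule s(1))
        then show ?thesis using *(2) by simp
      qed
      then show "\<exists>s h. 0 < h \<and> effective_state L \<epsilon> \<sigma> s h \<and>
          (\<forall>s' h'. 0 < h' \<and> effective_state L \<epsilon> \<sigma> s' h' \<longrightarrow> s' = s \<and> h' = h)"
        using pos state_branch[OF \<sigma>0 pos, THEN iffD2] s(2) s' by blast
    qed
  qed
qed


section \<open>Stationary distributions as Gibbs measures\<close>

definition tilted_measure :: "real \<Rightarrow> real \<Rightarrow> real \<Rightarrow> real measure" where
  "tilted_measure L s h =
    density lborel (\<lambda>x. ennreal (exp (h * x) * weight L (1 / s) x / moment L 0 (1 / s) h))"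

text \<open>Constants in the potential cancel in the normalisation, and the linear term becomes the tilt.\<close>

lemma gibbs_eq_tilted:
  assumes "0 < s" and V: "\<And>x. V x = double_well x + L / 2 * x\<^sup>2 - L * m * x + c"
  shows "gibbs (1 / s) V = tilted_measure L s (L * m / s)"
proof -
  define h where "h = L * m / s"
  have e: "exp (- (1 / s) * V x) = exp (- c / s) * (exp (h * x) * weight L (1 / s) x)" for x
    unfolding V weight_def exp_add[symmetric] h_def double_well_def
    using assms(1) by (simp add: field_simps)
  have "(LINT y|lborel. exp (- (1 / s) * V y)) = exp (- c / s) * moment L 0 (1 / s) h"
    unfolding e moment_def by simp
  then show ?thesis
    unfolding gibbs_def tilted_measure_def e h_def[symmetric] by simp
qed

lemma tilted_density_nonneg:
  "0 < s \<Longrightarrow> 0 \<le> exp (h * x) * weight L (1 / s) x / moment L 0 (1 / s) h"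
  using moment_pos[of "1 / s" 0 L h] by simp

lemma sets_tilted [simp]: "sets (tilted_measure L s h) = sets borel"
  by (simp add: tilted_measure_def)

lemma integral_tilted:
  fixes f :: "real \<Rightarrow> real"
  assumes "0 < s" "f \<in> borel_measurable borel"
  shows "(LINT x|tilted_measure L s h. f x)
    = (LINT x|lborel. f x * exp (h * x) * weight L (1 / s) x) / moment L 0 (1 / s) h"
proof -
  let ?d = "\<lambda>x. exp (h * x) * weight L (1 / s) x / moment L 0 (1 / s) h"
  have "(LINT x|tilted_measure L s h. f x) = (LINT x|lborel. ?d x *\<^sub>R f x)"
    unfolding tilted_measure_def
    using assms tilted_density_nonneg[OF assms(1)] by (intro integral_density) auto
  also have "\<dots> = (LINT x|lborel. f x * exp (h * x) * weight L (1 / s) x / moment L 0 (1 / s) h)"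
    by (simp add: mult_ac)
  finally show ?thesis by simp
qed

lemma integrable_tilted_power:
  assumes "0 < s"
  shows "integrable (tilted_measure L s h) (\<lambda>x. x ^ k)"
proof -
  let ?d = "\<lambda>x. exp (h * x) * weight L (1 / s) x / moment L 0 (1 / s) h"
  have "integrable lborel (\<lambda>x. x ^ k * exp (h * x) * weight L (1 / s) x / moment L 0 (1 / s) h)"
    using assms by (intro integrable_divide_zero integrable_moment) auto
  then have "integrable lborel (\<lambda>x. ?d x *\<^sub>R x ^ k)"
    by (simp add: mult_ac)
  then show ?thesis
    unfolding tilted_measure_def using tilted_density_nonneg[OF assms]
    by (subst integrable_density) auto
qed

lemma integral_tilted_power:
  assumes "0 < s"
  shows "(LINT x|tilted_measure L s h. x ^ k) = moment L k (1 / s) h / moment L 0 (1 / s) h"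
  using assms by (simp add: integral_tilted moment_def)

lemma prob_space_tilted:
  assumes "0 < s" shows "prob_space (tilted_measure L s h)"
proof
  have M0: "0 < moment L 0 (1 / s) h" using assms by (simp add: moment_pos)
  have int: "integrable lborel (\<lambda>x. exp (h * x) * weight L (1 / s) x / moment L 0 (1 / s) h)"
    using assms integrable_moment[of "1 / s" 0 h L] by (intro integrable_divide_zero) auto
  have "emeasure (tilted_measure L s h) (space (tilted_measure L s h))
      = (\<integral>\<^sup>+x. ennreal (exp (h * x) * weight L (1 / s) x / moment L 0 (1 / s) h) \<partial>lborel)"
    by (simp add: tilted_measure_def emeasure_density)
  also have "\<dots> = ennreal (LINT x|lborel. exp (h * x) * weight L (1 / s) x / moment L 0 (1 / s) h)"
    using int tilted_density_nonneg[OF assms] by (intro nn_integral_eq_integral) auto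
  also have "(LINT x|lborel. exp (h * x) * weight L (1 / s) x / moment L 0 (1 / s) h) = 1"
    using M0 by (simp add: moment_def)
  finally show "emeasure (tilted_measure L s h) (space (tilted_measure L s h)) = 1" by simp
qed

lemma mean_tilted: "0 < s \<Longrightarrow> mean (tilted_measure L s h) = gibbs_mean L s h"
  using integral_tilted_power[of s L h 1] by (simp add: mean_def gibbs_mean_def)

lemma second_cumulant_tilted:
  assumes "0 < s"
  shows "second_cumulant (tilted_measure L s h) = gibbs_variance L s h"
proof -
  interpret prob_space "tilted_measure L s h" using assms by (rule prob_space_tilted)
  define m where "m = gibbs_mean L s h"
  have "second_cumulant (tilted_measure L s h) = (LINT x|tilted_measure L s h. x\<^sup>2 - 2 * m * x + m\<^sup>2)"
    unfolding second_cumulant_def mean_tilted[OF assms] m_def[symmetric]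
    by (simp add: power2_eq_square algebra_simps)
  also have "\<dots> = (LINT x|tilted_measure L s h. x\<^sup>2) - 2 * m * (LINT x|tilted_measure L s h. x) + m\<^sup>2"
    using integrable_tilted_power[OF assms, of L h 2] integrable_tilted_power[OF assms, of L h 1] prob_space
    by simp
  also have "\<dots> = gibbs_variance L s h"
    using integral_tilted_power[OF assms, of L h 2] mean_tilted[OF assms, of L h]
    by (simp add: gibbs_variance_def mean_def m_def power2_eq_square)
  finally show ?thesis .
qed

lemma distr_uminus_tilted:
  "distr (tilted_measure L s h) borel uminus = tilted_measure L s (- h)"
proof -
  define f where "f x = ennreal (exp (- h * x) * weight L (1 / s) x / moment L 0 (1 / s) (- h))" for x
  have [measurable]: "f \<in> borel_measurable borel" unfolding f_def by measurable
  have "f (- x) = ennreal (exp (h * x) * weight L (1 / s) x / moment L 0 (1 / s) h)" for x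
    using moment_minus[of L 0 "1 / s" h] by (simp add: f_def)
  then have "distr (tilted_measure L s h) borel uminus = distr (density lborel (\<lambda>x. f (- x))) borel uminus"
    by (simp add: tilted_measure_def)
  also have "\<dots> = density (distr lborel borel uminus) f"
    by (rule density_distr[symmetric]) auto
  also have "\<dots> = tilted_measure L s (- h)"
    unfolding f_def tilted_measure_def by (simp add: lborel_distr_uminus)
  finally show ?thesis .
qed

lemma symmetric_tilted_0: "symmetric_measure (tilted_measure L s 0)"
  by (simp add: symmetric_measure_def distr_uminus_tilted)

lemma mean_self_consistent:
  "0 < s \<Longrightarrow> self_consistent L s h \<Longrightarrow> mean (tilted_measure L s h) = s * h / L"
  by (simp add: mean_tilted self_consistent_def)

text \<open>\<open>W * \<mu>\<close> depends on \<open>\<mu>\<close> only through its mean, up to a constant. Finiteness of \<open>W * \<mu>\<close> at a point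
  gives the second moment, which is what makes this expansion legitimate.\<close>

lemma nl_stationary_iff:
  assumes L: "0 < L" and \<sigma>: "0 < \<sigma>"
  shows "nl_stationary double_well (quad_interaction L) \<sigma> \<mu>
    \<longleftrightarrow> (\<exists>h. \<mu> = tilted_measure L \<sigma> h \<and> self_consistent L \<sigma> h)"
proof -
  have gibbs: "gibbs (1 / \<sigma>) (\<lambda>x. double_well x + conv_measure (quad_interaction L) \<mu> x)
      = tilted_measure L \<sigma> (L * mean \<mu> / \<sigma>)"
    if "prob_space \<mu>" "integrable \<mu> (\<lambda>x. x)" "integrable \<mu> (\<lambda>x. x\<^sup>2)" for \<mu>
  proof (rule gibbs_eq_tilted[OF \<sigma>])
    interpret prob_space \<mu> by (rule that(1))
    fix x
    have "conv_measure (quad_interaction L) \<mu> x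
        = (LINT y|\<mu>. L / 2 * x\<^sup>2 - L * x * y + L / 2 * y\<^sup>2)"
      unfolding conv_measure_def quad_interaction_def
      by (intro Bochner_Integration.integral_cong) (auto simp: power2_eq_square field_simps)
    also have "\<dots> = L / 2 * x\<^sup>2 - L * x * mean \<mu> + L / 2 * (LINT y|\<mu>. y\<^sup>2)"
      using that by (simp add: mean_def prob_space)
    finally show "double_well x + conv_measure (quad_interaction L) \<mu> x
        = double_well x + L / 2 * x\<^sup>2 - L * mean \<mu> * x + L / 2 * (LINT y|\<mu>. y\<^sup>2)" by simp
  qed
  show ?thesis
  proof
    assume *: "nl_stationary double_well (quad_interaction L) \<sigma> \<mu>"
    then interpret prob_space \<mu> by (simp add: nl_stationary_def borel_prob_def)
    have sets: "sets \<mu> = sets borel" using * by (simp add: nl_stationary_def borel_prob_def)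
    have "integrable \<mu> (\<lambda>y. quad_interaction L (0 - y))" using * unfolding nl_stationary_def by blast
    then have "integrable \<mu> (\<lambda>y. 2 / L * (L * y\<^sup>2 / 2))"
      by (intro integrable_mult_right) (simp add: quad_interaction_def)
    then have int2: "integrable \<mu> (\<lambda>y. y\<^sup>2)" using L by simp
    have meas: "(\<lambda>y. y) \<in> borel_measurable \<mu>" using sets by (simp add: measurable_def sets_eq_imp_space_eq[OF sets])
    have int1: "integrable \<mu> (\<lambda>y. y)" using square_integrable_imp_integrable[OF meas int2] .
    define h where "h = L * mean \<mu> / \<sigma>"
    have \<mu>: "\<mu> = tilted_measure L \<sigma> h"
      using * gibbs[OF prob_space_axioms int1 int2] by (simp add: nl_stationary_def h_def)
    have "gibbs_mean L \<sigma> h = mean \<mu>"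
      using mean_tilted[OF \<sigma>, of L h] \<mu> by simp
    then have "self_consistent L \<sigma> h"
      using L \<sigma> by (simp add: self_consistent_def h_def)
    then show "\<exists>h. \<mu> = tilted_measure L \<sigma> h \<and> self_consistent L \<sigma> h" using \<mu> by blast
  next
    assume "\<exists>h. \<mu> = tilted_measure L \<sigma> h \<and> self_consistent L \<sigma> h"
    then obtain h where \<mu>: "\<mu> = tilted_measure L \<sigma> h" and sc: "self_consistent L \<sigma> h" by blast
    interpret prob_space \<mu> unfolding \<mu> by (rule prob_space_tilted[OF \<sigma>])
    have int: "integrable \<mu> (\<lambda>x. x)" "integrable \<mu> (\<lambda>x. x\<^sup>2)"
      unfolding \<mu> using integrable_tilted_power[OF \<sigma>, of L h 1] integrable_tilted_power[OF \<sigma>, of L h 2] by simp_all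
    have "L * mean \<mu> / \<sigma> = h"
      using mean_self_consistent[OF \<sigma> sc] L \<sigma> by (simp add: \<mu>)
    then have "\<mu> = gibbs (1 / \<sigma>) (\<lambda>x. double_well x + conv_measure (quad_interaction L) \<mu> x)"
      using gibbs[OF prob_space_axioms int] \<mu> by simp
    moreover have "integrable \<mu> (\<lambda>y. quad_interaction L (x - y))" for x
    proof -
      have "integrable \<mu> (\<lambda>y. L / 2 * x\<^sup>2 - L * x * y + L / 2 * y\<^sup>2)"
        using int by simp
      moreover have "(\<lambda>y. quad_interaction L (x - y)) = (\<lambda>y. L / 2 * x\<^sup>2 - L * x * y + L / 2 * y\<^sup>2)"
        by (auto simp: quad_interaction_def power2_eq_square field_simps)
      ultimately show ?thesis by simp
    qed
    ultimately show "nl_stationary double_well (quad_interaction L) \<sigma> \<mu>"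
      using prob_space_axioms by (simp add: nl_stationary_def borel_prob_def) (simp add: \<mu>)
  qed
qed

text \<open>The inverse temperature \<open>2 / (2 * \<sigma> + \<dots>)\<close> is \<open>1 / (\<sigma> + \<epsilon> * v)\<close> with \<open>v\<close> the second cumulant,
  so a stationary distribution is a tilted measure at the temperature \<open>s = \<sigma> + \<epsilon> * v\<close>.\<close>

lemma eff_stationary_iff:
  fixes p :: nat
  assumes L: "0 < L" and \<delta>: "0 < \<delta>" and p: "2 \<le> p" and \<sigma>: "0 < \<sigma>"
  defines "\<epsilon> \<equiv> \<delta> * L\<^sup>2 / (2 * (real p - 1))"
  shows "eff_stationary double_well L \<delta> p \<sigma> \<mu>
    \<longleftrightarrow> (\<exists>s h. \<mu> = tilted_measure L s h \<and> effective_state L \<epsilon> \<sigma> s h)"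
proof -
  have p1: "0 < real p - 1" using p by simp
  have \<epsilon>: "0 < \<epsilon>" using L \<delta> p1 by (simp add: \<epsilon>_def)
  have coeff: "2 / (2 * \<sigma> + \<delta> * L\<^sup>2 / (real p - 1) * v) = 1 / (\<sigma> + \<epsilon> * v)" for v
  proof -
    have "2 * \<sigma> + \<delta> * L\<^sup>2 / (real p - 1) * v = 2 * (\<sigma> + \<epsilon> * v)"
      using p1 by (simp add: \<epsilon>_def field_simps)
    moreover have "2 / (2 * t) = 1 / t" for t :: real by simp
    ultimately show ?thesis by metis
  qed
  have gibbs: "gibbs (1 / s) (\<lambda>x. double_well x + L / 2 * \<bar>x - m\<bar>\<^sup>2) = tilted_measure L s (L * m / s)"
    if "0 < s" for s m
    using that by (rule gibbs_eq_tilted[where c = "L / 2 * m\<^sup>2"]) (simp add: power2_eq_square field_simps)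
  show ?thesis
  proof
    assume *: "eff_stationary double_well L \<delta> p \<sigma> \<mu>"
    define s where "s = \<sigma> + \<epsilon> * second_cumulant \<mu>"
    define h where "h = L * mean \<mu> / s"
    have "0 \<le> second_cumulant \<mu>"
      unfolding second_cumulant_def by (intro Bochner_Integration.integral_nonneg) simp
    then have s: "0 < s" using \<sigma> \<epsilon> by (simp add: s_def add_pos_nonneg)
    have "\<mu> = gibbs (1 / s) (\<lambda>x. double_well x + L / 2 * \<bar>x - mean \<mu>\<bar>\<^sup>2)"
      unfolding s_def coeff[symmetric]
      by (rule conjunct2[OF conjunct2[OF *[unfolded eff_stationary_def]]])
    then have \<mu>: "\<mu> = tilted_measure L s h" by (simp only: gibbs[OF s] h_def)
    have "gibbs_mean L s h = mean \<mu>" using mean_tilted[OF s, of L h] \<mu> by simp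
    then have sc: "self_consistent L s h" using L s by (simp add: self_consistent_def h_def)
    have v: "second_cumulant \<mu> = gibbs_variance L s h"
      unfolding \<mu> by (rule second_cumulant_tilted[OF s])
    have "effective_state L \<epsilon> \<sigma> s h"
      by (rule effective_stateI[OF s sc s_def[unfolded v]])
    then show "\<exists>s h. \<mu> = tilted_measure L s h \<and> effective_state L \<epsilon> \<sigma> s h" using \<mu> by blast
  next
    assume "\<exists>s h. \<mu> = tilted_measure L s h \<and> effective_state L \<epsilon> \<sigma> s h"
    then obtain s h where \<mu>: "\<mu> = tilted_measure L s h" and st: "effective_state L \<epsilon> \<sigma> s h" by blast
    note s = effective_stateD(1)[OF st] and sc = effective_stateD(2)[OF st] and eq = effective_stateD(3)[OF st]
    have v: "second_cumulant \<mu> = gibbs_variance L s h" unfolding \<mu> by (rule second_cumulant_tilted[OF s])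
    have "L * mean \<mu> / s = h" using mean_self_consistent[OF s sc] L s by (simp add: \<mu>)
    then have "\<mu> = gibbs (1 / s) (\<lambda>x. double_well x + L / 2 * \<bar>x - mean \<mu>\<bar>\<^sup>2)"
      using \<mu> by (simp only: gibbs[OF s])
    moreover have "integrable \<mu> (\<lambda>x. x\<^sup>2)" "prob_space \<mu>" "sets \<mu> = sets borel"
      unfolding \<mu> using s by (simp_all add: integrable_tilted_power prob_space_tilted)
    ultimately show "eff_stationary double_well L \<delta> p \<sigma> \<mu>"
      unfolding eff_stationary_def coeff v eq[symmetric] borel_prob_def by (intro conjI)
  qed
qed

text \<open>Distinct tilts have distinct means, so uniqueness of the stationary distribution excludes \<open>h > 0\<close>,
  and a stationary distribution of positive mean provides \<open>h > 0\<close>.\<close>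

lemma critical_parameter_self_consistent:
  assumes L: "0 < L" and crit: "critical_parameter L \<sigma>\<^sub>c"
  shows "\<sigma>\<^sub>c \<le> s \<Longrightarrow> 0 < h \<Longrightarrow> \<not> self_consistent L s h"
    and "0 < s \<Longrightarrow> s < \<sigma>\<^sub>c \<Longrightarrow> \<exists>h>0. self_consistent L s h"
proof -
  have \<sigma>c: "0 < \<sigma>\<^sub>c" using crit by (simp add: critical_parameter_def)
  show "\<not> self_consistent L s h" if "\<sigma>\<^sub>c \<le> s" "0 < h"
  proof
    assume sc: "self_consistent L s h"
    have s: "0 < s" using that \<sigma>c by simp
    have "one_symmetric {\<mu>. nl_stationary double_well (quad_interaction L) s \<mu>}"
      using crit that(1) unfolding critical_parameter_def by blast
    then obtain \<mu>\<^sub>0 where "{\<mu>. nl_stationary double_well (quad_interaction L) s \<mu>} = {\<mu>\<^sub>0}"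
      unfolding one_symmetric_def by blast
    moreover have "tilted_measure L s h \<in> {\<mu>. nl_stationary double_well (quad_interaction L) s \<mu>}"
      "tilted_measure L s 0 \<in> {\<mu>. nl_stationary double_well (quad_interaction L) s \<mu>}"
      unfolding mem_Collect_eq nl_stationary_iff[OF L s] using sc self_consistent_0[OF s] by blast+
    ultimately have "tilted_measure L s h = tilted_measure L s 0" by (metis singletonD)
    then have "s * h / L = s * 0 / L"
      using mean_self_consistent[OF s sc] mean_self_consistent[OF s self_consistent_0[OF s], of L] by simp
    then show False using s L that by simp
  qed
  show "\<exists>h>0. self_consistent L s h" if s: "0 < s" "s < \<sigma>\<^sub>c"
  proof -
    define S where "S = {\<mu>. nl_stationary double_well (quad_interaction L) s \<mu>}"
    have "three_phases S"
      using crit s unfolding critical_parameter_def S_def by blast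
    then obtain \<mu> where "\<mu> \<in> S" and \<mu>: "0 < mean \<mu>"
      unfolding three_phases_def by blast
    then obtain h where h: "\<mu> = tilted_measure L s h" "self_consistent L s h"
      unfolding S_def mem_Collect_eq nl_stationary_iff[OF L s(1)] by blast
    have "0 < h"
    proof (rule ccontr)
      assume "\<not> 0 < h"
      then have "s * h / L \<le> 0" using s(1) L by (simp add: divide_nonpos_pos mult_nonneg_nonpos)
      moreover have "mean \<mu> = s * h / L"
        unfolding h(1) by (rule mean_self_consistent[OF s(1) h(2)])
      ultimately show False using \<mu> by linarith
    qed
    then show ?thesis using h(2) by (intro exI conjI)
  qed
qed

theorem theorem3:
  fixes L\<^sub>W \<sigma>\<^sub>c \<sigma>\<^sub>0 :: real
  assumes "L\<^sub>W > 0"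
    and "critical_parameter L\<^sub>W \<sigma>\<^sub>c"
    and "0 < \<sigma>\<^sub>0" and "\<sigma>\<^sub>0 < \<sigma>\<^sub>c"
  shows "\<exists>c\<^sub>0>0. \<forall>(\<delta>::real) (p::nat). \<delta> > 0 \<and> p \<ge> 2 \<and> \<delta> / (real p - 1) \<le> c\<^sub>0 \<longrightarrow>
    (let \<sigma>\<^sub>e = \<sigma>\<^sub>c * (1 - \<delta> * L\<^sub>W / (2 * (real p - 1))) in
      (\<forall>\<sigma>\<ge>\<sigma>\<^sub>e. one_symmetric {\<mu>. eff_stationary double_well L\<^sub>W \<delta> p \<sigma> \<mu>}) \<and>
      (\<forall>\<sigma>\<in>{\<sigma>\<^sub>0..<\<sigma>\<^sub>e}. three_phases {\<mu>. eff_stationary double_well L\<^sub>W \<delta> p \<sigma> \<mu>}))"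
proof -
  note L = assms(1)
  define transition where "transition \<epsilon> \<longleftrightarrow>
      \<sigma>\<^sub>0 \<le> \<sigma>\<^sub>c - \<epsilon> * (\<sigma>\<^sub>c / L\<^sub>W) \<and>
      (\<forall>\<sigma>\<ge>\<sigma>\<^sub>0. \<exists>!s. effective_state L\<^sub>W \<epsilon> \<sigma> s 0) \<and>
      (\<forall>\<sigma>\<ge>\<sigma>\<^sub>c - \<epsilon> * (\<sigma>\<^sub>c / L\<^sub>W). \<forall>s h. 0 < h \<longrightarrow> \<not> effective_state L\<^sub>W \<epsilon> \<sigma> s h) \<and>
      (\<forall>\<sigma>\<in>{\<sigma>\<^sub>0..<\<sigma>\<^sub>c - \<epsilon> * (\<sigma>\<^sub>c / L\<^sub>W)}. \<exists>s h. 0 < h \<and> effective_state L\<^sub>W \<epsilon> \<sigma> s h \<and>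
        (\<forall>s' h'. 0 < h' \<and> effective_state L\<^sub>W \<epsilon> \<sigma> s' h' \<longrightarrow> s' = s \<and> h' = h))" for \<epsilon>
  have "\<exists>\<epsilon>\<^sub>0>0. \<forall>\<epsilon>. 0 < \<epsilon> \<and> \<epsilon> \<le> \<epsilon>\<^sub>0 \<longrightarrow> transition \<epsilon>"
    unfolding transition_def
    by (rule effective_phase_transition[OF L assms(3,4) critical_parameter_self_consistent[OF L assms(2)]])
  then obtain \<epsilon>\<^sub>0 where \<epsilon>\<^sub>0: "0 < \<epsilon>\<^sub>0" "\<And>\<epsilon>. 0 < \<epsilon> \<Longrightarrow> \<epsilon> \<le> \<epsilon>\<^sub>0 \<Longrightarrow> transition \<epsilon>"
    by blast
  show ?thesis
  proof (intro exI[of _ "2 * \<epsilon>\<^sub>0 / L\<^sub>W\<^sup>2"] conjI allI impI)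
    show "0 < 2 * \<epsilon>\<^sub>0 / L\<^sub>W\<^sup>2" using \<epsilon>\<^sub>0(1) L by simp
    fix \<delta> :: real and p :: nat
    assume *: "\<delta> > 0 \<and> p \<ge> 2 \<and> \<delta> / (real p - 1) \<le> 2 * \<epsilon>\<^sub>0 / L\<^sub>W\<^sup>2"
    then have \<delta>: "0 < \<delta>" and p: "2 \<le> p" by auto
    have p1: "0 < real p - 1" using p by simp
    define \<epsilon> where "\<epsilon> = \<delta> * L\<^sub>W\<^sup>2 / (2 * (real p - 1))"
    have \<epsilon>: "0 < \<epsilon>" using L \<delta> p1 by (simp add: \<epsilon>_def)
    have "\<epsilon> = \<delta> / (real p - 1) * (L\<^sub>W\<^sup>2 / 2)" by (simp add: \<epsilon>_def)
    also have "\<dots> \<le> 2 * \<epsilon>\<^sub>0 / L\<^sub>W\<^sup>2 * (L\<^sub>W\<^sup>2 / 2)" using * by (intro mult_right_mono) auto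
    also have "\<dots> = \<epsilon>\<^sub>0" using L by simp
    finally have "\<epsilon> \<le> \<epsilon>\<^sub>0" .
    define \<sigma>\<^sub>e where "\<sigma>\<^sub>e = \<sigma>\<^sub>c * (1 - \<delta> * L\<^sub>W / (2 * (real p - 1)))"
    have \<sigma>e: "\<sigma>\<^sub>c - \<epsilon> * (\<sigma>\<^sub>c / L\<^sub>W) = \<sigma>\<^sub>e"
      using L p1 by (simp add: \<sigma>\<^sub>e_def \<epsilon>_def field_simps power2_eq_square)
    have "transition \<epsilon>" by (rule \<epsilon>\<^sub>0(2)[OF \<epsilon> \<open>\<epsilon> \<le> \<epsilon>\<^sub>0\<close>])
    note * = this[unfolded transition_def \<sigma>e]
    note \<sigma>0e = conjunct1[OF *] and symmetric = conjunct1[OF conjunct2[OF *]]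
      and no_branch = conjunct1[OF conjunct2[OF conjunct2[OF *]]]
      and branch = conjunct2[OF conjunct2[OF conjunct2[OF *]]]
    have stationary: "{\<mu>. eff_stationary double_well L\<^sub>W \<delta> p \<sigma> \<mu>}
        = {tilted_measure L\<^sub>W s h | s h. effective_state L\<^sub>W \<epsilon> \<sigma> s h}" if "\<sigma>\<^sub>0 \<le> \<sigma>" for \<sigma>
    proof -
      have \<sigma>: "0 < \<sigma>" using that assms(3) by linarith
      show ?thesis unfolding eff_stationary_iff[OF L \<delta> p \<sigma>, folded \<epsilon>_def] ..
    qed
    have "one_symmetric {\<mu>. eff_stationary double_well L\<^sub>W \<delta> p \<sigma> \<mu>}" if \<sigma>: "\<sigma>\<^sub>e \<le> \<sigma>" for \<sigma>
    proof -
      have \<sigma>0: "\<sigma>\<^sub>0 \<le> \<sigma>" using \<sigma> \<sigma>0e by simp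
      obtain s where s: "effective_state L\<^sub>W \<epsilon> \<sigma> s 0"
        and s_unique: "\<And>t. effective_state L\<^sub>W \<epsilon> \<sigma> t 0 \<Longrightarrow> t = s"
        using symmetric \<sigma>0 by blast
      have none: "\<not> effective_state L\<^sub>W \<epsilon> \<sigma> t h" if "0 < h" for t h
        using no_branch \<sigma> that by blast
      have "h = 0 \<and> t = s" if "effective_state L\<^sub>W \<epsilon> \<sigma> t h" for t h
        using that none[of h t] none[of "- h" t] s_unique[of t] effective_state_minus[of L\<^sub>W \<epsilon> \<sigma> t h]
        by (cases h "0 :: real" rule: linorder_cases) auto
      then have "{\<mu>. eff_stationary double_well L\<^sub>W \<delta> p \<sigma> \<mu>} = {tilted_measure L\<^sub>W s 0}"
        unfolding stationary[OF \<sigma>0] using s by blast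
      then show ?thesis unfolding one_symmetric_def using symmetric_tilted_0 by blast
    qed
    moreover have "three_phases {\<mu>. eff_stationary double_well L\<^sub>W \<delta> p \<sigma> \<mu>}"
      if \<sigma>: "\<sigma> \<in> {\<sigma>\<^sub>0..<\<sigma>\<^sub>e}" for \<sigma>
    proof -
      have \<sigma>0: "\<sigma>\<^sub>0 \<le> \<sigma>" using \<sigma> by simp
      obtain s where s: "effective_state L\<^sub>W \<epsilon> \<sigma> s 0"
        and s_unique: "\<And>t. effective_state L\<^sub>W \<epsilon> \<sigma> t 0 \<Longrightarrow> t = s"
        using symmetric \<sigma>0 by blast
      obtain t h where th: "0 < h" "effective_state L\<^sub>W \<epsilon> \<sigma> t h"
        and th_unique: "\<And>t' h'. 0 < h' \<Longrightarrow> effective_state L\<^sub>W \<epsilon> \<sigma> t' h' \<Longrightarrow> t' = t \<and> h' = h"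
        using branch \<sigma> by blast
      have th': "effective_state L\<^sub>W \<epsilon> \<sigma> t (- h)" using th(2) by (simp add: effective_state_minus)
      have cases: "(t' = s \<and> h' = 0) \<or> (t' = t \<and> h' = h) \<or> (t' = t \<and> h' = - h)"
        if "effective_state L\<^sub>W \<epsilon> \<sigma> t' h'" for t' h'
        using that th_unique[of h' t'] th_unique[of "- h'" t'] s_unique[of t']
          effective_state_minus[of L\<^sub>W \<epsilon> \<sigma> t' h']
        by (cases h' "0 :: real" rule: linorder_cases) auto
      have set: "{\<mu>. eff_stationary double_well L\<^sub>W \<delta> p \<sigma> \<mu>}
          = {tilted_measure L\<^sub>W s 0, tilted_measure L\<^sub>W t h, tilted_measure L\<^sub>W t (- h)}"
        unfolding stationary[OF \<sigma>0] using s th(2) th' cases by blast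
      have pos: "0 < s" "0 < t" using s th(2) by (auto simp: effective_state_def)
      have means: "mean (tilted_measure L\<^sub>W s 0) = 0" "0 < mean (tilted_measure L\<^sub>W t h)"
        "mean (tilted_measure L\<^sub>W t (- h)) < 0"
      proof -
        show "mean (tilted_measure L\<^sub>W s 0) = 0" using pos by (simp add: mean_tilted)
        have "mean (tilted_measure L\<^sub>W t h) = t * h / L\<^sub>W"
          using th(2) pos by (intro mean_self_consistent) (auto simp: effective_state_def)
        then show "0 < mean (tilted_measure L\<^sub>W t h)" using pos th(1) L by simp
        then show "mean (tilted_measure L\<^sub>W t (- h)) < 0"
          using pos by (simp add: mean_tilted gibbs_mean_minus)
      qed
      then have "distinct [tilted_measure L\<^sub>W s 0, tilted_measure L\<^sub>W t h, tilted_measure L\<^sub>W t (- h)]"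
        by auto
      then show ?thesis
        unfolding three_phases_def using set means symmetric_tilted_0 by blast
    qed
    ultimately show "let \<sigma>\<^sub>e = \<sigma>\<^sub>c * (1 - \<delta> * L\<^sub>W / (2 * (real p - 1))) in
      (\<forall>\<sigma>\<ge>\<sigma>\<^sub>e. one_symmetric {\<mu>. eff_stationary double_well L\<^sub>W \<delta> p \<sigma> \<mu>}) \<and>
      (\<forall>\<sigma>\<in>{\<sigma>\<^sub>0..<\<sigma>\<^sub>e}. three_phases {\<mu>. eff_stationary double_well L\<^sub>W \<delta> p \<sigma> \<mu>})"
      unfolding Let_def \<sigma>\<^sub>e_def by blast
  qed
qed

end
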